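(* Let $\Omega\subset\mathbb{R}^N$ be a bounded Lipschitz domain and $\alpha\ge0$. Then there exist a sequence of eigenvalues $0=\lambda_1<\lambda_2\le\lambda_3\le\cdots$ of $L_{\alpha,\mu}$ with homogeneous $(\alpha,\mu)$-Neumann conditions and corresponding eigenfunctions $u_i:\mathbb{R}^N\to\mathbb{R}$, $i\in\{1,2,\dots\}$, whose restrictions to $\Omega$ form a complete orthogonal system in $L^2(\Omega)$.
   Context: $\mu$ is a nonnegative, nontrivial finite Borel measure on $(0,1)$. For $s\in(0,1)$, $c_{N,s}:=-\frac{2^{2s-1}\Gamma(\frac{N+2s}{2})}{\pi^{N/2}\Gamma(-s)}>0$. $\mathcal Q:=\mathbb{R}^{2N}\setminus(\mathbb{R}^N\setminus\Omega)^2$, $[u]_s^2:=c_{N,s}\iint_{\mathcal Q}\frac{|u(x)-u(y)|^2}{|x-y|^{N+2s}}dxdy$. $\mathcal H_{\alpha,\mu}(\Omega)$ (homogeneous case) is the space of measurable $u:\mathbb{R}^N\to\mathbb{R}$ with $\|u\|^2_{L^2(\Omega)}+\int_{(0,1)}[u]_s^2d\mu(s)<\infty$, and additionally $u|_\Omega\in H^1(\Omega)$ if $\alpha>0$. A real number $\lambda$ is an eigenvalue, with eigenfunction $u$, if $u\in\mathcal H_{\alpha,\mu}(\Omega)$, $u\not\equiv0$, and for all $v\in\mathcal H_{\alpha,\mu}(\Omega)$: $\alpha\int_\Omega\nabla u\cdot\nabla v\,dx+\int_{(0,1)}\frac{c_{N,s}}2\iint_{\mathcal Q}\frac{(u(x)-u(y))(v(x)-v(y))}{|x-y|^{N+2s}}dxdy\,d\mu(s)=\lambda\int_\Omega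 uv\,dx$ (i.e. $u$ is a weak solution of $-\alpha\Delta u+\int_{(0,1)}(-\Delta)^su\,d\mu(s)=\lambda u$ in $\Omega$ with homogeneous Neumann conditions $\int_{(0,1)}\mathscr N_su\,d\mu=0$ outside $\overline\Omega$ and, if $\alpha>0$, $\partial_\nu u=0$ on $\partial\Omega$). *)

theory Defs
  imports "HOL-Analysis.Analysis"
begin

definition lipschitz_domain :: "'a::euclidean_space set \<Rightarrow> bool" where
  "lipschitz_domain \<Omega> \<longleftrightarrow> open \<Omega> \<and> connected \<Omega> \<and> \<Omega> \<noteq> {} \<and>
     (\<forall>x\<in>frontier \<Omega>. \<exists>r>0. \<exists>e::'a. \<exists>g::'a \<Rightarrow> real. \<exists>L. norm e = 1 \<and> L-lipschitz_on UNIV g \<and>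
        (\<forall>y\<in>ball x r. y \<in> \<Omega> \<longleftrightarrow> g (y - (y \<bullet> e) *\<^sub>R e) < y \<bullet> e))"

fun dir_deriv :: "'a::euclidean_space list \<Rightarrow> ('a \<Rightarrow> real) \<Rightarrow> 'a \<Rightarrow> real" where
  "dir_deriv [] \<phi> = \<phi>"
| "dir_deriv (e # es) \<phi> = (\<lambda>x. frechet_derivative (dir_deriv es \<phi>) (at x) e)"

definition smooth_fun :: "('a::euclidean_space \<Rightarrow> real) \<Rightarrow> bool" where
  "smooth_fun \<phi> \<longleftrightarrow> (\<forall>es x. dir_deriv es \<phi> differentiable (at x))"

definition test_fun :: "'a::euclidean_space set \<Rightarrow> ('a \<Rightarrow> real) \<Rightarrow> bool" where
  "test_fun \<Omega> \<phi> \<longleftrightarrow> smooth_fun \<phi> \<and> compact (closure {x. \<phi> x \<noteq> 0}) \<and> closure {x. \<phi> x \<noteq> 0} \<subseteq> \<Omega>"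

definition L2_on :: "'a::euclidean_space set \<Rightarrow> ('a \<Rightarrow> real) \<Rightarrow> bool" where
  "L2_on \<Omega> f \<longleftrightarrow> f \<in> borel_measurable (restrict_space lborel \<Omega>) \<and>
      (\<integral>\<^sup>+ x\<in>\<Omega>. ennreal ((f x)\<^sup>2) \<partial>lborel) < \<infinity>"

definition weak_grad :: "'a::euclidean_space set \<Rightarrow> ('a \<Rightarrow> real) \<Rightarrow> ('a \<Rightarrow> 'a) \<Rightarrow> bool" where
  "weak_grad \<Omega> u G \<longleftrightarrow> G \<in> borel_measurable (restrict_space lborel \<Omega>) \<and>
     (\<integral>\<^sup>+ x\<in>\<Omega>. ennreal ((norm (G x))\<^sup>2) \<partial>lborel) < \<infinity> \<and>
     (\<forall>\<phi>. test_fun \<Omega> \<phi> \<longrightarrow> (\<forall>i\<in>Basis.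
        (\<integral>x\<in>\<Omega>. u x * frechet_derivative \<phi> (at x) i \<partial>lborel) = - (\<integral>x\<in>\<Omega>. (G x \<bullet> i) * \<phi> x \<partial>lborel)))"

definition H1_on :: "'a::euclidean_space set \<Rightarrow> ('a \<Rightarrow> real) \<Rightarrow> bool" where
  "H1_on \<Omega> u \<longleftrightarrow> L2_on \<Omega> u \<and> (\<exists>G. weak_grad \<Omega> u G)"

definition wgrad :: "'a::euclidean_space set \<Rightarrow> ('a \<Rightarrow> real) \<Rightarrow> 'a \<Rightarrow> 'a" where
  "wgrad \<Omega> u = (SOME G. weak_grad \<Omega> u G)"

definition cNs :: "nat \<Rightarrow> real \<Rightarrow> real" where
  "cNs n s = - (2 powr (2 * s - 1) * Gamma ((real n + 2 * s) / 2)) / (pi powr (real n / 2) * Gamma (-s))"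

definition Qset :: "'a set \<Rightarrow> ('a \<times> 'a) set" where
  "Qset \<Omega> = UNIV - (UNIV - \<Omega>) \<times> (UNIV - \<Omega>)"

definition frac_seminorm_sq :: "'a::euclidean_space set \<Rightarrow> real \<Rightarrow> ('a \<Rightarrow> real) \<Rightarrow> ennreal" where
  "frac_seminorm_sq \<Omega> s u = ennreal (cNs DIM('a) s) *
     (\<integral>\<^sup>+ z\<in>Qset \<Omega>. ennreal ((u (fst z) - u (snd z))\<^sup>2 / norm (fst z - snd z) powr (real DIM('a) + 2 * s))
        \<partial>(lborel \<Otimes>\<^sub>M lborel))"

definition frac_form :: "'a::euclidean_space set \<Rightarrow> real \<Rightarrow> ('a \<Rightarrow> real) \<Rightarrow> ('a \<Rightarrow> real) \<Rightarrow> real" where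
  "frac_form \<Omega> s u v = cNs DIM('a) s / 2 *
     (\<integral>z\<in>Qset \<Omega>. (u (fst z) - u (snd z)) * (v (fst z) - v (snd z)) / norm (fst z - snd z) powr (real DIM('a) + 2 * s)
        \<partial>(lborel \<Otimes>\<^sub>M lborel))"

definition admissible_mu :: "real measure \<Rightarrow> bool" where
  "admissible_mu \<mu> \<longleftrightarrow> sets \<mu> = sets (restrict_space borel {0<..<1::real}) \<and>
     finite_measure \<mu> \<and> emeasure \<mu> (space \<mu>) \<noteq> 0"

definition H_space :: "real \<Rightarrow> real measure \<Rightarrow> 'a::euclidean_space set \<Rightarrow> ('a \<Rightarrow> real) set" where
  "H_space \<alpha> \<mu> \<Omega> = {u. u \<in> borel_measurable lborel \<and>
     (\<integral>\<^sup>+ x\<in>\<Omega>. ennreal ((u x)\<^sup>2) \<partial>lborel) + (\<integral>\<^sup>+ s. frac_seminorm_sq \<Omega> s u \<partial>\<mu>) < \<infinity> \<and>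
     (\<alpha> > 0 \<longrightarrow> H1_on \<Omega> u)}"

definition neumann_eigenpair :: "real \<Rightarrow> real measure \<Rightarrow> 'a::euclidean_space set \<Rightarrow> real \<Rightarrow> ('a \<Rightarrow> real) \<Rightarrow> bool" where
  "neumann_eigenpair \<alpha> \<mu> \<Omega> lam u \<longleftrightarrow> u \<in> H_space \<alpha> \<mu> \<Omega> \<and> (\<exists>x. u x \<noteq> 0) \<and>
     (\<forall>v\<in>H_space \<alpha> \<mu> \<Omega>.
        \<alpha> * (\<integral>x\<in>\<Omega>. wgrad \<Omega> u x \<bullet> wgrad \<Omega> v x \<partial>lborel) + (\<integral>s. frac_form \<Omega> s u v \<partial>\<mu>)
        = lam * (\<integral>x\<in>\<Omega>. u x * v x \<partial>lborel))"

end

theory Submission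
  imports Defs
begin

text \<open>
  On the space \<open>H\<close> the energy is a symmetric positive semidefinite form \<open>a\<close>, and the eigenfunctions are
  obtained by successively minimising the Rayleigh quotient \<open>a(u,u) / b(u,u)\<close>, where \<open>b\<close> is the
  inner product of \<open>L\<^sup>2(\<Omega>)\<close>. This needs that \<open>H\<close> is complete for \<open>a + b\<close> and that bounded sequences of \<open>H\<close>
  have subsequences that are Cauchy in \<open>L\<^sup>2(\<Omega>)\<close>.

  Completeness: the nonlocal form is the \<open>L\<^sup>2\<close> inner product of weighted differences
  \<open>(u(x) - u(y)) k\<^sub>s(x,y)\<close>; if these and \<open>u\<^sub>n\<close> on \<open>\<Omega>\<close> converge almost everywhere along a subsequence, then so does
  \<open>u\<^sub>n\<close> on the whole space, and Fatou's lemma applies.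

  Compactness: the energy contains the interaction of points of \<open>\<Omega>\<close> with all points of the space.
  Hence for \<open>x \<in> \<Omega>\<close> the value \<open>u(x)\<close> can be compared with the mean of \<open>u\<close> over a full ball of radius \<open>\<delta>\<close>
  containing \<open>x\<close>, with an \<open>L\<^sup>2\<close> error of order \<open>\<delta>\<^sup>a\<close> for some \<open>a > 0\<close> with \<open>\<mu>([a,1)) > 0\<close>, and finitely many means
  suffice.

  Finally, functions of zero energy are constant, and an \<open>L\<^sup>2\<close> function orthogonal to all
  eigenfunctions is orthogonal to \<open>H\<close>, which contains the test functions because \<open>c\<^sub>N\<^sub>,\<^sub>s\<close> is of order \<open>s(1 - s)\<close>.
\<close>

section \<open>Eigenfunctions of a pair of quadratic forms\<close>

text \<open>Elements of \<open>H\<close> are functions on the whole space and not classes, and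
  neither \<open>aform\<close> nor \<open>bform\<close> is definite. The spectral argument therefore
  runs for a pair of semidefinite forms, whose limits exist without being unique.
  \<open>wgrad\<close> is a choice and linear only almost everywhere, which integrals do not see.
  The measure \<mu> may charge exponents arbitrarily close to 0 and to 1. For \<open>s\<close> near
  1 the kernel is critical at the diagonal, for \<open>s\<close> near 0 at infinity; the energy of a
  smooth function blows up like \<open>1 / (s * (1 - s))\<close> before it is multiplied by the
  constant, and this product stays bounded. For compactness no single exponent is given either. On
  pairs at distance at most \<open>R\<close>, with \<open>R \<ge> 1\<close>, every kernel with
  \<open>s \<ge> a\<close> is at least \<open>1 / R\<^sup>2\<close> times the kernel of exponent
  \<open>a\<close>, so the mixed energy controls one fractional energy of order \<open>a\<close>.
  Density of the eigenfunctions rests on the divergence of the eigenvalues: an orthonormal sequence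
  of bounded energy would contradict compactness, and the residual \<open>p n\<close> of
  \<open>v\<close> after \<open>n\<close> eigenfunctions satisfies
  \<open>a (u n) (u n) * b (p n) (p n) \<le> a v v\<close>.\<close>

lemma linear_coeff_zero:
  fixes p r :: real
  assumes "\<And>t. 0 \<le> 2 * t * p + t\<^sup>2 * r"
  shows "p = 0"
proof (rule ccontr)
  assume p: "p \<noteq> 0"
  \<comment> \<open>Any positive \<open>k > r\<close> works: at \<open>t = - p / k\<close> the
    negative linear term outweighs the quadratic one.\<close>
  define k where "k = \<bar>r\<bar> + 1"
  have k: "k > 0" "r < k" by (auto simp: k_def)
  have "0 \<le> 2 * (- p / k) * p + (- p / k)\<^sup>2 * r" by (rule assms)
  also have "\<dots> = p\<^sup>2 / k * (r / k - 2)"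
    using k by (simp add: field_simps power2_eq_square)
  finally have "0 \<le> r / k - 2"
    using k p by (simp add: zero_le_mult_iff zero_le_divide_iff)
  moreover have "r / k < 1" using k by simp
  ultimately show False by simp
qed

abbreviation quad :: "('v \<Rightarrow> 'v \<Rightarrow> real) \<Rightarrow> 'v \<Rightarrow> real" where "quad q u \<equiv> q u u"

text \<open>Only semidefinite, because functions that agree almost everywhere are not identified.
  The locale serves both forms on \<open>H\<close> and again the \<open>L\<^sup>2\<close> product of
  square integrable functions, so that all of them get Cauchy-Schwarz from here. The single closure
  axiom suffices for multiples too, as \<open>c * u = u + (c - 1) * u\<close>.\<close>

locale psd_form =
  fixes H :: "('x \<Rightarrow> real) set" and q :: "('x \<Rightarrow> real) \<Rightarrow> ('x \<Rightarrow> real) \<Rightarrow> real"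
  assumes lin_closed: "\<And>u v c. u \<in> H \<Longrightarrow> v \<in> H \<Longrightarrow> (\<lambda>x. u x + c * v x) \<in> H"
    and sym: "\<And>u v. u \<in> H \<Longrightarrow> v \<in> H \<Longrightarrow> q u v = q v u"
    and lin: "\<And>u v w c. u \<in> H \<Longrightarrow> v \<in> H \<Longrightarrow> w \<in> H \<Longrightarrow> q (\<lambda>x. u x + c * v x) w = q u w + c * q v w"
    and nonneg: "\<And>u. u \<in> H \<Longrightarrow> 0 \<le> q u u"
begin

lemma add_closed: "u \<in> H \<Longrightarrow> v \<in> H \<Longrightarrow> (\<lambda>x. u x + v x) \<in> H"
  using lin_closed[of u v 1] by simp

lemma diff_closed: "u \<in> H \<Longrightarrow> v \<in> H \<Longrightarrow> (\<lambda>x. u x - v x) \<in> H"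
  using lin_closed[of u v "-1"] by simp

lemma scale_closed: "u \<in> H \<Longrightarrow> (\<lambda>x. c * u x) \<in> H"
  using lin_closed[of u u "c - 1"] by (simp add: algebra_simps)

lemma lin_right:
  "u \<in> H \<Longrightarrow> v \<in> H \<Longrightarrow> w \<in> H \<Longrightarrow> q w (\<lambda>x. u x + c * v x) = q w u + c * q w v"
  using lin[of u v w c] sym[of w "\<lambda>x. u x + c * v x"] sym[of w u] sym[of w v] lin_closed[of u v c] by simp

lemma diff: "u \<in> H \<Longrightarrow> v \<in> H \<Longrightarrow> w \<in> H \<Longrightarrow> q (\<lambda>x. u x - v x) w = q u w - q v w"
  using lin[of u v w "-1"] by simp

lemma scale: "u \<in> H \<Longrightarrow> w \<in> H \<Longrightarrow> q (\<lambda>x. c * u x) w = c * q u w"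
  using lin[of u u w "c - 1"] by (simp add: algebra_simps)

lemma scale_right: "u \<in> H \<Longrightarrow> w \<in> H \<Longrightarrow> q w (\<lambda>x. c * u x) = c * q w u"
  using lin_right[of u u w "c - 1"] by (simp add: algebra_simps)

lemma quadratic:
  assumes "u \<in> H" "v \<in> H"
  shows "quad q (\<lambda>x. u x + c * v x) = q u u + 2 * c * q u v + c\<^sup>2 * q v v"
  using assms lin_closed[OF assms] sym[OF assms]
  by (simp add: lin lin_right algebra_simps power2_eq_square)

lemma quadratic_diff:
  assumes "u \<in> H" "v \<in> H"
  shows "quad q (\<lambda>x. u x - v x) = q u u - 2 * q u v + q v v"
  using quadratic[OF assms, of "-1"] by simp

lemma parallelogram:
  assumes "u \<in> H" "v \<in> H"
  shows "quad q (\<lambda>x. u x - v x) =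
    2 * q u u + 2 * q v v - quad q (\<lambda>x. u x + v x)"
  using quadratic_diff[OF assms] quadratic[OF assms, of 1] by simp

lemma diff_diff_le:
  assumes "u \<in> H" "v \<in> H"
  shows "quad q (\<lambda>x. u x - v x) \<le> 2 * q u u + 2 * q v v"
  using parallelogram[OF assms] nonneg[OF add_closed[OF assms]] by simp

text \<open>The usual discriminant argument, with the degenerate directions \<open>q v v = 0\<close>
  treated separately since they cannot be excluded.\<close>

lemma cauchy_schwarz:
  assumes "u \<in> H" "v \<in> H"
  shows "\<bar>q u v\<bar> \<le> sqrt (q u u) * sqrt (q v v)"
proof -
  have *: "0 \<le> q u u + 2 * c * q u v + c\<^sup>2 * q v v" for c
    using nonneg[OF lin_closed[OF assms]] quadratic[OF assms] by metis
  have "(q u v)\<^sup>2 \<le> q u u * q v v"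
  proof (cases "q v v = 0")
    case True
    have "q u v = 0"
    proof (rule ccontr)
      \<comment> \<open>With \<open>q v v = 0\<close> the expression is affine in \<open>c\<close>;
        the chosen \<open>c\<close> gives it the value -1.\<close>
      assume "q u v \<noteq> 0"
      then show False using *[of "- (q u u + 1) / (2 * q u v)"] True
        by (simp add: field_simps)
    qed
    then show ?thesis using True by simp
  next
    case False
    then have pos: "q v v > 0" using nonneg[OF assms(2)] by simp
    \<comment> \<open>The minimiser of the quadratic polynomial in \<open>c\<close>.\<close>
    show ?thesis using *[of "- q u v / q v v"] pos
      by (simp add: field_simps power2_eq_square)
  qed
  then show ?thesis
    by (metis real_sqrt_abs real_sqrt_le_iff real_sqrt_mult)
qed

lemma tendsto_form:
  assumes w: "\<And>k. w k \<in> H" and v: "v \<in> H" and u: "u \<in> H"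
    and lim: "(\<lambda>k. quad q (\<lambda>x. w k x - v x)) \<longlonglongrightarrow> 0"
  shows "(\<lambda>k. q (w k) u) \<longlonglongrightarrow> q v u"
proof -
  have "(\<lambda>k. q (\<lambda>x. w k x - v x) u) \<longlonglongrightarrow> 0"
  proof (rule Lim_null_comparison)
    show "\<forall>\<^sub>F k in sequentially. norm (q (\<lambda>x. w k x - v x) u)
        \<le> sqrt (quad q (\<lambda>x. w k x - v x)) * sqrt (q u u)"
      using cauchy_schwarz[OF diff_closed[OF w v] u] by simp
    show "(\<lambda>k. sqrt (quad q (\<lambda>x. w k x - v x)) * sqrt (q u u)) \<longlonglongrightarrow> 0"
      using tendsto_mult_left_zero[OF tendsto_real_sqrt[OF lim, simplified]] by simp
  qed
  then have "(\<lambda>k. q (w k) u - q v u) \<longlonglongrightarrow> 0"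
    using diff[OF w v u] by simp
  then show ?thesis by (simp add: LIM_zero_iff)
qed

lemma tendsto_form_self:
  assumes w: "\<And>k. w k \<in> H" and v: "v \<in> H"
    and lim: "(\<lambda>k. quad q (\<lambda>x. w k x - v x)) \<longlonglongrightarrow> 0"
  shows "(\<lambda>k. q (w k) (w k)) \<longlonglongrightarrow> q v v"
proof -
  have eq: "q (w k) (w k) = quad q (\<lambda>x. w k x - v x) + 2 * q (w k) v - q v v" for k
    using quadratic_diff[OF w v] by simp
  have "(\<lambda>k. quad q (\<lambda>x. w k x - v x) + 2 * q (w k) v - q v v)
     \<longlonglongrightarrow> 0 + 2 * q v v - q v v"
    by (intro tendsto_intros lim tendsto_form[OF w v v lim])
  then show ?thesis by (simp add: eq)
qed

lemma sub_sum_closed: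
  fixes n :: nat
  assumes "v \<in> H" "\<And>i. i < n \<Longrightarrow> f i \<in> H"
  shows "(\<lambda>x. v x - (\<Sum>i<n. c i * f i x)) \<in> H"
  using assms(2)
proof (induction n)
  case 0 then show ?case using assms(1) by simp
next
  case (Suc n)
  have "(\<lambda>x. (v x - (\<Sum>i<n. c i * f i x)) + (- c n) * f n x) \<in> H"
    by (intro lin_closed) (use Suc in auto)
  then show ?case by (simp add: algebra_simps)
qed

lemma sub_sum:
  fixes n :: nat
  assumes "v \<in> H" "\<And>i. i < n \<Longrightarrow> f i \<in> H" "w \<in> H"
  shows "q (\<lambda>x. v x - (\<Sum>i<n. c i * f i x)) w = q v w - (\<Sum>i<n. c i * q (f i) w)"
  using assms(2)
proof (induction n)
  case 0 then show ?case by simp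
next
  case (Suc n)
  have "q (\<lambda>x. (v x - (\<Sum>i<n. c i * f i x)) + (- c n) * f n x) w =
      q (\<lambda>x. v x - (\<Sum>i<n. c i * f i x)) w + (- c n) * q (f n) w"
    by (intro lin sub_sum_closed) (use Suc assms in auto)
  also have "\<dots> = q v w - (\<Sum>i<Suc n. c i * q (f i) w)"
    using Suc by simp
  finally show ?case by (simp add: algebra_simps)
qed

text \<open>\<open>p\<close> is \<open>v\<close> minus its orthogonal projection onto the span of
  the \<open>f i\<close>; the last fact is Pythagoras and contains Bessel's inequality.\<close>

lemma orthonormal_residual:
  fixes n :: nat
  assumes "v \<in> H" and f: "\<And>i. i < n \<Longrightarrow> f i \<in> H"
    and on: "\<And>i j. i < n \<Longrightarrow> j < n \<Longrightarrow> q (f i) (f j) = (if i = j then 1 else 0)"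
  defines "p \<equiv> (\<lambda>x. v x - (\<Sum>i<n. q v (f i) * f i x))"
  shows "p \<in> H" "\<And>j. j < n \<Longrightarrow> q p (f j) = 0"
    "q p p = q v v - (\<Sum>i<n. (q v (f i))\<^sup>2)"
proof -
  show pH: "p \<in> H" unfolding p_def by (intro sub_sum_closed assms)
  show orth: "q p (f j) = 0" if "j < n" for j
  proof -
    have "(\<Sum>i<n. q v (f i) * q (f i) (f j)) = (\<Sum>i<n. if i = j then q v (f i) else 0)"
      by (intro sum.cong refl) (use on that in auto)
    then show ?thesis using that sub_sum[where n=n and f=f and c="\<lambda>i. q v (f i)", OF assms(1) f f[OF that]]
      by (simp add: p_def)
  qed
  have "q p p = q v p - (\<Sum>i<n. q v (f i) * q (f i) p)"
    using sub_sum[where n=n and f=f and c="\<lambda>i. q v (f i)", OF assms(1) f pH] by (simp add: p_def)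
  also have "(\<Sum>i<n. q v (f i) * q (f i) p) = 0"
    using orth sym[OF pH f] by (intro sum.neutral) auto
  also have "q v p = q p v" using sym[OF pH assms(1)] by simp
  also have "q p v = q v v - (\<Sum>i<n. q v (f i) * q (f i) v)"
    using sub_sum[where n=n and f=f and c="\<lambda>i. q v (f i)", OF assms(1) f assms(1)] by (simp add: p_def)
  also have "(\<Sum>i<n. q v (f i) * q (f i) v) = (\<Sum>i<n. (q v (f i))\<^sup>2)"
    by (intro sum.cong refl) (use sym[OF assms(1) f] in \<open>auto simp: power2_eq_square\<close>)
  finally show "q p p = q v v - (\<Sum>i<n. (q v (f i))\<^sup>2)" by simp
qed

lemma bessel:
  fixes n :: nat
  assumes "v \<in> H" "\<And>i. i < n \<Longrightarrow> f i \<in> H"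
    and "\<And>i j. i < n \<Longrightarrow> j < n \<Longrightarrow> q (f i) (f j) = (if i = j then 1 else 0)"
  shows "(\<Sum>i<n. (q v (f i))\<^sup>2) \<le> q v v"
  using orthonormal_residual(1,3)[where n=n and f=f, OF assms] nonneg by fastforce

end

text \<open>\<open>complete\<close> is completeness for the norm of \<open>a + b\<close>,
  \<open>compact\<close> is compactness of the embedding of this space into \<open>H\<close> with
  the norm of \<open>b\<close>, and \<open>infinite_dim\<close> ensures that the successive
  minimisation never runs out of directions.\<close>

locale compact_form_pair = A: psd_form H a + B: psd_form H b
  for H :: "('x \<Rightarrow> real) set" and a b +
  assumes complete: "\<And>w. (\<And>k. w k \<in> H) \<Longrightarrow>
      (\<And>e. e > 0 \<Longrightarrow> \<exists>K. \<forall>m\<ge>K. \<forall>n\<ge>K. quad a (\<lambda>x. w m x - w n x)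
          + quad b (\<lambda>x. w m x - w n x) < e) \<Longrightarrow>
      \<exists>v\<in>H. (\<lambda>k. quad a (\<lambda>x. w k x - v x)) \<longlonglongrightarrow> 0 \<and>
            (\<lambda>k. quad b (\<lambda>x. w k x - v x)) \<longlonglongrightarrow> 0"
    and compact: "\<And>w C. (\<And>k. w k \<in> H) \<Longrightarrow> (\<And>k. a (w k) (w k) + b (w k) (w k) \<le> C) \<Longrightarrow>
      \<exists>r::nat \<Rightarrow> nat. strict_mono r \<and> (\<forall>e>0. \<exists>K. \<forall>m\<ge>K. \<forall>n\<ge>K.
          quad b (\<lambda>x. w (r m) x - w (r n) x) < e)"
    and infinite_dim: "\<exists>w::nat \<Rightarrow> 'x \<Rightarrow> real. (\<forall>k. w k \<in> H) \<and>
          (\<forall>j k. b (w j) (w k) = (if j = k then 1 else 0))"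
begin

text \<open>Double counting. If each of the \<open>n + 1\<close> vectors \<open>w 0\<close>, ...,
  \<open>w n\<close> had a projection of squared norm at least 1 onto the span of the
  \<open>f i\<close>, these squares would add up to at least \<open>n + 1\<close>; Bessel's
  inequality for each \<open>f i\<close> against the \<open>w k\<close> bounds the same sum by
  \<open>n\<close>.\<close>

lemma orthogonal_unit_exists:
  fixes n :: nat
  assumes f: "\<And>i. i < n \<Longrightarrow> f i \<in> H"
    and on: "\<And>i j. i < n \<Longrightarrow> j < n \<Longrightarrow> b (f i) (f j) = (if i = j then 1 else 0)"
  shows "\<exists>v\<in>H. b v v = 1 \<and> (\<forall>i<n. b v (f i) = 0)"
proof -
  from infinite_dim obtain w :: "nat \<Rightarrow> 'x \<Rightarrow> real" where w: "\<And>k. w k \<in> H"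
    and won: "\<And>j k. b (w j) (w k) = (if j = k then 1 else 0)" by blast
  have "\<exists>k<Suc n. (\<Sum>i<n. (b (w k) (f i))\<^sup>2) < 1"
  proof (rule ccontr)
    assume "\<not> ?thesis"
    then have "(\<Sum>k<Suc n. 1) \<le> (\<Sum>k<Suc n. \<Sum>i<n. (b (w k) (f i))\<^sup>2)"
      by (intro sum_mono) (meson lessThan_iff not_less)
    also have "\<dots> = (\<Sum>i<n. \<Sum>k<Suc n. (b (w k) (f i))\<^sup>2)" by (rule sum.swap)
    also have "\<dots> \<le> (\<Sum>i<n. 1)"
    proof (rule sum_mono)
      fix i assume i: "i \<in> {..<n}"
      have "(\<Sum>k<Suc n. (b (w k) (f i))\<^sup>2) = (\<Sum>k<Suc n. (b (f i) (w k))\<^sup>2)"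
        using B.sym[OF w f] i by (intro sum.cong refl) simp
      also have "\<dots> \<le> b (f i) (f i)" using i by (intro B.bessel f w won) auto
      finally show "(\<Sum>k<Suc n. (b (w k) (f i))\<^sup>2) \<le> 1" using on i by simp
    qed
    finally show False by simp
  qed
  then obtain k where k: "(\<Sum>i<n. (b (w k) (f i))\<^sup>2) < 1" by blast
  define p where "p = (\<lambda>x. w k x - (\<Sum>i<n. b (w k) (f i) * f i x))"
  have r: "p \<in> H" "\<And>i. i < n \<Longrightarrow> b p (f i) = 0"
    "b p p = b (w k) (w k) - (\<Sum>i<n. (b (w k) (f i))\<^sup>2)"
    unfolding p_def using w f on by (blast intro: B.orthonormal_residual)+
  have pos: "b p p > 0" using r(3) k won by simp
  define v where "v = (\<lambda>x. (1 / sqrt (b p p)) * p x)"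
  have pH: "p \<in> H" using r(1) by blast
  have "v \<in> H" unfolding v_def by (rule B.scale_closed[OF pH])
  moreover have "b v v = 1"
    using pos pH unfolding v_def
    by (simp add: B.scale B.scale_right B.scale_closed flip: power2_eq_square
        del: times_divide_eq_left times_divide_eq_right)
       (simp add: field_simps power2_eq_square)
  moreover have "b v (f i) = 0" if "i < n" for i
    using r(2)[OF that] f[OF that] pH unfolding v_def by (simp add: B.scale del: times_divide_eq_left times_divide_eq_right)
  ultimately show ?thesis by blast
qed

text \<open>The Rayleigh quotient attains its minimum on the complement of finitely many
  eigenfunctions: by the parallelogram law a minimising sequence that is Cauchy for \<open>b\<close>
  is Cauchy for \<open>a\<close> too.\<close>

lemma next_eigenfunction:
  fixes n :: nat
  assumes f: "\<And>i. i < n \<Longrightarrow> f i \<in> H"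
    and on: "\<And>i j. i < n \<Longrightarrow> j < n \<Longrightarrow> b (f i) (f j) = (if i = j then 1 else 0)"
    and eig: "\<And>i w. i < n \<Longrightarrow> w \<in> H \<Longrightarrow> a (f i) w = a (f i) (f i) * b (f i) w"
  shows "\<exists>v\<in>H. b v v = 1 \<and> (\<forall>i<n. b v (f i) = 0) \<and>
    (\<forall>w\<in>H. (\<forall>i<n. b w (f i) = 0) \<longrightarrow> a v v * b w w \<le> a w w) \<and>
    (\<forall>w\<in>H. a v w = a v v * b v w)"
proof -
  define V where "V = {w\<in>H. \<forall>i<n. b w (f i) = 0}"
  have VH: "w \<in> H" if "w \<in> V" for w using that by (simp add: V_def)
  have Vlin: "(\<lambda>x. u x + c * v x) \<in> V" if "u \<in> V" "v \<in> V" for u v c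
    using that f by (auto simp: V_def B.lin intro: B.lin_closed)
  define S where "S = {a w w | w. w \<in> V \<and> b w w = 1}"
  define L where "L = Inf S"
  have "S \<noteq> {}" using orthogonal_unit_exists[OF f on] by (auto simp: S_def V_def)
  have bdd: "bdd_below S" unfolding S_def using A.nonneg VH by (intro bdd_belowI[of _ 0]) auto
  have L0: "0 \<le> L" unfolding L_def using \<open>S \<noteq> {}\<close> A.nonneg VH
    by (intro cInf_greatest) (auto simp: S_def)
  have ray1: "L \<le> a w w" if "w \<in> V" "b w w = 1" for w
    unfolding L_def using that by (intro cInf_lower bdd) (auto simp: S_def)
  have ray: "L * b w w \<le> a w w" if w: "w \<in> V" for w
  proof (cases "b w w = 0")
    case True then show ?thesis using A.nonneg VH w by simp
  next
    case False
    then have pos: "b w w > 0" using B.nonneg VH w by (simp add: less_le)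
    define c where "c = 1 / sqrt (b w w)"
    have cc: "c * c = 1 / b w w" using pos by (simp add: c_def)
    have "(\<lambda>x. c * w x) \<in> V" using Vlin[OF w w, of "c - 1"] by (simp add: algebra_simps)
    moreover have "quad b (\<lambda>x. c * w x) = 1"
      using VH[OF w] pos cc by (simp add: B.scale B.scale_right B.scale_closed flip: mult.assoc)
    ultimately have "L \<le> quad a (\<lambda>x. c * w x)" by (rule ray1)
    also have "\<dots> = a w w / b w w"
      using VH[OF w] cc by (simp add: A.scale A.scale_right A.scale_closed flip: mult.assoc)
    finally show ?thesis using pos by (simp add: field_simps)
  qed
  have "\<exists>w. w \<in> V \<and> b w w = 1 \<and> a w w < L + 1 / (real k + 1)" for k :: nat
  proof -
    have "\<exists>x\<in>S. x < L + 1 / (real k + 1)"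
      unfolding L_def using \<open>S \<noteq> {}\<close> bdd by (subst cInf_less_iff[symmetric]) auto
    then show ?thesis by (auto simp: S_def)
  qed
  then obtain w0 where w0: "\<And>k. w0 k \<in> V" "\<And>k. b (w0 k) (w0 k) = 1"
    "\<And>k. a (w0 k) (w0 k) < L + 1 / (real k + 1)" by metis
  have "a (w0 k) (w0 k) + b (w0 k) (w0 k) \<le> L + 2" for k
  proof -
    have "1 / (real k + 1) \<le> 1" by simp
    then show ?thesis using w0(2)[of k] w0(3)[of k] by linarith
  qed
  from compact[of w0, OF VH[OF w0(1)] this] obtain r :: "nat \<Rightarrow> nat" where r: "strict_mono r"
    and rc: "\<And>e. e > 0 \<Longrightarrow> \<exists>K. \<forall>m\<ge>K. \<forall>n\<ge>K.
          quad b (\<lambda>x. w0 (r m) x - w0 (r n) x) < e" by blast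
  define w where "w k = w0 (r k)" for k
  have wV: "w k \<in> V" and wH: "w k \<in> H" and bw: "b (w k) (w k) = 1" for k
    using w0 VH by (auto simp: w_def)
  have alim: "(\<lambda>k. a (w k) (w k)) \<longlonglongrightarrow> L"
  proof (rule tendsto_sandwich)
    show "\<forall>\<^sub>F k in sequentially. L \<le> a (w k) (w k)" using ray1[OF wV bw] by simp
    show "\<forall>\<^sub>F k in sequentially. a (w k) (w k) \<le> L + 1 / (real (r k) + 1)"
      using w0(3) by (auto simp: w_def less_imp_le)
    have "(\<lambda>k. L + 1 / (real k + 1)) \<longlonglongrightarrow> L + 0"
      by (intro tendsto_add tendsto_const)
         (use LIMSEQ_inverse_real_of_nat in \<open>simp add: inverse_eq_divide add.commute\<close>)
    from LIMSEQ_subseq_LIMSEQ[OF this r]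
    show "(\<lambda>k. L + 1 / (real (r k) + 1)) \<longlonglongrightarrow> L" by (simp add: o_def)
  qed auto
  \<comment> \<open>The sum of two members of \<open>V\<close> is in \<open>V\<close>, so its energy
    is at least \<open>L\<close> times its \<open>b\<close>-square. The parallelogram laws turn this
    lower bound for the sum into an upper bound for the difference.\<close>
  have adiff: "quad a (\<lambda>x. w m x - w l x) \<le> 2 * (a (w m) (w m) - L)
      + 2 * (a (w l) (w l) - L) + L * quad b (\<lambda>x. w m x - w l x)" for m l
  proof -
    have "L * quad b (\<lambda>x. w m x + w l x) \<le> quad a (\<lambda>x. w m x + w l x)"
      using ray[OF Vlin[OF wV wV, of m 1 l]] by simp
    then have "L * (4 - quad b (\<lambda>x. w m x - w l x)) \<le> quad a (\<lambda>x. w m x + w l x)"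
      using B.parallelogram[OF wH wH, of m l] bw by simp
    then show ?thesis using A.parallelogram[OF wH wH, of m l] by (simp add: algebra_simps)
  qed
  have cau: "\<exists>K. \<forall>m\<ge>K. \<forall>n\<ge>K. quad a (\<lambda>x. w m x - w n x)
          + quad b (\<lambda>x. w m x - w n x) < e" if "e > 0" for e
  proof -
    have "\<forall>\<^sub>F m in sequentially. a (w m) (w m) < L + e / 8"
      using order_tendstoD(2)[OF alim, of "L + e/8"] that by simp
    then obtain K1 where K1: "\<And>m. m \<ge> K1 \<Longrightarrow> a (w m) (w m) < L + e / 8"
      unfolding eventually_sequentially by blast
    \<comment> \<open>The \<open>b\<close>-distance enters with factor \<open>L\<close> through
      \<open>adiff\<close> and with factor 1 by itself, and may use up \<open>e / 2\<close>; the two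
      energy excesses account for \<open>2 * e / 8\<close> each.\<close>
    have "e / (2 * (L + 1)) > 0" using that L0 by simp
    then obtain K2 where K2: "\<And>m n. m \<ge> K2 \<Longrightarrow> n \<ge> K2 \<Longrightarrow>
        quad b (\<lambda>x. w m x - w n x) < e / (2 * (L + 1))"
      using rc unfolding w_def by meson
    show ?thesis
    proof (intro exI[of _ "max K1 K2"] allI impI)
      fix m l assume ml: "m \<ge> max K1 K2" "l \<ge> max K1 K2"
      let ?d = "quad b (\<lambda>x. w m x - w l x)"
      have "(L + 1) * ?d < e / 2"
        using K2[of m l] ml L0 by (simp add: field_simps)
      moreover have "a (w m) (w m) < L + e / 8" "a (w l) (w l) < L + e / 8"
        using K1 ml by auto
      ultimately show "quad a (\<lambda>x. w m x - w l x) + ?d < e"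
        using adiff[of m l] by (simp add: algebra_simps)
    qed
  qed
  from complete[OF wH cau] obtain v where vH: "v \<in> H"
    and va: "(\<lambda>k. quad a (\<lambda>x. w k x - v x)) \<longlonglongrightarrow> 0"
    and vb: "(\<lambda>k. quad b (\<lambda>x. w k x - v x)) \<longlonglongrightarrow> 0" by blast
  have bv: "b v v = 1"
    using LIMSEQ_unique[OF B.tendsto_form_self[OF wH vH vb]] bw by simp
  have av: "a v v = L"
    using LIMSEQ_unique[OF A.tendsto_form_self[OF wH vH va] alim] .
  have bvf: "b v (f i) = 0" if "i < n" for i
  proof -
    have "b (w k) (f i) = 0" for k using wV[of k] that by (simp add: V_def)
    then show ?thesis
      using LIMSEQ_unique[OF B.tendsto_form[OF wH vH f[OF that] vb]] by simp
  qed
  have vV: "v \<in> V" using vH bvf by (simp add: V_def)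
  \<comment> \<open>\<open>a w w - L * b w w\<close> is nonnegative on \<open>V\<close> and vanishes
    at \<open>v\<close>, so its first variation at \<open>v\<close> is zero in every direction of
    \<open>V\<close>.\<close>
  have ELV: "a v z = L * b v z" if z: "z \<in> V" for z
  proof -
    have "0 \<le> 2 * t * (a v z - L * b v z) + t\<^sup>2 * (a z z - L * b z z)" for t
      using ray[OF Vlin[OF vV z, of t]] VH[OF z] vH bv av
      by (simp add: A.quadratic B.quadratic algebra_simps)
    from linear_coeff_zero[OF this] show ?thesis by simp
  qed
  \<comment> \<open>From \<open>V\<close> to all of \<open>H\<close>: the part of \<open>z\<close>
    removed by the projection is a combination of the \<open>f i\<close>, to which \<open>v\<close>
    is orthogonal for \<open>b\<close> and, as they are eigenfunctions, for \<open>a\<close> as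
    well.\<close>
  have EL: "a v z = L * b v z" if z: "z \<in> H" for z
  proof -
    define p where "p = (\<lambda>x. z x - (\<Sum>i<n. b z (f i) * f i x))"
    have pH: "p \<in> H" unfolding p_def by (rule B.orthonormal_residual(1)[OF z f on])
    have pV: "p \<in> V" using pH B.orthonormal_residual(2)[where n=n and f=f, OF z f on] by (simp add: V_def p_def)
    have afv: "a v (f i) = 0" if "i < n" for i
      using eig[OF that vH] bvf[OF that] A.sym[OF vH f[OF that]] B.sym[OF vH f[OF that]] by simp
    have "a p v = a z v - (\<Sum>i<n. b z (f i) * a (f i) v)"
      unfolding p_def by (rule A.sub_sum[OF z f vH])
    also have "(\<Sum>i<n. b z (f i) * a (f i) v) = 0"
      using afv A.sym[OF vH f] by (intro sum.neutral) auto
    finally have "a v z = a v p" using A.sym[OF vH z] A.sym[OF vH pH] by simp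
    moreover have "b p v = b z v - (\<Sum>i<n. b z (f i) * b (f i) v)"
      unfolding p_def by (rule B.sub_sum[OF z f vH])
    moreover have "(\<Sum>i<n. b z (f i) * b (f i) v) = 0"
      using bvf B.sym[OF vH f] by (intro sum.neutral) auto
    ultimately show ?thesis using ELV[OF pV] B.sym[OF vH z] B.sym[OF vH pH] by simp
  qed
  show ?thesis
    using vH bv bvf av EL ray by (intro bexI[of _ v]) (auto simp: V_def)
qed

text \<open>The eigenvalues are not separate objects: as \<open>b (u n) (u n) = 1\<close>, the
  eigenvalue of \<open>u n\<close> is its energy \<open>a (u n) (u n)\<close>.\<close>

theorem eigenfunction_sequence:
  obtains u :: "nat \<Rightarrow> 'x \<Rightarrow> real"
  where "\<And>n. u n \<in> H" "\<And>i j. b (u i) (u j) = (if i = j then 1 else 0)"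
    and "\<And>n w. w \<in> H \<Longrightarrow> a (u n) w = a (u n) (u n) * b (u n) w"
    and "\<And>n w. w \<in> H \<Longrightarrow> \<forall>i<n. b w (u i) = 0 \<Longrightarrow> a (u n) (u n) * b w w \<le> a w w"
    and "\<And>n. a (u n) (u n) \<le> a (u (Suc n)) (u (Suc n))"
    and "\<And>v. v \<in> H \<Longrightarrow> (\<lambda>n. quad b (\<lambda>x. v x - (\<Sum>i<n. b v (u i) * u i x))) \<longlonglongrightarrow> 0"
proof -
  \<comment> \<open>\<open>P f n\<close> looks at \<open>f\<close> only below \<open>n\<close>, as a
    recursion over all earlier choices demands.\<close>
  define P where "P f n v \<longleftrightarrow> v \<in> H \<and> b v v = 1 \<and> (\<forall>i<n. b v (f i) = 0) \<and>
    (\<forall>w\<in>H. (\<forall>i<n. b w (f i) = 0) \<longrightarrow> a v v * b w w \<le> a w w) \<and>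
    (\<forall>w\<in>H. a v w = a v v * b v w)" for f :: "nat \<Rightarrow> 'x \<Rightarrow> real" and n :: nat and v
  have "\<exists>u. \<forall>n. P u n (u n)"
  proof (rule dependent_wellorder_choice)
    show "P f x r = P g x r" if "\<And>y. y < x \<Longrightarrow> f y = g y" for r f g x
      using that by (simp add: P_def)
    fix n f assume IH: "\<And>m. m < n \<Longrightarrow> P f m (f m)"
    have f: "f i \<in> H" and f1: "b (f i) (f i) = 1" if "i < n" for i
      using IH[OF that] unfolding P_def by blast+
    have f0: "b (f j) (f i) = 0" if "i < j" "j < n" for i j
      using IH[OF that(2)] that(1) unfolding P_def by blast
    have on: "b (f i) (f j) = (if i = j then 1 else 0)" if "i < n" "j < n" for i j
      using f1 f0 that B.sym[OF f[OF that(1)] f[OF that(2)]]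
      by (cases i j rule: linorder_cases) auto
    have eig: "a (f i) w = a (f i) (f i) * b (f i) w" if "i < n" "w \<in> H" for i w
      using IH[OF that(1)] that(2) unfolding P_def by blast
    show "\<exists>v. P f n v" using next_eigenfunction[of n f, OF f on eig] unfolding P_def by blast
  qed
  then obtain u where u: "\<And>n. P u n (u n)" by blast
  have uH: "u n \<in> H" and u1: "b (u n) (u n) = 1" for n
    using u[of n] unfolding P_def by blast+
  have u0: "b (u j) (u i) = 0" if "i < j" for i j
    using u[of j] that unfolding P_def by blast
  have on: "b (u i) (u j) = (if i = j then 1 else 0)" for i j
    using u1 u0 B.sym[OF uH uH, of i j]
    by (cases i j rule: linorder_cases) auto
  have eig: "a (u n) w = a (u n) (u n) * b (u n) w" if "w \<in> H" for n w
    using u[of n] that unfolding P_def by blast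
  have ray: "a (u n) (u n) * b w w \<le> a w w" if "w \<in> H" "\<forall>i<n. b w (u i) = 0" for n w
    using u[of n] that unfolding P_def by blast
  have mono: "a (u n) (u n) \<le> a (u m) (u m)" if "n \<le> m" for n m
    using ray[OF uH, of n m] on that by simp
  \<comment> \<open>Distinct members of an orthonormal sequence have squared
    \<open>b\<close>-distance 2, so no subsequence is Cauchy for \<open>b\<close>; compactness then
    forbids a bound on the energies.\<close>
  have unbounded: "\<exists>n. a (u n) (u n) > C" for C
  proof (rule ccontr)
    assume "\<not> ?thesis"
    then have "a (u n) (u n) + b (u n) (u n) \<le> C + 1" for n
      using on by (simp add: not_less)
    from compact[of u, OF uH this] obtain r :: "nat \<Rightarrow> nat" and K where r: "strict_mono r"
      and K: "\<forall>m\<ge>K. \<forall>n\<ge>K. quad b (\<lambda>x. u (r m) x - u (r n) x) < 1"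
      by (meson zero_less_one)
    have "r K \<noteq> r (Suc K)" using r by (metis n_not_Suc_n strict_mono_eq)
    then have "quad b (\<lambda>x. u (r K) x - u (r (Suc K)) x) = 2"
      using B.quadratic_diff[OF uH uH, of "r K" "r (Suc K)"] on by simp
    then show False using K[rule_format, of K "Suc K"] by simp
  qed
  have lim: "(\<lambda>n. quad b (\<lambda>x. v x - (\<Sum>i<n. b v (u i) * u i x))) \<longlonglongrightarrow> 0" if v: "v \<in> H" for v
  proof -
    define p where "p n = (\<lambda>x. v x - (\<Sum>i<n. b v (u i) * u i x))" for n
    have pH: "p n \<in> H" and po: "\<forall>i<n. b (p n) (u i) = 0" for n
      unfolding p_def by (auto intro!: B.orthonormal_residual[OF v uH on])
    \<comment> \<open>The residual is also orthogonal to the \<open>u i\<close> for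
      \<open>a\<close>, whence \<open>a (p n) (p n) = a v (p n)\<close>; expanding the nonnegative
      energy of \<open>v - p n\<close> gives the bound.\<close>
    have ap: "a (p n) (p n) \<le> a v v" for n
    proof -
      have au: "a (u i) (p n) = 0" if "i < n" for i
        using eig[OF pH] po[of n] that B.sym[OF uH pH] by simp
      have "a (p n) (p n) = a v (p n) - (\<Sum>i<n. b v (u i) * a (u i) (p n))"
        using A.sub_sum[where n=n and f=u and c="\<lambda>i. b v (u i)", OF v uH pH] by (simp add: p_def)
      also have "(\<Sum>i<n. b v (u i) * a (u i) (p n)) = 0" using au by (intro sum.neutral) auto
      finally have "a (p n) (p n) = a v (p n)" by simp
      then show ?thesis
        using A.quadratic_diff[OF v pH, of n] A.nonneg[OF A.diff_closed[OF v pH], of n] by simp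
    qed
    have "(\<lambda>n. b (p n) (p n)) \<longlonglongrightarrow> 0"
    proof (rule LIMSEQ_I)
      fix e :: real assume e: "e > 0"
      \<comment> \<open>The added 1 keeps the factor positive when \<open>a v v = 0\<close>, so that
        it can be cancelled at the end.\<close>
      obtain N where N: "a (u N) (u N) > (a v v + 1) / e" using unbounded by blast
      have "norm (b (p n) (p n) - 0) < e" if "n \<ge> N" for n
      proof -
        have pos: "(a v v + 1) / e > 0" using e A.nonneg[OF v] by simp
        have "(a v v + 1) / e * b (p n) (p n) \<le> a (u n) (u n) * b (p n) (p n)"
          using N mono[OF that] B.nonneg[OF pH] by (intro mult_right_mono) auto
        also have "\<dots> \<le> a (p n) (p n)" by (rule ray[OF pH po])
        also have "\<dots> < a v v + 1" using ap[of n] by simp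
        finally have "(a v v + 1) * b (p n) (p n) < (a v v + 1) * e" using e by (simp add: field_simps)
        then have "b (p n) (p n) < e" using A.nonneg[OF v] by simp
        then show ?thesis using B.nonneg[OF pH] by simp
      qed
      then show "\<exists>N. \<forall>n\<ge>N. norm (b (p n) (p n) - 0) < e" by blast
    qed
    then show ?thesis by (simp add: p_def)
  qed
  show ?thesis by (rule that[OF uH on eig ray mono lim]) auto
qed

end

section \<open>Square integrable functions\<close>

abbreviation L2sq :: "'m measure \<Rightarrow> ('m \<Rightarrow> 'b::real_normed_vector) \<Rightarrow> ennreal" where
  "L2sq M f \<equiv> (\<integral>\<^sup>+ x. ennreal ((norm (f x))\<^sup>2) \<partial>M)"

definition sq_integrable :: "'m measure \<Rightarrow> ('m \<Rightarrow> 'b::euclidean_space) \<Rightarrow> bool" where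
  "sq_integrable M f \<longleftrightarrow> f \<in> borel_measurable M \<and> L2sq M f < \<infinity>"

lemma sq_integrable_measurable: "sq_integrable M f \<Longrightarrow> f \<in> borel_measurable M"
  by (simp add: sq_integrable_def)

lemma sq_integrable_iff:
  "sq_integrable M f \<longleftrightarrow> f \<in> borel_measurable M \<and> integrable M (\<lambda>x. (norm (f x))\<^sup>2)"
  by (auto simp: sq_integrable_def integrable_iff_bounded)

lemma sq_integrable_inner:
  assumes "sq_integrable M f" "sq_integrable M g"
  shows "integrable M (\<lambda>x. f x \<bullet> g x)"
proof (rule Bochner_Integration.integrable_bound)
  show "integrable M (\<lambda>x. (norm (f x))\<^sup>2 + (norm (g x))\<^sup>2)"
    using assms by (auto simp: sq_integrable_iff)
  show "(\<lambda>x. f x \<bullet> g x) \<in> borel_measurable M"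
    using assms by (auto simp: sq_integrable_iff)
  show "AE x in M. norm (f x \<bullet> g x) \<le> norm ((norm (f x))\<^sup>2 + (norm (g x))\<^sup>2)"
  proof (rule AE_I2)
    fix x
    have "\<bar>f x \<bullet> g x\<bar> \<le> norm (f x) * norm (g x)" by (rule Cauchy_Schwarz_ineq2)
    also have "\<dots> \<le> (norm (f x))\<^sup>2 + (norm (g x))\<^sup>2"
      using sum_squares_bound[of "norm (f x)" "norm (g x)"]
        mult_nonneg_nonneg[OF norm_ge_zero[of "f x"] norm_ge_zero[of "g x"]] by linarith
    finally show "norm (f x \<bullet> g x) \<le> norm ((norm (f x))\<^sup>2 + (norm (g x))\<^sup>2)" by simp
  qed
qed

lemma sq_integrable_mult:
  fixes f g :: "'m \<Rightarrow> real"
  assumes "sq_integrable M f" "sq_integrable M g"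
  shows "integrable M (\<lambda>x. f x * g x)"
  using sq_integrable_inner[OF assms] by simp

lemma norm_add_square_le: "(norm (x + y :: 'b::real_inner))\<^sup>2 \<le> 2 * (norm x)\<^sup>2 + 2 * (norm y)\<^sup>2"
proof -
  have "0 \<le> (norm (x - y))\<^sup>2" by simp
  then show ?thesis by (simp add: power2_norm_eq_inner inner_simps inner_commute)
qed

lemma sq_integrable_lin:
  assumes "sq_integrable M f" "sq_integrable M g"
  shows "sq_integrable M (\<lambda>x. f x + c *\<^sub>R g x)"
  unfolding sq_integrable_iff
proof
  show "(\<lambda>x. f x + c *\<^sub>R g x) \<in> borel_measurable M"
    using assms by (auto simp: sq_integrable_iff)
  show "integrable M (\<lambda>x. (norm (f x + c *\<^sub>R g x))\<^sup>2)"
  proof (rule Bochner_Integration.integrable_bound)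
    show "integrable M (\<lambda>x. 2 * (norm (f x))\<^sup>2 + 2 * (c\<^sup>2 * (norm (g x))\<^sup>2))"
      using assms by (auto simp: sq_integrable_iff)
    show "(\<lambda>x. (norm (f x + c *\<^sub>R g x))\<^sup>2) \<in> borel_measurable M"
      using assms by (auto simp: sq_integrable_iff)
    show "AE x in M. norm ((norm (f x + c *\<^sub>R g x))\<^sup>2) \<le> norm (2 * (norm (f x))\<^sup>2 + 2 * (c\<^sup>2 * (norm (g x))\<^sup>2))"
      using norm_add_square_le[of "f x" "c *\<^sub>R g x" for x] by (simp add: power_mult_distrib)
  qed
qed

lemma sq_integrable_diff: "sq_integrable M f \<Longrightarrow> sq_integrable M g \<Longrightarrow> sq_integrable M (\<lambda>x. f x - g x)"
  using sq_integrable_lin[of M f g "-1"] by simp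

lemma sq_integrable_nn_integral:
  "sq_integrable M f \<Longrightarrow> L2sq M f = ennreal (\<integral>x. f x \<bullet> f x \<partial>M)"
  by (auto simp: sq_integrable_iff power2_norm_eq_inner nn_integral_eq_integral)

lemma sq_integrable_inner_lin:
  assumes "sq_integrable M f" "sq_integrable M g" "sq_integrable M h"
  shows "(\<integral>x. (f x + c *\<^sub>R g x) \<bullet> h x \<partial>M) = (\<integral>x. f x \<bullet> h x \<partial>M) + c * (\<integral>x. g x \<bullet> h x \<partial>M)"
  using assms by (simp add: inner_add_left sq_integrable_inner)

lemma sq_integrable_bounded:
  assumes "finite_measure M" "f \<in> borel_measurable M" "\<And>x. x \<in> space M \<Longrightarrow> norm (f x) \<le> B"
  shows "sq_integrable M f"
proof -
  have "L2sq M f \<le> (\<integral>\<^sup>+ x. ennreal (B\<^sup>2) \<partial>M)"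
    by (intro nn_integral_mono ennreal_leI power_mono assms) auto
  also have "\<dots> < \<infinity>" using assms(1)
    using finite_measure.emeasure_finite[OF assms(1), of "space M"]
    by (simp add: ennreal_mult_less_top less_top)
  finally show ?thesis using assms by (simp add: sq_integrable_def)
qed

section \<open>Almost everywhere limits and completeness of square integrable functions\<close>

lemma fast_subsequence:
  fixes Q :: "nat \<Rightarrow> nat \<Rightarrow> nat \<Rightarrow> bool"
  assumes "\<And>k. \<exists>K. \<forall>m\<ge>K. \<forall>n\<ge>K. Q k m n"
  obtains r :: "nat \<Rightarrow> nat" where "strict_mono r" "\<And>k m n. m \<ge> r k \<Longrightarrow> n \<ge> r k \<Longrightarrow> Q k m n"
proof -
  from assms obtain N where N: "\<And>k m n. m \<ge> N k \<Longrightarrow> n \<ge> N k \<Longrightarrow> Q k m n" by metis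
  \<comment> \<open>The partial sum dominates the threshold \<open>N k\<close>, and the summand
    \<open>k\<close> makes the sequence strictly increasing.\<close>
  define r where "r k = (\<Sum>i\<le>k. N i) + k" for k
  have "strict_mono r" by (auto simp: strict_mono_Suc_iff r_def)
  moreover have "N k \<le> r k" for k
    unfolding r_def using member_le_sum[of k "{..k}" N] by simp
  then have "Q k m n" if "m \<ge> r k" "n \<ge> r k" for k m n using N that order_trans by blast
  ultimately show thesis by (rule that)
qed

lemma convergent_if_summable_increments:
  fixes g :: "nat \<Rightarrow> 'b::banach"
  assumes "summable (\<lambda>k. norm (g (Suc k) - g k))"
  shows "convergent g"
proof -
  have "summable (\<lambda>k. g (Suc k) - g k)" using assms by (rule summable_norm_cancel)
  then have "convergent (\<lambda>n. \<Sum>k<n. g (Suc k) - g k)" by (simp add: summable_iff_convergent)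
  then have "convergent (\<lambda>n. (g n - g 0) + g 0)"
    unfolding sum_lessThan_telescope by (intro convergent_add convergent_const)
  then show ?thesis by simp
qed

text \<open>The Riesz-Fischer argument, arranged for measures that may be infinite, where square
  integrable increments need not be integrable: squared norms of at most \<open>(1/4)^k\<close>
  remain summable after weighting with \<open>2^k\<close>.\<close>

lemma L2_Cauchy_AE_convergent_subseq:
  fixes f :: "nat \<Rightarrow> 'm \<Rightarrow> 'b::euclidean_space"
  assumes meas[measurable]: "\<And>n. f n \<in> borel_measurable M"
    and cauchy: "\<And>e. e > 0 \<Longrightarrow>
      \<exists>K. \<forall>m\<ge>K. \<forall>n\<ge>K. L2sq M (\<lambda>x. f m x - f n x) \<le> ennreal e"
  obtains r :: "nat \<Rightarrow> nat" where "strict_mono r" "AE x in M. convergent (\<lambda>k. f (r k) x)"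
proof -
  obtain r :: "nat \<Rightarrow> nat" where r: "strict_mono r"
    and rc: "\<And>k m n. m \<ge> r k \<Longrightarrow> n \<ge> r k \<Longrightarrow>
      L2sq M (\<lambda>x. f m x - f n x) \<le> ennreal ((1/4)^k)"
    by (rule fast_subsequence[of "\<lambda>k m n. L2sq M (\<lambda>x. f m x - f n x) \<le> ennreal ((1/4)^k)"])
       (use cauchy in auto)
  define d where "d k x = norm (f (r (Suc k)) x - f (r k) x)" for k x
  have [measurable]: "d k \<in> borel_measurable M" for k unfolding d_def by measurable
  have "(\<integral>\<^sup>+ x. (\<Sum>k. ennreal (2^k * (d k x)\<^sup>2)) \<partial>M) = (\<Sum>k. \<integral>\<^sup>+ x. ennreal (2^k * (d k x)\<^sup>2) \<partial>M)"
    by (rule nn_integral_suminf) measurable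
  also have "\<dots> \<le> (\<Sum>k. ennreal ((1/2)^k))"
  proof (intro suminf_le)
    fix k
    have "(\<integral>\<^sup>+ x. ennreal (2^k * (d k x)\<^sup>2) \<partial>M) = ennreal (2^k) * (\<integral>\<^sup>+ x. ennreal ((d k x)\<^sup>2) \<partial>M)"
      by (subst nn_integral_cmult[symmetric]) (auto simp: ennreal_mult)
    also have "\<dots> \<le> ennreal (2^k) * ennreal ((1/4)^k)"
      unfolding d_def using rc[of k "r (Suc k)" "r k"] strict_monoD[OF r, of k "Suc k"]
      by (intro mult_left_mono) auto
    also have "\<dots> = ennreal ((1/2)^k)"
      by (simp add: ennreal_mult[symmetric] power_mult_distrib[symmetric])
    finally show "(\<integral>\<^sup>+ x. ennreal (2^k * (d k x)\<^sup>2) \<partial>M) \<le> ennreal ((1/2)^k)" .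
  qed auto
  also have "\<dots> < \<infinity>"
    by (subst suminf_ennreal2) (auto simp: summable_geometric)
  finally have "AE x in M. (\<Sum>k. ennreal (2^k * (d k x)\<^sup>2)) \<noteq> \<infinity>"
    by (intro nn_integral_PInf_AE) auto
  then have "AE x in M. convergent (\<lambda>k. f (r k) x)"
  proof eventually_elim
    fix x assume "(\<Sum>k. ennreal (2^k * (d k x)\<^sup>2)) \<noteq> \<infinity>"
    then have s: "summable (\<lambda>k. 2^k * (d k x)\<^sup>2)" by (intro summable_suminf_not_top) auto
    have "summable (\<lambda>k. d k x)"
    proof (rule summable_comparison_test)
      show "summable (\<lambda>k. 2^k * (d k x)\<^sup>2 + (1/2)^k)" by (intro summable_add s) (simp add: summable_geometric)
      \<comment> \<open>Completing the square turns weighted square summability at the point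
        \<open>x\<close> into absolute summability of the increments.\<close>
      have "d k x \<le> 2^k * (d k x)\<^sup>2 + (1/2)^k" for k
      proof -
        have d0: "0 \<le> d k x" by (simp add: d_def)
        have "0 \<le> 2^k * (d k x - (1/2)^k)\<^sup>2" by simp
        also have "\<dots> = 2^k * (d k x)\<^sup>2 + (1/2)^k - 2 * d k x"
          by (simp add: power2_diff algebra_simps power_divide power2_eq_square)
        finally show ?thesis using d0 by linarith
      qed
      then show "\<exists>N. \<forall>n\<ge>N. norm (d n x) \<le> 2^n * (d n x)\<^sup>2 + (1/2)^n" by (simp add: d_def)
    qed
    then show "convergent (\<lambda>k. f (r k) x)"
      unfolding d_def by (intro convergent_if_summable_increments)
  qed
  with r show thesis by (rule that)
qed

text \<open>Fatou's lemma in the second index of the Cauchy condition, along the subsequence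
  \<open>r\<close>.\<close>

lemma L2_limit_Fatou:
  fixes f :: "nat \<Rightarrow> 'm \<Rightarrow> 'b::euclidean_space"
  assumes meas[measurable]: "\<And>n. f n \<in> borel_measurable M" "g \<in> borel_measurable M"
    and r: "strict_mono r" and lim: "AE x in M. (\<lambda>k. f (r k) x) \<longlonglongrightarrow> g x"
    and bound: "\<And>m n. m \<ge> K \<Longrightarrow> n \<ge> K \<Longrightarrow> L2sq M (\<lambda>x. f m x - f n x) \<le> e"
    and n: "n \<ge> K"
  shows "L2sq M (\<lambda>x. f n x - g x) \<le> e"
proof -
  have "L2sq M (\<lambda>x. f n x - g x)
      = (\<integral>\<^sup>+ x. liminf (\<lambda>k. ennreal ((norm (f n x - f (r k) x))\<^sup>2)) \<partial>M)"
  proof (rule nn_integral_cong_AE)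
    show "AE x in M. ennreal ((norm (f n x - g x))\<^sup>2) = liminf (\<lambda>k. ennreal ((norm (f n x - f (r k) x))\<^sup>2))"
      using lim
    proof eventually_elim
      fix x assume "(\<lambda>k. f (r k) x) \<longlonglongrightarrow> g x"
      then have "(\<lambda>k. ennreal ((norm (f n x - f (r k) x))\<^sup>2)) \<longlonglongrightarrow> ennreal ((norm (f n x - g x))\<^sup>2)"
        by (intro tendsto_intros)
      from lim_imp_Liminf[OF _ this]
      show "ennreal ((norm (f n x - g x))\<^sup>2) = liminf (\<lambda>k. ennreal ((norm (f n x - f (r k) x))\<^sup>2))" by simp
    qed
  qed
  also have "\<dots> \<le> liminf (\<lambda>k. \<integral>\<^sup>+ x. ennreal ((norm (f n x - f (r k) x))\<^sup>2) \<partial>M)"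
    by (rule nn_integral_liminf) measurable
  also have "\<dots> \<le> liminf (\<lambda>k. e)"
  proof (rule Liminf_mono)
    have "r k \<ge> K" if "k \<ge> K" for k using that seq_suble[OF r, of k] by simp
    then show "\<forall>\<^sub>F k in sequentially. L2sq M (\<lambda>x. f n x - f (r k) x) \<le> e"
      unfolding eventually_sequentially using bound[OF n] by blast
  qed
  also have "\<dots> = e" by (simp add: Liminf_const)
  finally show ?thesis .
qed

text \<open>The limit \<open>g\<close> is prescribed by pointwise convergence instead of being
  produced here, so that one and the same function can determine the limits on several measure
  spaces.\<close>

lemma L2_Cauchy_limit:
  fixes f :: "nat \<Rightarrow> 'm \<Rightarrow> 'b::euclidean_space"
  assumes sq: "\<And>n. sq_integrable M (f n)" and g: "g \<in> borel_measurable M"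
    and r: "strict_mono r" and lim: "AE x in M. (\<lambda>k. f (r k) x) \<longlonglongrightarrow> g x"
    and cauchy: "\<And>e. e > 0 \<Longrightarrow> \<exists>K. \<forall>m\<ge>K. \<forall>n\<ge>K. L2sq M (\<lambda>x. f m x - f n x) \<le> ennreal e"
  shows "sq_integrable M g" "\<And>e. e > 0 \<Longrightarrow> \<exists>K. \<forall>n\<ge>K. L2sq M (\<lambda>x. f n x - g x) \<le> ennreal e"
proof -
  have fm: "f n \<in> borel_measurable M" for n using sq by (rule sq_integrable_measurable)
  show conv: "\<exists>K. \<forall>n\<ge>K. L2sq M (\<lambda>x. f n x - g x) \<le> ennreal e" if e: "e > 0" for e
  proof -
    obtain K where K: "\<And>m n. m \<ge> K \<Longrightarrow> n \<ge> K \<Longrightarrow> L2sq M (\<lambda>x. f m x - f n x) \<le> ennreal e"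
      using cauchy[OF e] by blast
    have "L2sq M (\<lambda>x. f n x - g x) \<le> ennreal e" if "n \<ge> K" for n
      by (rule L2_limit_Fatou[OF fm g r lim K that])
    then show ?thesis by blast
  qed
  obtain K where "L2sq M (\<lambda>x. f K x - g x) \<le> ennreal 1" using conv[of 1] by auto
  also have "\<dots> < \<infinity>" by simp
  finally have "sq_integrable M (\<lambda>x. f K x - g x)" using fm g by (simp add: sq_integrable_def)
  from sq_integrable_diff[OF sq[of K] this] show "sq_integrable M g" by simp
qed

lemma L2_complete:
  fixes f :: "nat \<Rightarrow> 'm \<Rightarrow> 'b::euclidean_space"
  assumes sq: "\<And>n. sq_integrable M (f n)"
    and cauchy: "\<And>e. e > 0 \<Longrightarrow> \<exists>K. \<forall>m\<ge>K. \<forall>n\<ge>K. L2sq M (\<lambda>x. f m x - f n x) \<le> ennreal e"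
  obtains g where "sq_integrable M g"
    "\<And>e. e > 0 \<Longrightarrow> \<exists>K. \<forall>n\<ge>K. L2sq M (\<lambda>x. f n x - g x) \<le> ennreal e"
proof -
  have [measurable]: "f n \<in> borel_measurable M" for n using sq by (rule sq_integrable_measurable)
  obtain r :: "nat \<Rightarrow> nat" where r: "strict_mono r" "AE x in M. convergent (\<lambda>k. f (r k) x)"
    by (rule L2_Cauchy_AE_convergent_subseq[OF _ cauchy]) auto
  define g where "g x = lim (\<lambda>k. f (r k) x)" for x
  have g: "g \<in> borel_measurable M" unfolding g_def by (rule borel_measurable_lim_metric) measurable
  have lim: "AE x in M. (\<lambda>k. f (r k) x) \<longlonglongrightarrow> g x"
    using r(2) by eventually_elim (simp add: g_def convergent_LIMSEQ_iff)
  show thesis by (rule that[OF L2_Cauchy_limit[OF sq g r(1) lim cauchy]])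
qed

section \<open>Smooth bump functions\<close>

text \<open>The powers in the denominator make the family closed under differentiation up to linear
  combinations, so that one formula for the first derivative settles all orders.\<close>

definition flat_exp :: "nat \<Rightarrow> real \<Rightarrow> real" where
  "flat_exp m t = (if t \<le> 0 then 0 else exp (- 1 / t) / t ^ m)"

lemma flat_exp_tendsto_0: "(flat_exp m \<longlongrightarrow> 0) (at_right 0)"
proof -
  have "((\<lambda>x. (inverse x) ^ m / exp (inverse x)) \<longlongrightarrow> (0::real)) (at_right 0)"
    by (rule filterlim_compose[OF tendsto_power_div_exp_0 filterlim_inverse_at_top_right])
  moreover have "\<forall>\<^sub>F x in at_right 0. (inverse x) ^ m / exp (inverse x) = flat_exp m x"
    unfolding eventually_at_right_field
    by (intro exI[of _ 1]) (auto simp: flat_exp_def exp_minus field_simps power_divide)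
  ultimately show ?thesis by (rule Lim_transform_eventually)
qed

lemma flat_exp_has_derivative:
  "(flat_exp m has_real_derivative (flat_exp (m + 2) t - real m * flat_exp (m + 1) t)) (at t)"
proof (cases t "0::real" rule: linorder_cases)
  case less
  have "((\<lambda>_. 0::real) has_real_derivative 0) (at t)" by simp
  then have "(flat_exp m has_real_derivative 0) (at t)"
    by (rule has_field_derivative_transform_within_open[of _ _ _ "{..<0}"])
       (use less in \<open>auto simp: flat_exp_def\<close>)
  then show ?thesis using less by (simp add: flat_exp_def)
next
  case equal
  \<comment> \<open>At 0 the right difference quotient of \<open>flat_exp m\<close> is
    \<open>flat_exp (m + 1)\<close> itself, and the left one is 0.\<close>
  have "((\<lambda>y. (flat_exp m y - flat_exp m 0) / (y - 0)) \<longlongrightarrow> 0) (at 0)"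
  proof (rule filterlim_split_at)
    have "\<forall>\<^sub>F y in at_left (0::real). 0 = (flat_exp m y - flat_exp m 0) / (y - 0)"
      unfolding eventually_at_left_field by (intro exI[of _ "-1"]) (auto simp: flat_exp_def)
    then show "((\<lambda>y. (flat_exp m y - flat_exp m 0) / (y - 0)) \<longlongrightarrow> 0) (at_left 0)"
      by (rule Lim_transform_eventually[OF tendsto_const])
    have "\<forall>\<^sub>F y in at_right (0::real). flat_exp (m + 1) y = (flat_exp m y - flat_exp m 0) / (y - 0)"
      unfolding eventually_at_right_field by (intro exI[of _ "1"]) (auto simp: flat_exp_def)
    then show "((\<lambda>y. (flat_exp m y - flat_exp m 0) / (y - 0)) \<longlongrightarrow> 0) (at_right 0)"
      by (rule Lim_transform_eventually[OF flat_exp_tendsto_0])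
  qed
  then show ?thesis using equal by (simp add: has_field_derivative_iff flat_exp_def)
next
  case greater
  have "((\<lambda>s. exp (- 1 / s) / s ^ m) has_real_derivative
      (exp (- 1 / t) / t ^ (m + 2) - real m * (exp (- 1 / t) / t ^ (m + 1)))) (at t)"
    using greater
    by (auto intro!: derivative_eq_intros simp: field_simps power2_eq_square power_eq_if[of t m])
  then have "(flat_exp m has_real_derivative
      (exp (- 1 / t) / t ^ (m + 2) - real m * (exp (- 1 / t) / t ^ (m + 1)))) (at t)"
    by (rule has_field_derivative_transform_within_open[of _ _ _ "{0<..}"])
       (use greater in \<open>auto simp: flat_exp_def\<close>)
  then show ?thesis using greater by (simp add: flat_exp_def)
qed

lemma flat_exp_0: "0 \<le> flat_exp 0 t" "flat_exp 0 t \<le> 1" "flat_exp 0 t > 0 \<longleftrightarrow> t > 0"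
  by (auto simp: flat_exp_def)

text \<open>Stretching the argument sharpens the smooth step to the indicator of the positive
  half-line; through this, box bumps approximate indicators of boxes.\<close>

lemma flat_exp_scaled_tendsto:
  "(\<lambda>k. flat_exp 0 (real (Suc k) * t)) \<longlonglongrightarrow> (if t > 0 then 1 else 0)"
proof (cases "t > 0")
  case True
  have "(\<lambda>k. exp (- (1 / t) * inverse (real (Suc k)))) \<longlonglongrightarrow> exp (- (1 / t) * 0)"
    by (intro tendsto_intros LIMSEQ_inverse_real_of_nat)
  moreover have "exp (- (1 / t) * inverse (real (Suc k))) = flat_exp 0 (real (Suc k) * t)" for k
    using True mult_pos_pos[of "real (Suc k)" t] by (simp add: flat_exp_def field_simps not_le del: of_nat_Suc)
  ultimately show ?thesis using True by simp
next
  case False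
  then have "flat_exp 0 (real (Suc k) * t) = 0" for k
    by (simp add: flat_exp_def mult_nonneg_nonpos not_less del: of_nat_Suc)
  then show ?thesis using False by simp
qed

text \<open>An algebra of functions that is closed under directional derivatives consists of smooth functions.\<close>

inductive flat_algebra :: "('a::euclidean_space \<Rightarrow> real) \<Rightarrow> bool" where
  const: "flat_algebra (\<lambda>x. c)"
| flat: "flat_algebra (\<lambda>x. flat_exp m (w \<bullet> x + d))"
| add: "flat_algebra f \<Longrightarrow> flat_algebra g \<Longrightarrow> flat_algebra (\<lambda>x. f x + g x)"
| mult: "flat_algebra f \<Longrightarrow> flat_algebra g \<Longrightarrow> flat_algebra (\<lambda>x. f x * g x)"

text \<open>Because every directional derivative is again in the algebra, the statement can be
  iterated along an arbitrary list of directions.\<close>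

lemma flat_algebra_derivative:
  assumes "flat_algebra f"
  shows "\<exists>D. (\<forall>x. (f has_derivative D x) (at x)) \<and> (\<forall>e. flat_algebra (\<lambda>x. D x e))"
  using assms
proof induction
  case (const c)
  show ?case by (intro exI[of _ "\<lambda>_ _. 0"]) (auto intro: flat_algebra.intros)
next
  case (flat m w d)
  define D where "D x e = (flat_exp (m + 2) (w \<bullet> x + d) + (- real m) * flat_exp (m + 1) (w \<bullet> x + d)) * (w \<bullet> e)" for x e
  have "((\<lambda>x. flat_exp m (w \<bullet> x + d)) has_derivative D x) (at x)" for x
  proof -
    have "((\<lambda>x. w \<bullet> x + d) has_derivative (\<lambda>e. w \<bullet> e)) (at x)"
      by (auto intro!: derivative_eq_intros)
    moreover have "(flat_exp m has_derivative
        (\<lambda>h. (flat_exp (m + 2) (w \<bullet> x + d) - real m * flat_exp (m + 1) (w \<bullet> x + d)) * h)) (at (w \<bullet> x + d))"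
      using flat_exp_has_derivative[of m "w \<bullet> x + d"] by (simp add: has_field_derivative_def)
    ultimately show ?thesis
      using diff_chain_at[of "\<lambda>x. w \<bullet> x + d" "\<lambda>e. w \<bullet> e" x "flat_exp m"]
      by (simp add: o_def D_def[abs_def])
  qed
  moreover have "flat_algebra (\<lambda>x. D x e)" for e
    unfolding D_def by (intro flat_algebra.intros)
  ultimately show ?case by blast
next
  case (add f g)
  then obtain D E where "\<And>x. (f has_derivative D x) (at x)" "\<And>e. flat_algebra (\<lambda>x. D x e)"
    "\<And>x. (g has_derivative E x) (at x)" "\<And>e. flat_algebra (\<lambda>x. E x e)" by blast
  then show ?case
    by (intro exI[of _ "\<lambda>x e. D x e + E x e"]) (auto intro: flat_algebra.intros derivative_intros)
next
  case (mult f g)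
  then obtain D E where "\<And>x. (f has_derivative D x) (at x)" "\<And>e. flat_algebra (\<lambda>x. D x e)"
    "\<And>x. (g has_derivative E x) (at x)" "\<And>e. flat_algebra (\<lambda>x. E x e)" by blast
  with mult.hyps show ?case
    by (intro exI[of _ "\<lambda>x e. f x * E x e + D x e * g x"])
       (auto intro!: flat_algebra.intros has_derivative_mult)
qed

lemma flat_algebra_smooth:
  assumes "flat_algebra f"
  shows "smooth_fun f"
proof -
  have "flat_algebra (dir_deriv es f)" for es
  proof (induction es)
    case Nil then show ?case using assms by simp
  next
    case (Cons e es)
    obtain D where D: "\<And>x. (dir_deriv es f has_derivative D x) (at x)" "flat_algebra (\<lambda>x. D x e)"
      using flat_algebra_derivative[OF Cons] by blast
    then show ?case using frechet_derivative_at[OF D(1), symmetric] by simp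
  qed
  then show ?thesis unfolding smooth_fun_def
    using flat_algebra_derivative differentiableI by blast
qed

lemma flat_algebra_prod:
  assumes "finite A" "\<And>i. i \<in> A \<Longrightarrow> flat_algebra (f i)"
  shows "flat_algebra (\<lambda>x. \<Prod>i\<in>A. f i x)"
  using assms by (induction rule: finite_induct) (auto intro: flat_algebra.intros)

text \<open>One smooth step for each face of the box. \<open>k\<close> is the steepness: for
  \<open>k > 0\<close> the support is the same box, and for \<open>k\<close> to infinity the
  indicator of the open box results.\<close>

definition box_bump :: "'a::euclidean_space \<Rightarrow> 'a \<Rightarrow> real \<Rightarrow> 'a \<Rightarrow> real" where
  "box_bump a b k x = (\<Prod>i\<in>Basis. flat_exp 0 (k * (x \<bullet> i - a \<bullet> i)) * flat_exp 0 (k * (b \<bullet> i - x \<bullet> i)))"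

lemma box_bump_smooth: "smooth_fun (box_bump a b k)"
proof -
  have "flat_algebra (\<lambda>x::'a. flat_exp 0 (k * (x \<bullet> i - a \<bullet> i)) * flat_exp 0 (k * (b \<bullet> i - x \<bullet> i)))" for i
    using flat_algebra.mult[OF flat_algebra.flat[of 0 "k *\<^sub>R i" "- k * (a \<bullet> i)"]
        flat_algebra.flat[of 0 "(- k) *\<^sub>R i" "k * (b \<bullet> i)"]]
    by (simp add: algebra_simps inner_commute)
  then have "flat_algebra (box_bump a b k)"
    unfolding box_bump_def[abs_def] by (intro flat_algebra_prod) auto
  then show ?thesis by (rule flat_algebra_smooth)
qed

lemma box_bump_bounds: "0 \<le> box_bump a b k x" "box_bump a b k x \<le> 1"
  unfolding box_bump_def
  by (auto intro!: prod_nonneg prod_le_1 mult_nonneg_nonneg mult_le_one simp: flat_exp_0)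

lemma box_bump_pos_iff:
  assumes "k > 0"
  shows "box_bump a b k x > 0 \<longleftrightarrow> x \<in> box a b"
proof
  assume "x \<in> box a b"
  then show "box_bump a b k x > 0"
    unfolding box_bump_def using assms
    by (intro prod_pos ballI mult_pos_pos) (auto simp: flat_exp_0 mem_box)
next
  assume pos: "box_bump a b k x > 0"
  show "x \<in> box a b"
    unfolding mem_box
  proof
    fix i :: 'a assume i: "i \<in> Basis"
    have "flat_exp 0 (k * (x \<bullet> i - a \<bullet> i)) * flat_exp 0 (k * (b \<bullet> i - x \<bullet> i)) \<noteq> 0"
    proof
      assume "flat_exp 0 (k * (x \<bullet> i - a \<bullet> i)) * flat_exp 0 (k * (b \<bullet> i - x \<bullet> i)) = 0"
      then have "box_bump a b k x = 0"
        unfolding box_bump_def using i by (intro prod_zero) (auto intro!: bexI[of _ i])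
      then show False using pos by simp
    qed
    then have "flat_exp 0 (k * (x \<bullet> i - a \<bullet> i)) > 0" "flat_exp 0 (k * (b \<bullet> i - x \<bullet> i)) > 0"
      using flat_exp_0(1) by (auto simp: less_le)
    then show "a \<bullet> i < x \<bullet> i \<and> x \<bullet> i < b \<bullet> i"
      using assms by (auto simp: flat_exp_0 zero_less_mult_iff)
  qed
qed

lemma box_bump_eq_0_iff: "k > 0 \<Longrightarrow> box_bump a b k x = 0 \<longleftrightarrow> x \<notin> box a b"
  using box_bump_pos_iff[of k a b x] box_bump_bounds(1)[of a b k x] by linarith

lemma box_bump_tendsto: "(\<lambda>k. box_bump a b (real (Suc k)) x) \<longlonglongrightarrow> indicator (box a b) x"
proof -
  have "(\<lambda>k. box_bump a b (real (Suc k)) x) \<longlonglongrightarrow>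
      (\<Prod>i\<in>Basis. (if x \<bullet> i - a \<bullet> i > 0 then 1 else 0) * (if b \<bullet> i - x \<bullet> i > 0 then 1 else 0))"
    unfolding box_bump_def by (intro tendsto_prod tendsto_mult flat_exp_scaled_tendsto)
  also have "(\<Prod>i\<in>Basis. (if x \<bullet> i - a \<bullet> i > 0 then 1 else 0) * (if b \<bullet> i - x \<bullet> i > 0 then 1 else 0))
      = (indicator (box a b) x :: real)"
  proof (cases "x \<in> box a b")
    case True then show ?thesis by (auto simp: mem_box intro!: prod.neutral)
  next
    case False
    then obtain i where "i \<in> Basis" "\<not> (a \<bullet> i < x \<bullet> i \<and> x \<bullet> i < b \<bullet> i)" by (auto simp: mem_box)
    then have "(\<Prod>i\<in>Basis. (if x \<bullet> i - a \<bullet> i > 0 then 1 else 0) * (if b \<bullet> i - x \<bullet> i > 0 then 1 else 0)) = (0::real)"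
      by (intro prod_zero bexI[of _ i]) auto
    then show ?thesis using False by simp
  qed
  finally show ?thesis .
qed

lemma box_bump_test_fun:
  assumes "cbox a b \<subseteq> \<Omega>" "k > 0"
  shows "test_fun \<Omega> (box_bump a b k)"
proof -
  have "{x. box_bump a b k x \<noteq> 0} \<subseteq> cbox a b"
    using box_bump_eq_0_iff[OF assms(2), of a b] box_subset_cbox[of a b] by auto
  then have sub: "closure {x. box_bump a b k x \<noteq> 0} \<subseteq> cbox a b"
    by (simp add: closed_cbox closure_minimal)
  then have "compact (closure {x. box_bump a b k x \<noteq> 0})"
    by (meson bounded_subset bounded_cbox closed_closure compact_eq_bounded_closed)
  then show ?thesis using sub assms box_bump_smooth by (auto simp: test_fun_def)
qed

lemma smooth_fun_differentiable: "smooth_fun f \<Longrightarrow> f differentiable (at x)"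
  unfolding smooth_fun_def by (metis dir_deriv.simps(1))

lemma smooth_fun_continuous: "smooth_fun f \<Longrightarrow> continuous_on S f"
  by (meson continuous_at_imp_continuous_on differentiable_imp_continuous_within smooth_fun_differentiable)

lemma smooth_fun_partial_continuous:
  assumes "smooth_fun f"
  shows "continuous_on S (\<lambda>x. frechet_derivative f (at x) i)"
proof -
  have "dir_deriv [i] f differentiable (at x)" for x using assms unfolding smooth_fun_def by blast
  then have "(\<lambda>x. frechet_derivative f (at x) i) differentiable (at x)" for x by simp
  then show ?thesis
    by (meson continuous_at_imp_continuous_on differentiable_imp_continuous_within)
qed

section \<open>The fundamental lemma of the calculus of variations\<close>

text \<open>Boxes are an intersection-stable generator of the Borel sets, so the integral of
  \<open>F\<close> vanishes over the part of \<open>box A B\<close> in any Borel set, in particular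
  where \<open>F > 0\<close> and where \<open>F < 0\<close>. Staying inside one box provides the
  total integral zero that the complement step needs.\<close>

lemma integral_box_zero_AE_zero:
  fixes F :: "'a::euclidean_space \<Rightarrow> real"
  assumes F: "integrable lborel F"
    and zero: "\<And>a b. box a b \<subseteq> box A B \<Longrightarrow> (\<integral>x. indicator (box a b) x * F x \<partial>lborel) = 0"
  shows "AE x in lborel. x \<in> box A B \<longrightarrow> F x = 0"
proof -
  have Fm[measurable]: "F \<in> borel_measurable borel" using F by auto
  have int: "integrable lborel (\<lambda>x. indicator S x * F x)" if "S \<in> sets borel" for S
    using integrable_mult_indicator[of S lborel F] that F by simp
  have *: "(\<integral>x. indicator (S \<inter> box A B) x * F x \<partial>lborel) = 0" if "S \<in> sets borel" for S
  proof -
    let ?G = "range (\<lambda>(a, b). box a b :: 'a set)"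
    have S: "S \<in> sigma_sets UNIV ?G"
      using that unfolding borel_eq_box by (simp add: sets_measure_of)
    have stable: "Int_stable ?G" by (auto simp: Int_stable_def box_Int_box)
    show ?thesis using stable subset_UNIV[of ?G, unfolded Pow_UNIV[symmetric]] S
    proof (induction rule: sigma_sets_induct_disjoint)
      case (basic S)
      then obtain a b where ab: "S = box a b" by auto
      show ?case unfolding ab box_Int_box by (rule zero) (simp add: box_Int_box[symmetric])
    next
      case empty show ?case by simp
    next
      case (compl S)
      then have [measurable]: "S \<in> sets borel" unfolding borel_eq_box by (simp add: sets_measure_of)
      have "(\<integral>x. indicator ((UNIV - S) \<inter> box A B) x * F x \<partial>lborel)
          = (\<integral>x. indicator (box A B) x * F x - indicator (S \<inter> box A B) x * F x \<partial>lborel)"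
        by (intro Bochner_Integration.integral_cong) (auto simp: indicator_def)
      also have "\<dots> = 0" using zero[of A B] compl by (subst Bochner_Integration.integral_diff) (auto intro!: int)
      finally show ?case .
    next
      case (union S)
      then have [measurable]: "S i \<in> sets borel" for i unfolding borel_eq_box by (auto simp: sets_measure_of)
      have "(LINT x:(\<Union>i. S i \<inter> box A B)|lborel. F x) = (\<Sum>i. LINT x:(S i \<inter> box A B)|lborel. F x)"
        using union(1) int[of "\<Union>i. S i \<inter> box A B"]
        by (intro lebesgue_integral_countable_add)
           (auto simp: disjoint_family_on_def set_integrable_def)
      then show ?case using union by (simp add: set_lebesgue_integral_def)
    qed
  qed
  have pos: "AE x in lborel. x \<in> box A B \<longrightarrow> F x \<le> 0"
  proof -
    have "(\<integral>x. indicator ({x. F x > 0} \<inter> box A B) x * F x \<partial>lborel) = 0" by (rule *) measurable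
    moreover have "integrable lborel (\<lambda>x. indicator ({x. F x > 0} \<inter> box A B) x * F x)" by (rule int) measurable
    ultimately have "AE x in lborel. indicator ({x. F x > 0} \<inter> box A B) x * F x = 0"
      by (subst integral_nonneg_eq_0_iff_AE[symmetric]) (auto simp: indicator_def)
    then show ?thesis by eventually_elim (auto simp: indicator_def split: if_splits)
  qed
  have neg: "AE x in lborel. x \<in> box A B \<longrightarrow> F x \<ge> 0"
  proof -
    have "(\<integral>x. - (indicator ({x. F x < 0} \<inter> box A B) x * F x) \<partial>lborel) = 0"
      using *[of "{x. F x < 0}"] by simp
    moreover have "integrable lborel (\<lambda>x. - (indicator ({x. F x < 0} \<inter> box A B) x * F x))"
      by (intro integrable_minus int) measurable
    ultimately have "AE x in lborel. - (indicator ({x. F x < 0} \<inter> box A B) x * F x) = 0"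
      by (subst integral_nonneg_eq_0_iff_AE[symmetric]) (auto simp: indicator_def)
    then show ?thesis by eventually_elim (auto simp: indicator_def split: if_splits)
  qed
  from pos neg show ?thesis by eventually_elim auto
qed

text \<open>An open set is exhausted by closed boxes, whereas bumps give information on open ones
  only.\<close>

lemma AE_lborel_not_box_boundary: "AE x in lborel. x \<notin> cbox a b - box a b"
proof -
  have "emeasure lborel (cbox a b - box a b) = emeasure lborel (cbox a b) - emeasure lborel (box a b)"
    by (intro emeasure_Diff) (auto simp: emeasure_lborel_box_eq box_subset_cbox)
  also have "\<dots> = 0" by (simp add: emeasure_lborel_box_eq emeasure_lborel_cbox_eq)
  finally show ?thesis by (intro AE_not_in) (auto simp: null_sets_def)
qed

text \<open>Dominated convergence passes from bumps to indicators of boxes, and countably many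
  closed boxes cover \<Omega>.\<close>

lemma test_fun_orthogonal_AE_zero:
  fixes f :: "'a::euclidean_space \<Rightarrow> real"
  assumes "open \<Omega>" and f: "set_integrable lborel \<Omega> f"
    and zero: "\<And>\<phi>. test_fun \<Omega> \<phi> \<Longrightarrow> (\<integral>x\<in>\<Omega>. f x * \<phi> x \<partial>lborel) = 0"
  shows "AE x in lborel. x \<in> \<Omega> \<longrightarrow> f x = 0"
proof -
  define F where "F x = indicator \<Omega> x * f x" for x
  have F: "integrable lborel F" using f by (simp add: F_def[abs_def] set_integrable_def)
  have box0: "(\<integral>x. indicator (box a b) x * F x \<partial>lborel) = 0" if "cbox a b \<subseteq> \<Omega>" for a b
  proof -
    have "(\<lambda>k. \<integral>x. box_bump a b (real (Suc k)) x * F x \<partial>lborel) \<longlonglongrightarrow> (\<integral>x. indicator (box a b) x * F x \<partial>lborel)"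
    proof (rule integral_dominated_convergence[where w="\<lambda>x. norm (F x)"])
      show "(\<lambda>x. indicator (box a b) x * F x) \<in> borel_measurable lborel" using F by auto
      show "(\<lambda>x. box_bump a b (real (Suc k)) x * F x) \<in> borel_measurable lborel" for k
        using F borel_measurable_continuous_onI[OF smooth_fun_continuous[OF box_bump_smooth[of a b "real (Suc k)"]]]
        by auto
      show "integrable lborel (\<lambda>x. norm (F x))" using F by simp
      show "AE x in lborel. (\<lambda>k. box_bump a b (real (Suc k)) x * F x) \<longlonglongrightarrow> indicator (box a b) x * F x"
        by (intro AE_I2 tendsto_intros box_bump_tendsto)
      show "AE x in lborel. norm (box_bump a b (real (Suc k)) x * F x) \<le> norm (F x)" for k
        using box_bump_bounds[of a b "real (Suc k)"]
        by (intro AE_I2) (simp add: abs_mult mult_left_le_one_le)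
    qed
    moreover have "(\<integral>x. box_bump a b (real (Suc k)) x * F x \<partial>lborel) = 0" for k
      using zero[OF box_bump_test_fun[OF that, of "real (Suc k)"]]
      by (simp add: set_lebesgue_integral_def F_def mult_ac del: of_nat_Suc)
    ultimately show ?thesis by (simp add: LIMSEQ_const_iff del: of_nat_Suc)
  qed
  obtain D where D: "countable D" "D \<subseteq> Pow \<Omega>" "\<And>X. X \<in> D \<Longrightarrow> \<exists>a b. X = cbox a b" "\<Union>D = \<Omega>"
    using open_countable_Union_open_cbox[OF assms(1)] by metis
  have "AE x in lborel. x \<in> X \<longrightarrow> F x = 0" if X: "X \<in> D" for X
  proof -
    obtain A B where AB: "X = cbox A B" using D(3)[OF X] by blast
    have "AE x in lborel. x \<in> box A B \<longrightarrow> F x = 0"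
    proof (rule integral_box_zero_AE_zero[OF F])
      fix a b :: 'a assume sub: "box a b \<subseteq> box A B"
      show "(\<integral>x. indicator (box a b) x * F x \<partial>lborel) = 0"
      \<comment> \<open>When the open box is empty, the closed one can be nonempty and stick out of
        \<Omega>.\<close>
      proof (cases "box a b = {}")
        case False
        then have "cbox a b = closure (box a b)" by (simp add: closure_box)
        also have "\<dots> \<subseteq> cbox A B" using sub box_subset_cbox[of A B] by (intro closure_minimal) auto
        finally show ?thesis using D(2) X AB by (intro box0) auto
      qed simp
    qed
    with AE_lborel_not_box_boundary[of A B] show ?thesis by eventually_elim (auto simp: AB)
  qed
  then have "AE x in lborel. \<forall>X\<in>D. x \<in> X \<longrightarrow> F x = 0" using D(1) by (subst AE_ball_countable) auto
  then show ?thesis by eventually_elim (use D(4) in \<open>auto simp: F_def indicator_def split: if_splits\<close>)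
qed

section \<open>Weak gradients\<close>

lemma integral_lborel_translate:
  fixes f :: "'a::euclidean_space \<Rightarrow> real"
  assumes [measurable]: "f \<in> borel_measurable borel"
  shows "(\<integral>x. f (c + x) \<partial>lborel) = (\<integral>x. f x \<partial>lborel)"
proof -
  have "(\<integral>x. f x \<partial>lborel) = (\<integral>x. f x \<partial>(distr lborel borel ((+) c)))"
    by (simp add: lborel_distr_plus)
  also have "\<dots> = (\<integral>x. f (c + x) \<partial>lborel)" by (rule integral_distr) auto
  finally show ?thesis by simp
qed

lemma integrable_lborel_translate:
  fixes f :: "'a::euclidean_space \<Rightarrow> real"
  assumes "integrable lborel f"
  shows "integrable lborel (\<lambda>x. f (c + x))"
proof -
  have "integrable (distr lborel borel ((+) c)) f" using assms by (simp add: lborel_distr_plus)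
  then show ?thesis using assms by (subst (asm) integrable_distr_eq) auto
qed

lemma integrable_continuous_compact_support:
  fixes f :: "'a::euclidean_space \<Rightarrow> real"
  assumes "continuous_on UNIV f" "\<And>x. norm x > R \<Longrightarrow> f x = 0"
  shows "integrable lborel f"
proof -
  have "integrable lborel (\<lambda>x. indicator (cball 0 R) x *\<^sub>R f x)"
    by (intro borel_integrable_compact continuous_on_subset[OF assms(1)]) auto
  also have "(\<lambda>x. indicator (cball 0 R) x *\<^sub>R f x) = f"
    using assms(2) by (auto simp: fun_eq_iff indicator_def not_le)
  finally show ?thesis .
qed

lemma bounded_continuous_compact_support:
  fixes f :: "'a::euclidean_space \<Rightarrow> real"
  assumes "continuous_on UNIV f" "\<And>x. norm x > R \<Longrightarrow> f x = 0"
  obtains B where "B \<ge> 0" "\<And>x. \<bar>f x\<bar> \<le> B"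
proof -
  have "compact (f ` cball 0 R)"
    by (intro compact_continuous_image continuous_on_subset[OF assms(1)]) auto
  then obtain B where B: "B > 0" "\<And>x. x \<in> cball 0 R \<Longrightarrow> norm (f x) \<le> B"
    using compact_imp_bounded bounded_pos by (metis imageI)
  show thesis
  proof (rule that[of B])
    show "\<bar>f x\<bar> \<le> B" for x using B assms(2)[of x] by (cases "norm x > R") auto
  qed (use B in auto)
qed

lemma frechet_derivative_eq_0_outside:
  assumes "open S" "x \<in> S" "\<And>y. y \<in> S \<Longrightarrow> f y = 0"
  shows "frechet_derivative f (at x) = (\<lambda>_. 0)"
proof -
  have "((\<lambda>_. 0) has_derivative (\<lambda>_. 0)) (at x)" by simp
  then have "(f has_derivative (\<lambda>_. 0)) (at x)"
    by (rule has_derivative_transform_within_open[OF _ assms(1,2)]) (use assms(3) in auto)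
  then show ?thesis by (rule frechet_derivative_at[symmetric])
qed

text \<open>The mean value inequality on a line; \<open>i\<close> is any vector, not only a
  coordinate direction.\<close>

lemma directional_derivative_bound:
  fixes h :: "'a::euclidean_space \<Rightarrow> real"
  assumes diff: "\<And>x. h differentiable (at x)"
    and B: "\<And>x. \<bar>frechet_derivative h (at x) i\<bar> \<le> B"
  shows "\<bar>h (x + t *\<^sub>R i) - h x\<bar> \<le> B * \<bar>t\<bar>"
proof -
  have "((\<lambda>s. h (x + s *\<^sub>R i)) has_field_derivative frechet_derivative h (at (x + s *\<^sub>R i)) i) (at s within UNIV)" for s
  proof -
    have "((\<lambda>s. x + s *\<^sub>R i) has_derivative (\<lambda>s. s *\<^sub>R i)) (at s)"
      by (auto intro!: derivative_eq_intros)
    moreover have hd: "(h has_derivative frechet_derivative h (at (x + s *\<^sub>R i))) (at (x + s *\<^sub>R i))"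
      using diff frechet_derivative_works by blast
    ultimately have "(h \<circ> (\<lambda>s. x + s *\<^sub>R i) has_derivative frechet_derivative h (at (x + s *\<^sub>R i)) \<circ> (\<lambda>s. s *\<^sub>R i)) (at s)"
      by (rule diff_chain_at)
    moreover have "frechet_derivative h (at (x + s *\<^sub>R i)) (r *\<^sub>R i) = frechet_derivative h (at (x + s *\<^sub>R i)) i * r" for r
      using linear_scale[OF has_derivative_linear[OF hd]] by simp
    ultimately show ?thesis by (simp add: has_field_derivative_def o_def mult_commute_abs)
  qed
  from field_differentiable_bound[of UNIV "\<lambda>s. h (x + s *\<^sub>R i)", OF convex_UNIV this, of B t 0] B
  show ?thesis by simp
qed

text \<open>Difference quotients have integral zero by translation invariance; pass to the limit.\<close>

lemma integral_partial_derivative_zero: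
  fixes h :: "'a::euclidean_space \<Rightarrow> real"
  assumes diff: "\<And>x. h differentiable (at x)"
    and cont: "continuous_on UNIV (\<lambda>x. frechet_derivative h (at x) i)"
    and supp: "\<And>x. norm x > R \<Longrightarrow> h x = 0"
  shows "(\<integral>x. frechet_derivative h (at x) i \<partial>lborel) = 0"
proof -
  define D where "D x = frechet_derivative h (at x) i" for x
  have hc: "continuous_on UNIV h"
    using diff by (meson continuous_at_imp_continuous_on differentiable_imp_continuous_within)
  have hm[measurable]: "h \<in> borel_measurable borel" by (rule borel_measurable_continuous_onI[OF hc])
  have hint: "integrable lborel h" by (rule integrable_continuous_compact_support[OF hc supp])
  have Dm: "D \<in> borel_measurable borel"
    unfolding D_def[abs_def] by (rule borel_measurable_continuous_onI[OF cont])
  have Dsupp: "D x = 0" if "norm x > R" for x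
  proof -
    have "open {x::'a. norm x > R}" by (intro open_Collect_less continuous_intros)
    from frechet_derivative_eq_0_outside[OF this, of x h] that supp show ?thesis by (simp add: D_def)
  qed
  obtain B where B: "B \<ge> 0" "\<And>x. \<bar>D x\<bar> \<le> B"
    using bounded_continuous_compact_support[OF cont Dsupp[unfolded D_def]] unfolding D_def by metis
  define t where "t n = inverse (real (Suc n))" for n
  have t: "0 < t n" "t n \<le> 1" for n unfolding t_def by (auto simp: field_simps)
  have t0: "t \<longlonglongrightarrow> 0" unfolding t_def[abs_def] by (rule LIMSEQ_inverse_real_of_nat)
  define q where "q n x = (h (t n *\<^sub>R i + x) - h x) / t n" for n x
  have qzero: "(\<integral>x. q n x \<partial>lborel) = 0" for n
    unfolding q_def using hint integrable_lborel_translate[OF hint] integral_lborel_translate[OF hm, of "t n *\<^sub>R i"]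
    by simp
  have "(\<lambda>n. \<integral>x. q n x \<partial>lborel) \<longlonglongrightarrow> (\<integral>x. D x \<partial>lborel)"
  \<comment> \<open>As \<open>t n \<le> 1\<close>, points are moved by at most
    \<open>norm i\<close>, so all quotients vanish outside this ball; inside it the mean value
    inequality bounds them by \<open>B\<close>.\<close>
  proof (rule integral_dominated_convergence[where w="\<lambda>x. indicator (cball 0 (R + norm i)) x * B"])
    show "D \<in> borel_measurable lborel" using Dm by simp
    show "q n \<in> borel_measurable lborel" for n unfolding q_def by measurable
    show "integrable lborel (\<lambda>x. indicator (cball 0 (R + norm i)) x * B)"
      by (intro integrable_mult_left integrable_real_indicator) (use emeasure_bounded_finite[OF bounded_cball] in auto)
    show "AE x in lborel. (\<lambda>n. q n x) \<longlonglongrightarrow> D x"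
    proof (rule AE_I2)
      fix x
      have hd: "(h has_derivative frechet_derivative h (at x)) (at x)"
        using diff frechet_derivative_works by blast
      have "((\<lambda>s. x + s *\<^sub>R i) has_derivative (\<lambda>s. s *\<^sub>R i)) (at 0)"
        by (auto intro!: derivative_eq_intros)
      from diff_chain_at[OF this, of h "frechet_derivative h (at x)"] hd
      have "((\<lambda>s. h (x + s *\<^sub>R i)) has_derivative (\<lambda>r. frechet_derivative h (at x) (r *\<^sub>R i))) (at 0)"
        by (simp add: o_def)
      moreover have "frechet_derivative h (at x) (r *\<^sub>R i) = D x * r" for r
        using linear_scale[OF has_derivative_linear[OF hd]] by (simp add: D_def)
      ultimately have "((\<lambda>s. h (x + s *\<^sub>R i)) has_field_derivative D x) (at 0)"
        by (simp add: has_field_derivative_def mult_commute_abs)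
      then have "((\<lambda>s. (h (x + s *\<^sub>R i) - h x) / s) \<longlongrightarrow> D x) (at 0)"
        by (simp add: has_field_derivative_iff)
      moreover have "filterlim t (at 0) sequentially"
        using t0 t(1) by (simp add: filterlim_at less_imp_neq[symmetric] eventually_sequentially)
      ultimately have "(\<lambda>n. (h (x + t n *\<^sub>R i) - h x) / t n) \<longlonglongrightarrow> D x"
        by (rule filterlim_compose)
      then show "(\<lambda>n. q n x) \<longlonglongrightarrow> D x" by (simp add: q_def add.commute)
    qed
    show "AE x in lborel. norm (q n x) \<le> indicator (cball 0 (R + norm i)) x * B" for n
    proof (rule AE_I2)
      fix x
      show "norm (q n x) \<le> indicator (cball 0 (R + norm i)) x * B"
      proof (cases "norm x \<le> R + norm i")
        case True
        have "\<bar>h (x + t n *\<^sub>R i) - h x\<bar> \<le> B * \<bar>t n\<bar>"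
          by (rule directional_derivative_bound[OF diff B(2)[unfolded D_def]])
        then show ?thesis using True t[of n] by (simp add: q_def add.commute field_simps)
      next
        case False
        have "norm x \<le> norm (t n *\<^sub>R i + x) + norm (t n *\<^sub>R i)"
          using norm_triangle_ineq4[of "t n *\<^sub>R i + x" "t n *\<^sub>R i"] by simp
        also have "norm (t n *\<^sub>R i) \<le> norm i" using t[of n] by (simp add: mult_left_le_one_le)
        finally have "norm (t n *\<^sub>R i + x) > R" using False by simp
        moreover have "norm x > R" using False norm_ge_zero[of i] by linarith
        ultimately show ?thesis using False supp by (simp add: q_def)
      qed
    qed
  qed
  then show ?thesis by (simp add: qzero LIMSEQ_const_iff D_def)
qed

lemma test_fun_facts:
  assumes "test_fun \<Omega> \<phi>"
  shows "smooth_fun \<phi>"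
    and "\<And>x. x \<notin> \<Omega> \<Longrightarrow> \<phi> x = 0" "\<And>x i. x \<notin> \<Omega> \<Longrightarrow> frechet_derivative \<phi> (at x) i = 0"
    and "\<exists>R. \<forall>x. norm x > R \<longrightarrow> \<phi> x = 0 \<and> (\<forall>i. frechet_derivative \<phi> (at x) i = 0)"
proof -
  let ?K = "closure {x. \<phi> x \<noteq> 0}"
  have out: "\<phi> x = 0" "frechet_derivative \<phi> (at x) i = 0" if "x \<notin> ?K" for x i
  proof -
    show "\<phi> x = 0" using that closure_subset[of "{x. \<phi> x \<noteq> 0}"] by auto
    have "frechet_derivative \<phi> (at x) = (\<lambda>_. 0)"
      by (rule frechet_derivative_eq_0_outside[of "- ?K"])
         (use that closure_subset[of "{x. \<phi> x \<noteq> 0}"] in auto)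
    then show "frechet_derivative \<phi> (at x) i = 0" by simp
  qed
  show "smooth_fun \<phi>" using assms by (simp add: test_fun_def)
  show "\<phi> x = 0" "frechet_derivative \<phi> (at x) i = 0" if "x \<notin> \<Omega>" for x i
    using assms that out[of x] unfolding test_fun_def by auto
  have "bounded ?K" using assms by (simp add: test_fun_def compact_imp_bounded)
  then obtain R where "\<And>x. x \<in> ?K \<Longrightarrow> norm x \<le> R" unfolding bounded_iff by blast
  then show "\<exists>R. \<forall>x. norm x > R \<longrightarrow> \<phi> x = 0 \<and> (\<forall>i. frechet_derivative \<phi> (at x) i = 0)"
    using out by (meson not_le)
qed

lemma test_fun_bounded:
  assumes "test_fun \<Omega> \<phi>"
  obtains B where "B \<ge> 0" "\<And>x. \<bar>\<phi> x\<bar> \<le> B" "\<And>x. \<bar>frechet_derivative \<phi> (at x) i\<bar> \<le> B"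
proof -
  note s = test_fun_facts(1)[OF assms]
  obtain R where R: "\<And>x. norm x > R \<Longrightarrow> \<phi> x = 0" "\<And>x. norm x > R \<Longrightarrow> frechet_derivative \<phi> (at x) i = 0"
    using test_fun_facts(4)[OF assms] by blast
  obtain B1 where "B1 \<ge> 0" "\<And>x. \<bar>\<phi> x\<bar> \<le> B1"
    using bounded_continuous_compact_support[OF smooth_fun_continuous[OF s] R(1)] by blast
  moreover obtain B2 where "B2 \<ge> 0" "\<And>x. \<bar>frechet_derivative \<phi> (at x) i\<bar> \<le> B2"
    using bounded_continuous_compact_support[OF smooth_fun_partial_continuous[OF s] R(2)] by blast
  ultimately show thesis by (intro that[of "max B1 B2"]) (auto simp: le_max_iff_disj)
qed

lemma smooth_fun_measurable:
  assumes "smooth_fun \<phi>"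
  shows "\<phi> \<in> borel_measurable borel" "(\<lambda>x. frechet_derivative \<phi> (at x) i) \<in> borel_measurable borel"
  using assms by (auto intro!: borel_measurable_continuous_onI smooth_fun_continuous smooth_fun_partial_continuous)

section \<open>Square integrability and weak gradients on a bounded open set\<close>

abbreviation leb_on :: "'a::euclidean_space set \<Rightarrow> 'a measure" where
  "leb_on \<Omega> \<equiv> restrict_space lborel \<Omega>"

lemma set_integral_leb_on:
  fixes f :: "'a::euclidean_space \<Rightarrow> real"
  assumes "\<Omega> \<in> sets borel"
  shows "(\<integral>x\<in>\<Omega>. f x \<partial>lborel) = (\<integral>x. f x \<partial>leb_on \<Omega>)"
  using assms by (simp add: set_lebesgue_integral_def integral_restrict_space)

lemma set_nn_integral_leb_on:
  assumes "\<Omega> \<in> sets borel"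
  shows "(\<integral>\<^sup>+x\<in>\<Omega>. f x \<partial>lborel) = (\<integral>\<^sup>+x. f x \<partial>leb_on \<Omega>)"
  using assms by (simp add: nn_integral_restrict_space)

lemma finite_measure_leb_on:
  assumes "\<Omega> \<in> sets borel" "bounded \<Omega>"
  shows "finite_measure (leb_on \<Omega>)"
proof
  have "emeasure lborel \<Omega> < \<infinity>" by (rule emeasure_bounded_finite[OF assms(2)])
  then show "emeasure (leb_on \<Omega>) (space (leb_on \<Omega>)) \<noteq> \<infinity>"
    using assms(1) by (simp add: emeasure_restrict_space space_restrict_space)
qed

lemma L2_on_iff: "\<Omega> \<in> sets borel \<Longrightarrow> L2_on \<Omega> f \<longleftrightarrow> sq_integrable (leb_on \<Omega>) f"
  unfolding L2_on_def sq_integrable_def by (subst set_nn_integral_leb_on) auto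

lemma weak_grad_iff:
  assumes "\<Omega> \<in> sets borel"
  shows "weak_grad \<Omega> u G \<longleftrightarrow> sq_integrable (leb_on \<Omega>) G \<and>
     (\<forall>\<phi>. test_fun \<Omega> \<phi> \<longrightarrow> (\<forall>i\<in>Basis.
        (\<integral>x. u x * frechet_derivative \<phi> (at x) i \<partial>leb_on \<Omega>) = - (\<integral>x. (G x \<bullet> i) * \<phi> x \<partial>leb_on \<Omega>)))"
  unfolding weak_grad_def sq_integrable_def set_nn_integral_leb_on[OF assms] set_integral_leb_on[OF assms]
  by auto

locale bounded_open_set =
  fixes \<Omega> :: "'a::euclidean_space set"
  assumes open_\<Omega>: "open \<Omega>" and bounded_\<Omega>: "bounded \<Omega>" and nonempty_\<Omega>: "\<Omega> \<noteq> {}"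
begin

lemma borel_\<Omega>[measurable]: "\<Omega> \<in> sets borel" using open_\<Omega> by simp

lemma finite_leb_on: "finite_measure (leb_on \<Omega>)"
  using finite_measure_leb_on[OF borel_\<Omega> bounded_\<Omega>] .

lemma test_fun_sq_integrable:
  assumes "test_fun \<Omega> \<phi>"
  shows "sq_integrable (leb_on \<Omega>) \<phi>" "sq_integrable (leb_on \<Omega>) (\<lambda>x. frechet_derivative \<phi> (at x) i)"
proof -
  obtain B where B: "\<And>x. \<bar>\<phi> x\<bar> \<le> B" "\<And>x. \<bar>frechet_derivative \<phi> (at x) i\<bar> \<le> B"
    using test_fun_bounded[OF assms, of i] by metis
  show "sq_integrable (leb_on \<Omega>) \<phi>" "sq_integrable (leb_on \<Omega>) (\<lambda>x. frechet_derivative \<phi> (at x) i)"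
    by (rule sq_integrable_bounded[OF finite_leb_on, where B=B];
        use B smooth_fun_measurable[OF test_fun_facts(1)[OF assms]] in \<open>auto intro: measurable_restrict_space1\<close>)+
qed

lemma sq_integrable_component:
  "sq_integrable (leb_on \<Omega>) G \<Longrightarrow> i \<in> Basis \<Longrightarrow> sq_integrable (leb_on \<Omega>) (\<lambda>x. G x \<bullet> i)"
proof -
  assume G: "sq_integrable (leb_on \<Omega>) G" and i: "i \<in> Basis"
  then have [measurable]: "G \<in> borel_measurable (leb_on \<Omega>)" by (simp add: sq_integrable_measurable)
  have "L2sq (leb_on \<Omega>) (\<lambda>x. G x \<bullet> i) \<le> L2sq (leb_on \<Omega>) G"
    using Basis_le_norm[OF i] by (intro nn_integral_mono ennreal_leI power_mono) auto
  then show "sq_integrable (leb_on \<Omega>) (\<lambda>x. G x \<bullet> i)" using G by (auto simp: sq_integrable_def)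
qed

lemma weak_grad_lin:
  assumes "sq_integrable (leb_on \<Omega>) u" "sq_integrable (leb_on \<Omega>) v" "weak_grad \<Omega> u G" "weak_grad \<Omega> v F"
  shows "weak_grad \<Omega> (\<lambda>x. u x + c * v x) (\<lambda>x. G x + c *\<^sub>R F x)"
  unfolding weak_grad_iff[OF borel_\<Omega>]
proof (intro conjI allI impI ballI)
  note G = assms(3)[unfolded weak_grad_iff[OF borel_\<Omega>]] and F = assms(4)[unfolded weak_grad_iff[OF borel_\<Omega>]]
  show "sq_integrable (leb_on \<Omega>) (\<lambda>x. G x + c *\<^sub>R F x)" using G F by (intro sq_integrable_lin) auto
  fix \<phi> and i :: 'a assume \<phi>: "test_fun \<Omega> \<phi>" and i: "i \<in> Basis"
  note s = test_fun_sq_integrable[OF \<phi>]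
  have "(\<integral>x. (u x + c * v x) * frechet_derivative \<phi> (at x) i \<partial>leb_on \<Omega>) =
      (\<integral>x. u x * frechet_derivative \<phi> (at x) i \<partial>leb_on \<Omega>) + c * (\<integral>x. v x * frechet_derivative \<phi> (at x) i \<partial>leb_on \<Omega>)"
    using sq_integrable_inner_lin[OF assms(1,2) s(2)] by simp
  also have "\<dots> = - ((\<integral>x. (G x \<bullet> i) * \<phi> x \<partial>leb_on \<Omega>) + c * (\<integral>x. (F x \<bullet> i) * \<phi> x \<partial>leb_on \<Omega>))"
    using G F \<phi> i by simp
  also have "\<dots> = - (\<integral>x. ((G x + c *\<^sub>R F x) \<bullet> i) * \<phi> x \<partial>leb_on \<Omega>)"
    using sq_integrable_inner_lin[OF sq_integrable_component[OF conjunct1[OF G] i]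
        sq_integrable_component[OF conjunct1[OF F] i] s(1), of c]
    by (simp add: inner_simps)
  finally show "(\<integral>x. (u x + c * v x) * frechet_derivative \<phi> (at x) i \<partial>leb_on \<Omega>) =
      - (\<integral>x. ((G x + c *\<^sub>R F x) \<bullet> i) * \<phi> x \<partial>leb_on \<Omega>)" .
qed

text \<open>On a set of finite measure square integrable functions are integrable, as the
  fundamental lemma asks.\<close>

lemma sq_integrable_orthogonal_test_fun_AE_zero:
  assumes f: "sq_integrable (leb_on \<Omega>) f"
    and zero: "\<And>\<phi>. test_fun \<Omega> \<phi> \<Longrightarrow> (\<integral>x. f x * \<phi> x \<partial>leb_on \<Omega>) = 0"
  shows "AE x in lborel. x \<in> \<Omega> \<longrightarrow> f x = 0"
proof (rule test_fun_orthogonal_AE_zero[OF open_\<Omega>])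
  have one: "sq_integrable (leb_on \<Omega>) (\<lambda>_. 1::real)"
    by (rule sq_integrable_bounded[OF finite_leb_on, of _ 1]) auto
  have "integrable (leb_on \<Omega>) f" using sq_integrable_mult[OF f one] by simp
  then show "set_integrable lborel \<Omega> f" by (simp add: integrable_restrict_space set_integrable_def)
  show "(\<integral>x\<in>\<Omega>. f x * \<phi> x \<partial>lborel) = 0" if "test_fun \<Omega> \<phi>" for \<phi>
    using zero[OF that] by (simp add: set_integral_leb_on)
qed

text \<open>Since \<open>wgrad\<close> is an arbitrary choice, uniqueness up to null sets is what
  lets its integrals be computed from any convenient weak gradient.\<close>

lemma weak_grad_unique:
  assumes "weak_grad \<Omega> u G" "weak_grad \<Omega> u F"
  shows "AE x in leb_on \<Omega>. G x = F x"
proof -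
  note G = assms(1)[unfolded weak_grad_iff[OF borel_\<Omega>]] and F = assms(2)[unfolded weak_grad_iff[OF borel_\<Omega>]]
  have "AE x in lborel. x \<in> \<Omega> \<longrightarrow> G x \<bullet> i - F x \<bullet> i = 0" if i: "i \<in> Basis" for i
  proof (rule sq_integrable_orthogonal_test_fun_AE_zero)
    have Gi: "sq_integrable (leb_on \<Omega>) (\<lambda>x. G x \<bullet> i)" and Fi: "sq_integrable (leb_on \<Omega>) (\<lambda>x. F x \<bullet> i)"
      using G F i sq_integrable_component by auto
    then show "sq_integrable (leb_on \<Omega>) (\<lambda>x. G x \<bullet> i - F x \<bullet> i)" by (rule sq_integrable_diff)
    show "(\<integral>x. (G x \<bullet> i - F x \<bullet> i) * \<phi> x \<partial>leb_on \<Omega>) = 0" if \<phi>: "test_fun \<Omega> \<phi>" for \<phi>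
    proof -
      have "(\<integral>x. (G x \<bullet> i) * \<phi> x \<partial>leb_on \<Omega>) = (\<integral>x. (F x \<bullet> i) * \<phi> x \<partial>leb_on \<Omega>)"
        using conjunct2[OF G, rule_format, OF \<phi> i] conjunct2[OF F, rule_format, OF \<phi> i] by simp
      then show ?thesis
        using sq_integrable_mult[OF Gi test_fun_sq_integrable(1)[OF \<phi>]]
          sq_integrable_mult[OF Fi test_fun_sq_integrable(1)[OF \<phi>]]
        by (simp add: left_diff_distrib)
    qed
  qed
  then have "AE x in lborel. \<forall>i\<in>Basis. x \<in> \<Omega> \<longrightarrow> G x \<bullet> i - F x \<bullet> i = 0"
    by (intro AE_finite_allI) auto
  then have "AE x in lborel. x \<in> \<Omega> \<longrightarrow> G x = F x"
    by eventually_elim (auto intro: euclidean_eqI)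
  then show ?thesis by (simp add: AE_restrict_space_iff)
qed

lemma weak_grad_wgrad: "H1_on \<Omega> u \<Longrightarrow> weak_grad \<Omega> u (wgrad \<Omega> u)"
  unfolding H1_on_def wgrad_def using someI_ex[of "weak_grad \<Omega> u"] by blast

lemma wgrad_AE_eq:
  assumes "weak_grad \<Omega> u G"
  shows "AE x in leb_on \<Omega>. wgrad \<Omega> u x = G x"
  unfolding wgrad_def by (rule weak_grad_unique[OF someI[of "weak_grad \<Omega> u", OF assms] assms])

text \<open>Integration by parts: the product of \<open>u\<close> with a test function has compact
  support, so its partial derivatives have integral zero. \<open>u\<close> itself may be supported
  everywhere, as constants are.\<close>

lemma weak_grad_smooth:
  assumes u: "smooth_fun u" and sq: "sq_integrable (leb_on \<Omega>) (\<lambda>x. \<Sum>i\<in>Basis. frechet_derivative u (at x) i *\<^sub>R i)"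
  shows "weak_grad \<Omega> u (\<lambda>x. \<Sum>i\<in>Basis. frechet_derivative u (at x) i *\<^sub>R i)"
  unfolding weak_grad_iff[OF borel_\<Omega>]
proof (intro conjI allI impI ballI sq)
  fix \<phi> and i :: 'a assume \<phi>: "test_fun \<Omega> \<phi>" and i: "i \<in> Basis"
  note f = test_fun_facts[OF \<phi>]
  obtain R where R: "\<And>x. norm x > R \<Longrightarrow> \<phi> x = 0" "\<And>x. norm x > R \<Longrightarrow> frechet_derivative \<phi> (at x) i = 0"
    using f(4) by blast
  define D where "D x = u x * frechet_derivative \<phi> (at x) i + frechet_derivative u (at x) i * \<phi> x" for x
  have D: "((\<lambda>x. u x * \<phi> x) has_derivative (\<lambda>e. u x * frechet_derivative \<phi> (at x) e + frechet_derivative u (at x) e * \<phi> x)) (at x)" for x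
    using smooth_fun_differentiable[OF u] smooth_fun_differentiable[OF f(1)]
    by (intro has_derivative_mult) (auto simp: frechet_derivative_works)
  have eq: "frechet_derivative (\<lambda>x. u x * \<phi> x) (at x) i = D x" for x
    using frechet_derivative_at[OF D[of x], symmetric] by (simp add: D_def)
  note c = smooth_fun_continuous[OF u] smooth_fun_continuous[OF f(1)]
    smooth_fun_partial_continuous[OF u] smooth_fun_partial_continuous[OF f(1)]
  have "(\<integral>x. frechet_derivative (\<lambda>x. u x * \<phi> x) (at x) i \<partial>lborel) = 0"
  proof (rule integral_partial_derivative_zero[where R=R])
    show "(\<lambda>x. u x * \<phi> x) differentiable (at x)" for x using D differentiableI by blast
    show "continuous_on UNIV (\<lambda>x. frechet_derivative (\<lambda>x. u x * \<phi> x) (at x) i)"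
      unfolding eq D_def by (intro continuous_intros c)
  qed (use R in auto)
  then have "(\<integral>x. D x \<partial>lborel) = 0" by (simp add: eq)
  moreover have "integrable lborel (\<lambda>x. u x * frechet_derivative \<phi> (at x) i)"
    "integrable lborel (\<lambda>x. frechet_derivative u (at x) i * \<phi> x)"
    by (rule integrable_continuous_compact_support[where R=R]; use R in \<open>auto intro!: continuous_intros c\<close>)+
  ultimately have *: "(\<integral>x. u x * frechet_derivative \<phi> (at x) i \<partial>lborel) = - (\<integral>x. frechet_derivative u (at x) i * \<phi> x \<partial>lborel)"
    by (simp add: D_def)
  have "(\<integral>x. u x * frechet_derivative \<phi> (at x) i \<partial>leb_on \<Omega>) = (\<integral>x. u x * frechet_derivative \<phi> (at x) i \<partial>lborel)"
    unfolding integral_restrict_space[of \<Omega> lborel, simplified]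
    by (intro Bochner_Integration.integral_cong) (use f(3) in \<open>auto simp: indicator_def\<close>)
  moreover have "(\<integral>x. frechet_derivative u (at x) i * \<phi> x \<partial>leb_on \<Omega>) = (\<integral>x. frechet_derivative u (at x) i * \<phi> x \<partial>lborel)"
    unfolding integral_restrict_space[of \<Omega> lborel, simplified]
    by (intro Bochner_Integration.integral_cong) (use f(2) in \<open>auto simp: indicator_def\<close>)
  moreover have "(\<Sum>j\<in>Basis. frechet_derivative u (at x) j *\<^sub>R j) \<bullet> i = frechet_derivative u (at x) i" for x
    using i by (simp add: inner_sum_left inner_Basis if_distrib cong: if_cong)
  ultimately show "(\<integral>x. u x * frechet_derivative \<phi> (at x) i \<partial>leb_on \<Omega>) =
      - (\<integral>x. ((\<Sum>j\<in>Basis. frechet_derivative u (at x) j *\<^sub>R j) \<bullet> i) * \<phi> x \<partial>leb_on \<Omega>)"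
    using * by simp
qed

end

section \<open>The normalising constant\<close>

text \<open>Two applications of the functional equation,
  \<open>Gamma (2 - s) = (1 - s) * (- s) * Gamma (- s)\<close>, expose the zeros of the constant at
  both ends of the interval.\<close>

lemma cNs_eq:
  assumes "0 < s" "s < 1"
  shows "cNs n s = s * (1 - s) * (2 powr (2 * s - 1) * Gamma (real n / 2 + s) / (pi powr (real n / 2) * Gamma (2 - s)))"
proof -
  have "- s \<notin> \<int>\<^sub>\<le>\<^sub>0"
  proof
    assume "- s \<in> \<int>\<^sub>\<le>\<^sub>0"
    then obtain k :: int where "- s = of_int k" by (auto elim: nonpos_Ints_cases)
    then have "-1 < real_of_int k" "real_of_int k < 0" using assms by auto
    then have "-1 < k" "k < 0" by linarith+
    then show False by simp
  qed
  then have 1: "Gamma (1 - s) = - s * Gamma (- s)"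
    using Gamma_plus1[of "- s"] by (simp add: algebra_simps)
  have "1 - s \<notin> \<int>\<^sub>\<le>\<^sub>0" using assms nonpos_Ints_nonpos[of "1 - s"] by auto
  then have 2: "Gamma (2 - s) = (1 - s) * Gamma (1 - s)"
    using Gamma_plus1[of "1 - s"] by (simp add: algebra_simps)
  have G: "Gamma (2 - s) = (1 - s) * (- s * Gamma (- s))" using 1 2 by simp
  have "Gamma (2 - s) > 0" using assms by (intro Gamma_real_pos) auto
  then have "Gamma (- s) \<noteq> 0" using G by auto
  moreover have "(real n + 2 * s) / 2 = real n / 2 + s" by (simp add: field_simps)
  ultimately show ?thesis unfolding cNs_def G using assms by (simp add: field_simps)
qed

lemma cNs_pos:
  assumes "0 < s" "s < 1"
  shows "cNs n s > 0"
proof -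
  have "Gamma (real n / 2 + s) > 0" "Gamma (2 - s) > 0"
    using assms by (auto intro!: Gamma_real_pos add_nonneg_pos)
  then show ?thesis using assms by (simp add: cNs_eq)
qed

lemma continuous_on_Gamma_pos:
  fixes f :: "real \<Rightarrow> real"
  assumes "continuous_on S f" "\<And>x. x \<in> S \<Longrightarrow> f x > 0"
  shows "continuous_on S (\<lambda>x. Gamma (f x))"
proof (rule continuous_on_compose2[OF _ assms(1)])
  show "continuous_on (f ` S) Gamma"
    using assms(2) nonpos_Ints_nonpos[where 'a=real] by (intro continuous_on_Gamma) fastforce
qed simp

text \<open>The cofactor in \<open>cNs_eq\<close> is continuous up to both ends;
  \<open>n > 0\<close> keeps \<open>Gamma (real n / 2 + s)\<close> finite at
  \<open>s = 0\<close>.\<close>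

lemma cNs_bound:
  assumes "n > 0"
  obtains C where "C \<ge> 0" "\<And>s. 0 < s \<Longrightarrow> s < 1 \<Longrightarrow> cNs n s \<le> C * (s * (1 - s))"
proof -
  define g where "g s = 2 powr (2 * s - 1) * Gamma (real n / 2 + s) / (pi powr (real n / 2) * Gamma (2 - s))" for s :: real
  have "continuous_on {0..1} g"
    unfolding g_def using assms Gamma_real_pos[of "2 - x" for x]
    by (intro continuous_intros continuous_on_Gamma_pos) (auto intro!: add_pos_nonneg simp: less_imp_neq[symmetric])
  then have "compact (g ` {0..1})" by (rule compact_continuous_image) simp
  then obtain C where C: "C > 0" "\<And>s. s \<in> {0..1} \<Longrightarrow> norm (g s) \<le> C"
    using compact_imp_bounded bounded_pos by (metis imageI)
  show thesis
  proof (rule that[of C])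
    fix s :: real assume s: "0 < s" "s < 1"
    have "cNs n s = s * (1 - s) * g s" using s by (simp add: cNs_eq g_def)
    also have "\<dots> \<le> s * (1 - s) * C" using s C(2)[of s] by (intro mult_left_mono) auto
    finally show "cNs n s \<le> C * (s * (1 - s))" by (simp add: mult_ac)
  qed (use C in auto)
qed

lemma cNs_measurable: "cNs n \<in> borel_measurable (restrict_space borel {0<..<1})"
proof (rule borel_measurable_continuous_on_restrict)
  have "continuous_on {0<..<1} (\<lambda>s. s * (1 - s) * (2 powr (2 * s - 1) * Gamma (real n / 2 + s) / (pi powr (real n / 2) * Gamma (2 - s))))"
    using Gamma_real_pos[of "2 - x" for x]
    by (intro continuous_intros continuous_on_Gamma_pos) (auto intro!: add_nonneg_pos simp: less_imp_neq[symmetric])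
  then show "continuous_on {0<..<1} (cNs n)"
    by (rule continuous_on_eq) (auto simp: cNs_eq)
qed

section \<open>The energy form\<close>

locale neumann_problem = bounded_open_set \<Omega> for \<Omega> :: "'a::euclidean_space set" +
  fixes \<alpha> :: real and \<mu> :: "real measure"
  assumes \<alpha>_nonneg: "\<alpha> \<ge> 0" and admissible: "admissible_mu \<mu>"
begin

lemma
  shows sets_\<mu>: "sets \<mu> = sets (restrict_space borel {0<..<1})"
  and finite_\<mu>: "finite_measure \<mu>" and nontrivial_\<mu>: "emeasure \<mu> (space \<mu>) \<noteq> 0"
  using admissible by (auto simp: admissible_mu_def)

lemma space_\<mu>: "space \<mu> = {0<..<1}"
  using sets_eq_imp_space_eq[OF sets_\<mu>] by (simp add: space_restrict_space)

lemma measurable_\<mu>: "f \<in> borel_measurable (restrict_space borel {0<..<1}) \<Longrightarrow> f \<in> borel_measurable \<mu>"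
  using measurable_cong_sets[OF sets_\<mu> refl] by blast

lemma cNs_measurable_\<mu>[measurable]: "cNs n \<in> borel_measurable \<mu>"
  by (rule measurable_\<mu>[OF cNs_measurable])

lemma ident_measurable_\<mu>[measurable]: "(\<lambda>s. s) \<in> borel_measurable \<mu>"
  by (rule measurable_\<mu>) (simp add: measurable_restrict_space1)

abbreviation lborel2 :: "('a \<times> 'a) measure" where "lborel2 \<equiv> lborel \<Otimes>\<^sub>M lborel"

sublocale M: finite_measure \<mu> by (rule finite_\<mu>)

lemma sigma_finite_lborel2: "sigma_finite_measure lborel2"
  unfolding lborel_prod by (rule sigma_finite_lborel)

sublocale MP: pair_sigma_finite \<mu> lborel2
  by (intro pair_sigma_finite.intro sigma_finite_lborel2) unfold_locales

abbreviation nonlocal_measure :: "(real \<times> 'a \<times> 'a) measure" where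
  "nonlocal_measure \<equiv> \<mu> \<Otimes>\<^sub>M lborel2"

text \<open>The square root of the kernel, including the factor 1/2 of the weak formulation. On the
  diagonal it is 0 because \<open>0 powr _ = 0\<close>.\<close>

definition kern :: "real \<Rightarrow> 'a \<times> 'a \<Rightarrow> real" where
  "kern s z = sqrt (cNs DIM('a) s / 2) * norm (fst z - snd z) powr (- (real DIM('a) + 2 * s) / 2)"

text \<open>The weighted difference \<open>D u\<close> makes the nonlocal form an \<open>L\<^sup>2\<close> inner product.\<close>

definition D :: "('a \<Rightarrow> real) \<Rightarrow> real \<times> 'a \<times> 'a \<Rightarrow> real" where
  "D u p = indicator (Qset \<Omega>) (snd p) * kern (fst p) (snd p) * (u (fst (snd p)) - u (snd (snd p)))"

lemma Qset_measurable[measurable]: "Qset \<Omega> \<in> sets lborel2"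
proof -
  have "(UNIV - \<Omega>) \<times> (UNIV - \<Omega>) \<in> sets lborel2" by (intro pair_measureI) auto
  then have "space lborel2 - (UNIV - \<Omega>) \<times> (UNIV - \<Omega>) \<in> sets lborel2" by (rule sets.compl_sets)
  then show ?thesis by (simp add: Qset_def space_pair_measure)
qed

lemma D_measurable:
  assumes [measurable]: "u \<in> borel_measurable borel"
  shows "D u \<in> borel_measurable nonlocal_measure"
proof -
  have [measurable]: "u \<in> borel_measurable lborel" by simp
  show ?thesis unfolding D_def kern_def by measurable
qed

lemma kern_sq:
  assumes "s \<in> {0<..<1}"
  shows "kern s z * kern s z = cNs DIM('a) s / 2 / norm (fst z - snd z) powr (real DIM('a) + 2 * s)"
proof -
  \<comment> \<open>Also correct for \<open>x = 0\<close>, where both sides are 0.\<close>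
  have p: "(x::real) powr (- p / 2) * x powr (- p / 2) = 1 / x powr p" for x p
    by (simp add: powr_add[symmetric] powr_minus_divide[symmetric])
  have c: "sqrt (cNs DIM('a) s / 2) * sqrt (cNs DIM('a) s / 2) = cNs DIM('a) s / 2"
    using cNs_pos[of s "DIM('a)"] assms by simp
  have "kern s z * kern s z = (sqrt (cNs DIM('a) s / 2) * sqrt (cNs DIM('a) s / 2)) *
      (norm (fst z - snd z) powr (- (real DIM('a) + 2 * s) / 2) * norm (fst z - snd z) powr (- (real DIM('a) + 2 * s) / 2))"
    unfolding kern_def by (simp only: mult_ac)
  then show ?thesis unfolding p c by simp
qed

lemma D_mult:
  assumes "s \<in> {0<..<1}"
  shows "D u (s, z) * D v (s, z) = cNs DIM('a) s / 2 * (indicator (Qset \<Omega>) z *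
    ((u (fst z) - u (snd z)) * (v (fst z) - v (snd z)) / norm (fst z - snd z) powr (real DIM('a) + 2 * s)))"
proof -
  have "D u (s, z) * D v (s, z) = (kern s z * kern s z) * (indicator (Qset \<Omega>) z *
      ((u (fst z) - u (snd z)) * (v (fst z) - v (snd z))))"
    by (simp add: D_def indicator_def)
  then show ?thesis unfolding kern_sq[OF assms] by simp
qed

text \<open>The 2 appears because the seminorm carries the full constant and the form only half of
  it.\<close>

lemma frac_seminorm_sq_D:
  assumes [measurable]: "u \<in> borel_measurable borel"
  shows "(\<integral>\<^sup>+ s. frac_seminorm_sq \<Omega> s u \<partial>\<mu>) = 2 * L2sq nonlocal_measure (D u)"
proof -
  have [measurable]: "D u \<in> borel_measurable nonlocal_measure" by (rule D_measurable) simp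
  have "(\<integral>\<^sup>+ s. frac_seminorm_sq \<Omega> s u \<partial>\<mu>) = (\<integral>\<^sup>+ s. 2 * L2sq lborel2 (\<lambda>z. D u (s, z)) \<partial>\<mu>)"
  proof (rule nn_integral_cong)
    fix s assume "s \<in> space \<mu>"
    then have s: "s \<in> {0<..<1}" by (simp add: space_\<mu>)
    then have c: "cNs DIM('a) s > 0" using cNs_pos by auto
    have "2 * L2sq lborel2 (\<lambda>z. D u (s, z)) = (\<integral>\<^sup>+ z. 2 * ennreal ((norm (D u (s, z)))\<^sup>2) \<partial>lborel2)"
      using \<open>s \<in> space \<mu>\<close> by (intro nn_integral_cmult[symmetric]) measurable
    also have "\<dots> = (\<integral>\<^sup>+ z. ennreal (cNs DIM('a) s) * (ennreal ((u (fst z) - u (snd z))\<^sup>2 /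
        norm (fst z - snd z) powr (real DIM('a) + 2 * s)) * indicator (Qset \<Omega>) z) \<partial>lborel2)"
    proof (rule nn_integral_cong)
      fix z
      have "2 * ennreal ((norm (D u (s, z)))\<^sup>2) = ennreal (2 * (D u (s, z) * D u (s, z)))"
        by (subst ennreal_mult'') (auto simp: power2_eq_square)
      also have "2 * (D u (s, z) * D u (s, z)) = cNs DIM('a) s * ((u (fst z) - u (snd z))\<^sup>2 /
        norm (fst z - snd z) powr (real DIM('a) + 2 * s) * indicator (Qset \<Omega>) z)"
        unfolding D_mult[OF s] by (simp add: power2_eq_square)
      also have "ennreal \<dots> = ennreal (cNs DIM('a) s) * (ennreal ((u (fst z) - u (snd z))\<^sup>2 /
        norm (fst z - snd z) powr (real DIM('a) + 2 * s)) * indicator (Qset \<Omega>) z)"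
        using c by (cases "z \<in> Qset \<Omega>") (simp_all add: ennreal_mult'[symmetric])
      finally show "2 * ennreal ((norm (D u (s, z)))\<^sup>2) = ennreal (cNs DIM('a) s) * (ennreal ((u (fst z) - u (snd z))\<^sup>2 /
        norm (fst z - snd z) powr (real DIM('a) + 2 * s)) * indicator (Qset \<Omega>) z)" .
    qed
    also have "\<dots> = frac_seminorm_sq \<Omega> s u"
      unfolding frac_seminorm_sq_def by (rule nn_integral_cmult) measurable
    finally show "frac_seminorm_sq \<Omega> s u = 2 * L2sq lborel2 (\<lambda>z. D u (s, z))" by simp
  qed
  also have "\<dots> = 2 * (\<integral>\<^sup>+ s. L2sq lborel2 (\<lambda>z. D u (s, z)) \<partial>\<mu>)"
    by (rule nn_integral_cmult) measurable
  also have "(\<integral>\<^sup>+ s. L2sq lborel2 (\<lambda>z. D u (s, z)) \<partial>\<mu>) =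
      L2sq nonlocal_measure (D u)"
    by (rule sigma_finite_measure.nn_integral_fst[OF sigma_finite_lborel2]) measurable
  finally show ?thesis .
qed

text \<open>\<open>frac_form\<close> is a Bochner integral and silently 0 where its integrand is not
  integrable; joint integrability is what lets Fubini identify both sides.\<close>

lemma frac_form_D:
  assumes "integrable nonlocal_measure (\<lambda>p. D u p * D v p)"
  shows "(\<integral>s. frac_form \<Omega> s u v \<partial>\<mu>) = (\<integral>p. D u p * D v p \<partial>nonlocal_measure)"
proof -
  have "(\<integral>s. frac_form \<Omega> s u v \<partial>\<mu>) = (\<integral>s. (\<integral>z. D u (s, z) * D v (s, z) \<partial>lborel2) \<partial>\<mu>)"
    by (intro Bochner_Integration.integral_cong refl)
       (simp only: frac_form_def D_mult space_\<mu> set_lebesgue_integral_def real_scaleR_def integral_mult_right_zero)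
  also have "\<dots> = (\<integral>p. D u p * D v p \<partial>nonlocal_measure)"
    using MP.integral_fst'[OF assms] by simp
  finally show ?thesis .
qed

section \<open>The space H and its two forms\<close>

abbreviation H :: "('a \<Rightarrow> real) set" where "H \<equiv> H_space \<alpha> \<mu> \<Omega>"

text \<open>Membership becomes square integrability on two measure spaces plus a weak gradient, so
  that closure and limits in \<open>H\<close> reduce to facts about
  \<open>L\<^sup>2\<close>.\<close>

lemma H_iff:
  "u \<in> H \<longleftrightarrow> u \<in> borel_measurable borel \<and> sq_integrable (leb_on \<Omega>) u \<and>
     sq_integrable nonlocal_measure (D u) \<and> (\<alpha> > 0 \<longrightarrow> (\<exists>G. weak_grad \<Omega> u G))"
proof (cases "u \<in> borel_measurable borel")
  case True
  have m1: "u \<in> borel_measurable (leb_on \<Omega>)" using True by (simp add: measurable_restrict_space1)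
  have m2: "D u \<in> borel_measurable nonlocal_measure" by (rule D_measurable[OF True])
  have m3: "L2_on \<Omega> u \<longleftrightarrow> sq_integrable (leb_on \<Omega>) u" by (rule L2_on_iff) simp
  have 1: "(\<integral>\<^sup>+ x\<in>\<Omega>. ennreal ((u x)\<^sup>2) \<partial>lborel) < \<infinity> \<longleftrightarrow> sq_integrable (leb_on \<Omega>) u"
    using m1 by (simp add: sq_integrable_def set_nn_integral_leb_on)
  have 2: "(\<integral>\<^sup>+ s. frac_seminorm_sq \<Omega> s u \<partial>\<mu>) < \<infinity> \<longleftrightarrow> sq_integrable nonlocal_measure (D u)"
    unfolding frac_seminorm_sq_D[OF True] using m2 by (auto simp: sq_integrable_def ennreal_mult_less_top)
  show ?thesis using True 1 2 m3 by (auto simp: H_space_def H1_on_def)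
next
  case False then show ?thesis by (simp add: H_space_def)
qed

lemma HD:
  assumes "u \<in> H"
  shows "u \<in> borel_measurable borel" "sq_integrable (leb_on \<Omega>) u" "sq_integrable nonlocal_measure (D u)"
    and "\<alpha> > 0 \<Longrightarrow> weak_grad \<Omega> u (wgrad \<Omega> u)"
    and "\<alpha> > 0 \<Longrightarrow> sq_integrable (leb_on \<Omega>) (wgrad \<Omega> u)"
proof -
  show *: "u \<in> borel_measurable borel" "sq_integrable (leb_on \<Omega>) u" "sq_integrable nonlocal_measure (D u)"
    using assms by (auto simp: H_iff)
  show w: "weak_grad \<Omega> u (wgrad \<Omega> u)" if "\<alpha> > 0"
    using assms that * by (intro weak_grad_wgrad) (auto simp: H_iff H1_on_def L2_on_iff)
  show "sq_integrable (leb_on \<Omega>) (wgrad \<Omega> u)" if "\<alpha> > 0"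
    using w[OF that] by (simp add: weak_grad_iff)
qed

definition bform :: "('a \<Rightarrow> real) \<Rightarrow> ('a \<Rightarrow> real) \<Rightarrow> real" where
  "bform u v = (\<integral>x. u x * v x \<partial>leb_on \<Omega>)"

text \<open>For \<open>\<alpha> = 0\<close> weak gradients need not exist and \<open>wgrad\<close>
  is then an arbitrary value, but its integral is multiplied by 0.\<close>

definition aform :: "('a \<Rightarrow> real) \<Rightarrow> ('a \<Rightarrow> real) \<Rightarrow> real" where
  "aform u v = \<alpha> * (\<integral>x. wgrad \<Omega> u x \<bullet> wgrad \<Omega> v x \<partial>leb_on \<Omega>) + (\<integral>p. D u p * D v p \<partial>nonlocal_measure)"

lemma D_lin: "D (\<lambda>x. u x + c * v x) = (\<lambda>p. D u p + c *\<^sub>R D v p)"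
  by (simp add: D_def fun_eq_iff algebra_simps)

lemma D_diff: "D (\<lambda>x. u x - v x) = (\<lambda>p. D u p - D v p)"
  using D_lin[of u "-1" v] by simp

lemma H_lin: "u \<in> H \<Longrightarrow> v \<in> H \<Longrightarrow> (\<lambda>x. u x + c * v x) \<in> H"
  using sq_integrable_lin[of "leb_on \<Omega>" u v c] sq_integrable_lin[of nonlocal_measure "D u" "D v" c]
    weak_grad_lin[of u v _ _ c]
  unfolding H_iff D_lin by auto

lemma wgrad_lin:
  assumes "u \<in> H" "v \<in> H" "\<alpha> > 0"
  shows "AE x in leb_on \<Omega>. wgrad \<Omega> (\<lambda>x. u x + c * v x) x = wgrad \<Omega> u x + c *\<^sub>R wgrad \<Omega> v x"
  using assms HD by (intro wgrad_AE_eq weak_grad_lin) auto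

lemma wgrad_form_lin:
  assumes "u \<in> H" "v \<in> H" "w \<in> H" "\<alpha> > 0"
  shows "(\<integral>x. wgrad \<Omega> (\<lambda>x. u x + c * v x) x \<bullet> wgrad \<Omega> w x \<partial>leb_on \<Omega>) =
    (\<integral>x. wgrad \<Omega> u x \<bullet> wgrad \<Omega> w x \<partial>leb_on \<Omega>) + c * (\<integral>x. wgrad \<Omega> v x \<bullet> wgrad \<Omega> w x \<partial>leb_on \<Omega>)"
proof -
  have [measurable]: "wgrad \<Omega> v \<in> borel_measurable (leb_on \<Omega>)" if "v \<in> H" for v
    using HD(5)[OF that assms(4)] by (rule sq_integrable_measurable)
  have "(\<integral>x. wgrad \<Omega> (\<lambda>x. u x + c * v x) x \<bullet> wgrad \<Omega> w x \<partial>leb_on \<Omega>) =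
      (\<integral>x. (wgrad \<Omega> u x + c *\<^sub>R wgrad \<Omega> v x) \<bullet> wgrad \<Omega> w x \<partial>leb_on \<Omega>)"
    using assms H_lin[OF assms(1,2), of c] wgrad_lin[OF assms(1,2,4), of c] by (intro integral_cong_AE) auto
  also have "\<dots> = (\<integral>x. wgrad \<Omega> u x \<bullet> wgrad \<Omega> w x \<partial>leb_on \<Omega>) + c * (\<integral>x. wgrad \<Omega> v x \<bullet> wgrad \<Omega> w x \<partial>leb_on \<Omega>)"
    using assms HD(5) by (intro sq_integrable_inner_lin) auto
  finally show ?thesis .
qed

lemma bform_psd: "psd_form H bform"
proof
  show "(\<lambda>x. u x + c * v x) \<in> H" if "u \<in> H" "v \<in> H" for u v c using that by (rule H_lin)
  show "bform u v = bform v u" for u v by (simp add: bform_def mult.commute)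
  show "bform (\<lambda>x. u x + c * v x) w = bform u w + c * bform v w" if "u \<in> H" "v \<in> H" "w \<in> H" for u v w c
    using sq_integrable_inner_lin[OF HD(2)[OF that(1)] HD(2)[OF that(2)] HD(2)[OF that(3)], of c]
    by (simp add: bform_def)
  show "0 \<le> bform u u" for u by (simp add: bform_def)
qed

lemma aform_psd: "psd_form H aform"
proof
  show "(\<lambda>x. u x + c * v x) \<in> H" if "u \<in> H" "v \<in> H" for u v c using that by (rule H_lin)
  show "aform u v = aform v u" for u v by (simp add: aform_def mult.commute inner_commute)
  show "aform (\<lambda>x. u x + c * v x) w = aform u w + c * aform v w" if "u \<in> H" "v \<in> H" "w \<in> H" for u v w c
  proof -
    have "(\<integral>p. D (\<lambda>x. u x + c * v x) p * D w p \<partial>nonlocal_measure) =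
        (\<integral>p. D u p * D w p \<partial>nonlocal_measure) + c * (\<integral>p. D v p * D w p \<partial>nonlocal_measure)"
      unfolding D_lin
      using sq_integrable_inner_lin[OF HD(3)[OF that(1)] HD(3)[OF that(2)] HD(3)[OF that(3)], of c] by simp
    moreover have "\<alpha> * (\<integral>x. wgrad \<Omega> (\<lambda>x. u x + c * v x) x \<bullet> wgrad \<Omega> w x \<partial>leb_on \<Omega>) =
        \<alpha> * ((\<integral>x. wgrad \<Omega> u x \<bullet> wgrad \<Omega> w x \<partial>leb_on \<Omega>) + c * (\<integral>x. wgrad \<Omega> v x \<bullet> wgrad \<Omega> w x \<partial>leb_on \<Omega>))"
      using wgrad_form_lin[OF that, of c] \<alpha>_nonneg by (cases "\<alpha> = 0") auto
    ultimately show ?thesis by (simp add: aform_def algebra_simps)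
  qed
  show "0 \<le> aform u u" for u using \<alpha>_nonneg by (simp add: aform_def)
qed

lemma neumann_eigenpair_iff:
  "neumann_eigenpair \<alpha> \<mu> \<Omega> lam u \<longleftrightarrow> u \<in> H \<and> (\<exists>x. u x \<noteq> 0) \<and> (\<forall>v\<in>H. aform u v = lam * bform u v)"
proof -
  have "(\<integral>s. frac_form \<Omega> s u v \<partial>\<mu>) = (\<integral>p. D u p * D v p \<partial>nonlocal_measure)" if "u \<in> H" "v \<in> H" for v
    using HD(3) that by (intro frac_form_D sq_integrable_mult)
  then show ?thesis
    by (auto simp: neumann_eigenpair_def aform_def bform_def set_integral_leb_on)
qed

end

section \<open>Smooth functions have finite energy\<close>

lemma dyadic_inside:
  fixes r :: real
  assumes "0 < r" "r < 1"
  shows "\<exists>k. (1/2)^(Suc k) \<le> r \<and> r < 2 * (1/2)^(Suc k)"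
proof -
  obtain n where n: "(1/2)^n \<le> r" using assms real_arch_pow_inv[of r "1/2"] by (auto intro: less_imp_le)
  define m where "m = (LEAST n. (1/2)^n \<le> r)"
  have m: "(1/2)^m \<le> r" unfolding m_def by (rule LeastI[of "\<lambda>n. (1/2)^n \<le> r", OF n])
  have "m \<noteq> 0" using m assms by (cases m) auto
  then obtain k where k: "m = Suc k" using not0_implies_Suc by blast
  have "\<not> (1/2)^k \<le> r" unfolding m_def using not_less_Least[of k "\<lambda>n. (1/2)^n \<le> r"] k m_def by auto
  then show ?thesis using m k by (intro exI[of _ k]) auto
qed

lemma dyadic_outside:
  fixes r :: real
  assumes "1 \<le> r"
  shows "\<exists>k. 2^k \<le> r \<and> r < 2 * 2^k"
proof -
  obtain n where n: "r < 2^n" using real_arch_pow[of 2 r] by auto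
  define m where "m = (LEAST n. r < 2^n)"
  have m: "r < 2^m" unfolding m_def by (rule LeastI[of "\<lambda>n. r < 2^n", OF n])
  have "m \<noteq> 0" using m assms by (cases m) auto
  then obtain k where k: "m = Suc k" using not0_implies_Suc by blast
  have "\<not> r < 2^k" using not_less_Least[of k "\<lambda>n. r < 2^n"] k m_def by auto
  then show ?thesis using m k by (intro exI[of _ k]) auto
qed

text \<open>The series grows no faster than \<open>1 / t\<close> as \<open>t\<close> tends to 0, a
  rate that the zeros of \<open>cNs\<close> can absorb.\<close>

lemma geometric_powr_bound:
  fixes t :: real
  assumes "0 < t" "t < 1"
  shows "(\<Sum>k. ennreal ((2 powr (- 2 * t)) ^ k)) \<le> ennreal (2 / t)"
proof -
  define q where "q = 2 powr (- 2 * t)"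
  have "q = exp (- (2 * ln 2 * t))" by (simp add: q_def powr_def)
  \<comment> \<open>Only \<open>2 * ln 2 \<ge> 1\<close> is needed.\<close>
  also have "\<dots> \<le> exp (- t)" using ln2_ge_two_thirds assms by simp
  also have "\<dots> \<le> 1 / (1 + t)"
    using exp_ge_add_one_self[of t] assms by (simp add: exp_minus field_simps)
  finally have "1 - q \<ge> t / (1 + t)" using assms by (simp add: field_simps)
  moreover have "t / (1 + t) \<ge> t / 2" using assms by (intro divide_left_mono) auto
  ultimately have q: "1 - q \<ge> t / 2" by linarith
  have q0: "0 \<le> q" "q < 1" using q assms by (auto simp: q_def)
  have "(\<Sum>k. ennreal (q ^ k)) = ennreal (1 / (1 - q))"
    using q0 by (subst suminf_ennreal2) (auto simp: suminf_geometric summable_geometric)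
  also have "\<dots> \<le> ennreal (2 / t)" using q assms by (intro ennreal_leI) (simp add: field_simps)
  finally show ?thesis by (simp add: q_def)
qed

text \<open>For a bounded Lipschitz function the squared increment over \<open>h\<close> is at most
  a constant times \<open>min ((norm h)\<^sup>2) 1\<close>; the weight is the resulting majorant of
  the energy density.\<close>

definition sing_weight :: "real \<Rightarrow> 'a::euclidean_space \<Rightarrow> real" where
  "sing_weight s h = min ((norm h)\<^sup>2) 1 / norm h powr (real DIM('a) + 2 * s)"

lemma sing_weight_nonneg: "0 \<le> sing_weight s h"
  by (simp add: sing_weight_def)

lemma sing_weight_measurable[measurable]: "sing_weight s \<in> borel_measurable borel"
  unfolding sing_weight_def by measurable

lemma sing_weight_minus: "sing_weight s (x - y) = sing_weight s (y - x)"
  by (simp add: sing_weight_def norm_minus_commute)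

text \<open>The volume of the shell is of order \<open>r ^ DIM('a)\<close> and cancels this power in
  the denominator.\<close>

lemma sing_weight_shell:
  assumes r: "0 < r" and s: "0 < s"
  shows "(\<integral>\<^sup>+ h. ennreal (sing_weight s h) * indicator {h::'a::euclidean_space. r \<le> norm h \<and> norm h < 2 * r} h \<partial>lborel)
    \<le> ennreal (unit_ball_vol (real DIM('a)) * 2 ^ DIM('a) * (min (4 * r\<^sup>2) 1 * r powr (- 2 * s)))"
proof -
  let ?N = "DIM('a)" and ?V = "unit_ball_vol (real DIM('a))"
  define c where "c = min (4 * r\<^sup>2) 1 / r powr (real ?N + 2 * s)"
  have c0: "c \<ge> 0" by (simp add: c_def)
  have "(\<integral>\<^sup>+ h. ennreal (sing_weight s h) * indicator {h::'a. r \<le> norm h \<and> norm h < 2 * r} h \<partial>lborel)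
      \<le> (\<integral>\<^sup>+ h. ennreal c * indicator (ball (0::'a) (2 * r)) h \<partial>lborel)"
  proof (rule nn_integral_mono)
    fix h :: 'a
    have "sing_weight s h \<le> c" if h: "r \<le> norm h" "norm h < 2 * r"
    proof -
      have "(norm h)\<^sup>2 \<le> (2 * r)\<^sup>2" using h r by (intro power_mono) auto
      then have "min ((norm h)\<^sup>2) 1 \<le> min (4 * r\<^sup>2) 1" by (simp add: power_mult_distrib min_le_iff_disj)
      moreover have "r powr (real ?N + 2 * s) \<le> norm h powr (real ?N + 2 * s)"
        using h r s by (intro powr_mono2) auto
      ultimately show ?thesis unfolding sing_weight_def c_def using r by (intro frac_le) auto
    qed
    then show "ennreal (sing_weight s h) * indicator {h. r \<le> norm h \<and> norm h < 2 * r} h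
      \<le> ennreal c * indicator (ball 0 (2 * r)) h"
      by (auto simp: indicator_def intro!: ennreal_leI)
  qed
  also have "\<dots> = ennreal c * emeasure lborel (ball (0::'a) (2 * r))"
    by (simp add: nn_integral_cmult_indicator)
  also have "\<dots> = ennreal (c * (?V * (2 * r) ^ ?N))"
    using r c0 by (simp add: emeasure_ball ennreal_mult')
  also have "c * (?V * (2 * r) ^ ?N) = ?V * 2 ^ ?N * (min (4 * r\<^sup>2) 1 * r powr (- 2 * s))"
  proof -
    have "r powr (real ?N + 2 * s) = r ^ ?N * r powr (2 * s)"
      using r by (simp add: powr_add powr_realpow)
    moreover have "r powr (- 2 * s) = 1 / r powr (2 * s)" using r by (simp add: powr_minus_divide)
    ultimately show ?thesis using r by (simp add: c_def power_mult_distrib field_simps)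
  qed
  finally show ?thesis .
qed

text \<open>Shells inside the unit ball contribute terms of order
  \<open>(2 powr (- 2 * (1 - s))) ^ k\<close>, those outside \<open>(2 powr (- 2 * s)) ^ k\<close>.
  The two series give \<open>1 / (1 - s)\<close> and \<open>1 / s\<close>, whose sum is
  \<open>1 / (s * (1 - s))\<close>; the 8 covers both constants.\<close>

lemma sing_weight_integral:
  assumes s: "0 < s" "s < 1"
  shows "(\<integral>\<^sup>+ h. ennreal (sing_weight s (h::'a::euclidean_space)) \<partial>lborel)
    \<le> ennreal (8 * (unit_ball_vol (real DIM('a)) * 2 ^ DIM('a)) / (s * (1 - s)))"
proof -
  let ?W = "unit_ball_vol (real DIM('a)) * 2 ^ DIM('a)"
  define S where "S r = {h::'a. r \<le> norm h \<and> norm h < 2 * r}" for r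
  have [measurable]: "S r \<in> sets borel" for r
    unfolding S_def by measurable
  let ?f = "\<lambda>h::'a. ennreal (sing_weight s h)"
  have W0: "0 \<le> ?W" by simp
  have "(\<integral>\<^sup>+ h. ?f h \<partial>lborel) \<le> (\<integral>\<^sup>+ h. (\<Sum>k. ?f h * indicator (S ((1/2)^Suc k)) h) + (\<Sum>k. ?f h * indicator (S (2^k)) h) \<partial>lborel)"
  proof (rule nn_integral_mono)
    fix h :: 'a
    consider "h = 0" | "0 < norm h" "norm h < 1" | "1 \<le> norm h" by fastforce
    then show "?f h \<le> (\<Sum>k. ?f h * indicator (S ((1/2)^Suc k)) h) + (\<Sum>k. ?f h * indicator (S (2^k)) h)"
    proof cases
      case 1 then show ?thesis by (simp add: sing_weight_def)
    next
      case 2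
      obtain k where "h \<in> S ((1/2)^Suc k)" using dyadic_inside[OF 2] by (auto simp: S_def)
      then have "?f h \<le> (\<Sum>i<Suc k. ?f h * indicator (S ((1/2)^Suc i)) h)" by simp
      also have "\<dots> \<le> (\<Sum>i. ?f h * indicator (S ((1/2)^Suc i)) h)" by (intro sum_le_suminf) auto
      finally show ?thesis by (simp add: add_increasing2)
    next
      case 3
      obtain k where "h \<in> S (2^k)" using dyadic_outside[OF 3] by (auto simp: S_def)
      then have "?f h \<le> (\<Sum>i<Suc k. ?f h * indicator (S (2^i)) h)" by simp
      also have "\<dots> \<le> (\<Sum>i. ?f h * indicator (S (2^i)) h)" by (intro sum_le_suminf) auto
      finally show ?thesis by (simp add: add_increasing)
    qed
  qed
  also have "\<dots> = (\<Sum>k. \<integral>\<^sup>+ h. ?f h * indicator (S ((1/2)^Suc k)) h \<partial>lborel) + (\<Sum>k. \<integral>\<^sup>+ h. ?f h * indicator (S (2^k)) h \<partial>lborel)"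
  proof -
    have "(\<integral>\<^sup>+ h. (\<Sum>k. ?f h * indicator (S (c k)) h) \<partial>lborel) = (\<Sum>k. \<integral>\<^sup>+ h. ?f h * indicator (S (c k)) h \<partial>lborel)" for c :: "nat \<Rightarrow> real"
      by (rule nn_integral_suminf) measurable
    note sw = this[of "\<lambda>k. (1/2)^Suc k"] this[of "\<lambda>k. 2^k"]
    show ?thesis unfolding sw[symmetric] by (rule nn_integral_add) measurable
  qed
  also have "\<dots> \<le> (\<Sum>k. ennreal (4 * ?W) * ennreal ((2 powr (- 2 * (1 - s))) ^ k)) + (\<Sum>k. ennreal ?W * ennreal ((2 powr (- 2 * s)) ^ k))"
  proof (intro add_mono suminf_le)
    fix k
    define r :: real where "r = (1/2)^Suc k"
    have r: "0 < r" by (simp add: r_def)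
    have rp: "r = 2 powr (- real (Suc k))" by (simp add: r_def powr_minus powr_realpow power_one_over inverse_eq_divide del: of_nat_Suc)
    have "min (4 * r\<^sup>2) 1 * r powr (- 2 * s) \<le> 4 * r\<^sup>2 * r powr (- 2 * s)" by (intro mult_right_mono) auto
    also have "\<dots> = 4 * r powr (2 * (1 - s))"
    proof -
      have "r powr (2 * (1 - s)) = r powr (2 + (- 2 * s))" by (rule arg_cong[of _ _ "(powr) r"]) simp
      also have "\<dots> = r\<^sup>2 * r powr (- 2 * s)" unfolding powr_add using r by simp
      finally show ?thesis by simp
    qed
    also have "r powr (2 * (1 - s)) = (2 powr (- 2 * (1 - s))) ^ Suc k"
      by (subst powr_power, simp, subst rp, subst powr_powr, rule arg_cong[of _ _ "(powr) 2"], simp add: algebra_simps)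
    also have "\<dots> \<le> (2 powr (- 2 * (1 - s))) ^ k"
      using s powr_mono[of "- 2 * (1 - s)" 0 "2::real"] by (intro power_decreasing) auto
    finally have "?W * (min (4 * r\<^sup>2) 1 * r powr (- 2 * s)) \<le> ?W * (4 * (2 powr (- 2 * (1 - s))) ^ k)"
      using W0 by (intro mult_left_mono) auto
    then show "(\<integral>\<^sup>+ h. ?f h * indicator (S ((1/2)^Suc k)) h \<partial>lborel) \<le> ennreal (4 * ?W) * ennreal ((2 powr (- 2 * (1 - s))) ^ k)"
      using sing_weight_shell[OF r s(1), where 'a='a] unfolding S_def r_def[symmetric]
      by (subst ennreal_mult'[symmetric]) (auto simp: mult_ac intro: order_trans ennreal_leI)
    have "min (4 * (2^k)\<^sup>2) 1 * (2^k) powr (- 2 * s) \<le> 1 * (2^k) powr (- 2 * s)" by (intro mult_right_mono) auto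
    also have "\<dots> = (2 powr (- 2 * s)) ^ k"
    proof -
      have "(2^k) powr (- 2 * s) = (2 powr real k) powr (- 2 * s)" by (simp add: powr_realpow)
      also have "\<dots> = 2 powr (real k * (- 2 * s))" by (rule powr_powr)
      also have "\<dots> = (2 powr (- 2 * s)) ^ k" by (simp add: powr_power)
      finally show ?thesis by simp
    qed
    finally have "?W * (min (4 * (2^k)\<^sup>2) 1 * (2^k) powr (- 2 * s)) \<le> ?W * (2 powr (- 2 * s)) ^ k"
      using W0 by (intro mult_left_mono) auto
    then show "(\<integral>\<^sup>+ h. ?f h * indicator (S (2^k)) h \<partial>lborel) \<le> ennreal ?W * ennreal ((2 powr (- 2 * s)) ^ k)"
      using sing_weight_shell[of "2^k", OF _ s(1), where 'a='a] W0 unfolding S_def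
      by (subst ennreal_mult[symmetric]) (auto intro: order_trans ennreal_leI)
  qed auto
  also have "\<dots> = ennreal (4 * ?W) * (\<Sum>k. ennreal ((2 powr (- 2 * (1 - s))) ^ k)) + ennreal ?W * (\<Sum>k. ennreal ((2 powr (- 2 * s)) ^ k))"
    by simp
  also have "\<dots> \<le> ennreal (4 * ?W) * ennreal (2 / (1 - s)) + ennreal ?W * ennreal (2 / s)"
    using s by (intro add_mono mult_left_mono geometric_powr_bound) auto
  also have "\<dots> = ennreal (4 * ?W * (2 / (1 - s)) + ?W * (2 / s))"
    using s W0 by (simp add: ennreal_mult[symmetric] ennreal_plus[symmetric] del: ennreal_plus)
  also have "\<dots> \<le> ennreal (8 * ?W / (s * (1 - s)))"
  proof (rule ennreal_leI)
    have "4 * ?W * (2 / (1 - s)) + ?W * (2 / s) \<le> 8 * ?W * (1 / (1 - s)) + 8 * ?W * (1 / s)"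
      using s W0 by (intro add_mono) (auto intro!: mult_right_mono divide_right_mono)
    also have "\<dots> = 8 * ?W / (s * (1 - s))"
      using s by (simp add: field_simps)
    finally show "4 * ?W * (2 / (1 - s)) + ?W * (2 / s) \<le> 8 * ?W / (s * (1 - s))" .
  qed
  finally show ?thesis .
qed

lemma nn_integral_lborel_translate:
  fixes f :: "'a::euclidean_space \<Rightarrow> ennreal"
  assumes [measurable]: "f \<in> borel_measurable borel"
  shows "(\<integral>\<^sup>+x. f (x - c) \<partial>lborel) = (\<integral>\<^sup>+x. f x \<partial>lborel)"
proof -
  have "(\<integral>\<^sup>+x. f x \<partial>lborel) = (\<integral>\<^sup>+x. f x \<partial>(distr lborel borel ((+) (- c))))"
    by (simp add: lborel_distr_plus)
  also have "\<dots> = (\<integral>\<^sup>+x. f (- c + x) \<partial>lborel)" by (rule nn_integral_distr) auto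
  finally show ?thesis by simp
qed

context neumann_problem
begin

text \<open>In each pair of \<open>Qset \<Omega>\<close> one point lies in \<Omega>; integrating
  over the other yields order \<open>1 / (s * (1 - s))\<close>, which \<open>cNs\<close> cancels.
  The bound is thus uniform in \<open>s\<close> and integrable against the finite measure \<mu>,
  even if \<mu> charges every neighbourhood of 0 and 1.\<close>

lemma finite_energy:
  assumes [measurable]: "u \<in> borel_measurable borel"
    and A: "A \<ge> 0" "\<And>x y. (u x - u y)\<^sup>2 \<le> A * min ((norm (x - y))\<^sup>2) 1"
  shows "sq_integrable nonlocal_measure (D u)"
proof -
  let ?W = "8 * (unit_ball_vol (real DIM('a)) * 2 ^ DIM('a))"
  have [measurable]: "D u \<in> borel_measurable nonlocal_measure" by (rule D_measurable) simp
  obtain C where C: "C \<ge> 0" "\<And>s. 0 < s \<Longrightarrow> s < 1 \<Longrightarrow> cNs DIM('a) s \<le> C * (s * (1 - s))"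
    using cNs_bound[of "DIM('a)"] by auto
  define V where "V = measure lborel \<Omega>"
  have V: "emeasure lborel \<Omega> = ennreal V" "V \<ge> 0"
    using emeasure_bounded_finite[OF bounded_\<Omega>] by (auto simp: V_def emeasure_eq_ennreal_measure)
  have inner: "L2sq lborel2 (\<lambda>z. D u (s, z)) \<le> ennreal (C * A * (V * ?W))"
    if s: "s \<in> {0<..<1}" for s
  proof -
    have s': "0 < s" "s < 1" using s by auto
    have c: "cNs DIM('a) s > 0" by (rule cNs_pos[OF s'])
    have "L2sq lborel2 (\<lambda>z. D u (s, z)) \<le>
        (\<integral>\<^sup>+ z. ennreal (cNs DIM('a) s / 2 * A) * (indicator \<Omega> (fst z) * ennreal (sing_weight s (snd z - fst z))
           + indicator \<Omega> (snd z) * ennreal (sing_weight s (fst z - snd z))) \<partial>lborel2)"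
    proof (rule nn_integral_mono)
      fix z :: "'a \<times> 'a"
      let ?i = "indicator (Qset \<Omega>) z :: real" and ?x = "fst z" and ?y = "snd z"
      have "(norm (D u (s, z)))\<^sup>2 = cNs DIM('a) s / 2 * (?i * ((u ?x - u ?y)\<^sup>2 / norm (?x - ?y) powr (real DIM('a) + 2 * s)))"
        using D_mult[OF s, of u z u] by (simp add: power2_eq_square)
      also have "\<dots> \<le> cNs DIM('a) s / 2 * (?i * (A * min ((norm (?x - ?y))\<^sup>2) 1 / norm (?x - ?y) powr (real DIM('a) + 2 * s)))"
        using c A by (intro mult_left_mono divide_right_mono) auto
      also have "\<dots> = cNs DIM('a) s / 2 * A * (?i * sing_weight s (?x - ?y))" by (simp add: sing_weight_def)
      also have "\<dots> \<le> cNs DIM('a) s / 2 * A * (indicator \<Omega> ?x * sing_weight s (?y - ?x) + indicator \<Omega> ?y * sing_weight s (?x - ?y))"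
        using c A sing_weight_nonneg[of s "?x - ?y"] sing_weight_minus[of s ?x ?y]
        by (intro mult_left_mono) (auto simp: indicator_def Qset_def mem_Times_iff)
      finally have "ennreal ((norm (D u (s, z)))\<^sup>2) \<le> ennreal (cNs DIM('a) s / 2 * A * (indicator \<Omega> ?x * sing_weight s (?y - ?x) + indicator \<Omega> ?y * sing_weight s (?x - ?y)))"
        by (rule ennreal_leI)
      also have "\<dots> = ennreal (cNs DIM('a) s / 2 * A) * (indicator \<Omega> ?x * ennreal (sing_weight s (?y - ?x))
           + indicator \<Omega> ?y * ennreal (sing_weight s (?x - ?y)))"
        using c A sing_weight_nonneg[where 'a='a]
        by (simp add: ennreal_mult ennreal_indicator del: times_divide_eq_left)
      finally show "ennreal ((norm (D u (s, z)))\<^sup>2) \<le> ennreal (cNs DIM('a) s / 2 * A) * (indicator \<Omega> ?x * ennreal (sing_weight s (?y - ?x))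
           + indicator \<Omega> ?y * ennreal (sing_weight s (?x - ?y)))" .
    qed
    also have "\<dots> = ennreal (cNs DIM('a) s / 2 * A) * ((\<integral>\<^sup>+ z. indicator \<Omega> (fst z) * ennreal (sing_weight s (snd z - fst z)) \<partial>lborel2)
           + (\<integral>\<^sup>+ z. indicator \<Omega> (snd z) * ennreal (sing_weight s (fst z - snd z)) \<partial>lborel2))"
      by (simp add: nn_integral_cmult nn_integral_add)
    also have "(\<integral>\<^sup>+ z. indicator \<Omega> (fst z) * ennreal (sing_weight s (snd z - fst z)) \<partial>lborel2) = ennreal V * (\<integral>\<^sup>+ h. ennreal (sing_weight s (h::'a)) \<partial>lborel)"
      by (subst lborel.nn_integral_fst[symmetric])
         (simp_all add: nn_integral_cmult nn_integral_lborel_translate[of "\<lambda>h. ennreal (sing_weight s h)"] nn_integral_multc V)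
    also have "(\<integral>\<^sup>+ z. indicator \<Omega> (snd z) * ennreal (sing_weight s (fst z - snd z)) \<partial>lborel2) = ennreal V * (\<integral>\<^sup>+ h. ennreal (sing_weight s (h::'a)) \<partial>lborel)"
      by (subst lborel_pair.nn_integral_snd[symmetric])
         (simp_all add: nn_integral_cmult nn_integral_lborel_translate[of "\<lambda>h. ennreal (sing_weight s h)"] nn_integral_multc V)
    also have "ennreal (cNs DIM('a) s / 2 * A) * (ennreal V * (\<integral>\<^sup>+ h. ennreal (sing_weight s (h::'a)) \<partial>lborel) + ennreal V * (\<integral>\<^sup>+ h. ennreal (sing_weight s (h::'a)) \<partial>lborel))
       \<le> ennreal (cNs DIM('a) s / 2 * A) * (ennreal V * ennreal (?W / (s * (1 - s))) + ennreal V * ennreal (?W / (s * (1 - s))))"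
      by (intro mult_left_mono add_mono sing_weight_integral s') auto
    also have "\<dots> = ennreal (cNs DIM('a) s / 2 * A * (V * (?W / (s * (1 - s))) + V * (?W / (s * (1 - s)))))"
      using c A V(2) s' by (simp add: ennreal_mult[symmetric] ennreal_plus[symmetric] del: ennreal_plus)
    also have "\<dots> \<le> ennreal (C * A * (V * ?W))"
    proof (rule ennreal_leI)
      have "cNs DIM('a) s / 2 * A * (V * (?W / (s * (1 - s))) + V * (?W / (s * (1 - s)))) = cNs DIM('a) s / (s * (1 - s)) * (A * (V * ?W))"
        by (simp add: field_simps)
      also have "\<dots> \<le> C * (A * (V * ?W))"
        using C(2)[OF s'] s' A V(2) by (intro mult_right_mono) (auto simp: divide_le_eq)
      finally show "cNs DIM('a) s / 2 * A * (V * (?W / (s * (1 - s))) + V * (?W / (s * (1 - s)))) \<le> C * A * (V * ?W)"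
        by (simp only: mult.assoc)
    qed
    finally show ?thesis .
  qed
  have "L2sq nonlocal_measure (D u) = (\<integral>\<^sup>+ s. L2sq lborel2 (\<lambda>z. D u (s, z)) \<partial>\<mu>)"
    by (rule sigma_finite_measure.nn_integral_fst[OF sigma_finite_lborel2, symmetric]) measurable
  also have "\<dots> \<le> (\<integral>\<^sup>+ s. ennreal (C * A * (V * ?W)) \<partial>\<mu>)"
    by (intro nn_integral_mono inner) (simp add: space_\<mu>)
  also have "\<dots> < \<infinity>"
    by (simp add: ennreal_mult_eq_top_iff less_top[symmetric])
  finally show ?thesis by (simp add: sq_integrable_def)
qed

text \<open>Stated for bounded functions with bounded derivatives, so as to cover the constants
  besides the test functions.\<close>

lemma smooth_in_H:
  assumes u: "smooth_fun u" and B: "\<And>x. \<bar>u x\<bar> \<le> B" and B': "\<And>i x. \<bar>frechet_derivative u (at x) i\<bar> \<le> B' i"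
  shows "u \<in> H"
proof -
  define L where "L = (\<Sum>i\<in>(Basis::'a set). B' i)"
  have B'0: "0 \<le> B' i" for i using B'[where i=i and x=0] by linarith
  have lip: "\<bar>u y - u x\<bar> \<le> L * norm (y - x)" for x y
  proof -
    have "\<bar>frechet_derivative u (at z) v\<bar> \<le> L * norm v" for z v
    proof -
      have lin: "linear (frechet_derivative u (at z))"
        using smooth_fun_differentiable[OF u] by (rule linear_frechet_derivative)
      have "frechet_derivative u (at z) v = frechet_derivative u (at z) (\<Sum>i\<in>Basis. (v \<bullet> i) *\<^sub>R i)"
        by (simp add: euclidean_representation)
      also have "\<dots> = (\<Sum>i\<in>Basis. (v \<bullet> i) * frechet_derivative u (at z) i)"
        by (simp add: linear_sum[OF lin] linear_scale[OF lin])
      also have "\<bar>\<dots>\<bar> \<le> (\<Sum>i\<in>Basis. \<bar>(v \<bullet> i) * frechet_derivative u (at z) i\<bar>)" by (rule sum_abs)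
      also have "\<dots> \<le> (\<Sum>i\<in>Basis. norm v * B' i)"
        unfolding abs_mult using B' Basis_le_norm by (intro sum_mono mult_mono) auto
      finally show ?thesis by (simp add: L_def sum_distrib_left mult.commute)
    qed
    \<comment> \<open>The increment is a single step of parameter length 1 in the direction
      \<open>y - x\<close>.\<close>
    from directional_derivative_bound[OF smooth_fun_differentiable[OF u] this[of _ "y - x"], of x 1]
    show ?thesis by simp
  qed
  have um: "u \<in> borel_measurable borel" by (rule smooth_fun_measurable(1)[OF u])
  have "sq_integrable (leb_on \<Omega>) u"
    using um B by (intro sq_integrable_bounded[OF finite_leb_on, of _ B]) (auto intro: measurable_restrict_space1)
  moreover have "sq_integrable nonlocal_measure (D u)"
  proof (rule finite_energy[OF um, of "L\<^sup>2 + 4 * B\<^sup>2"])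
    fix x y
    have "(u x - u y)\<^sup>2 \<le> (L * norm (x - y))\<^sup>2"
      using lip[of x y] by (intro abs_le_square_iff[THEN iffD1]) auto
    moreover have "(u x - u y)\<^sup>2 \<le> (2 * B)\<^sup>2"
      using B[of x] B[of y] by (intro abs_le_square_iff[THEN iffD1]) auto
    then have "(u x - u y)\<^sup>2 \<le> 4 * B\<^sup>2" by (simp add: power_mult_distrib)
    moreover have "0 \<le> L\<^sup>2" "0 \<le> 4 * B\<^sup>2 * (norm (x - y))\<^sup>2" by auto
    ultimately have "(u x - u y)\<^sup>2 \<le> (L\<^sup>2 + 4 * B\<^sup>2) * (norm (x - y))\<^sup>2"
      "(u x - u y)\<^sup>2 \<le> (L\<^sup>2 + 4 * B\<^sup>2) * 1"
      unfolding distrib_right power_mult_distrib by linarith+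
    then show "(u x - u y)\<^sup>2 \<le> (L\<^sup>2 + 4 * B\<^sup>2) * min ((norm (x - y))\<^sup>2) 1"
      by (simp add: min_def)
  qed simp
  moreover have "\<exists>G. weak_grad \<Omega> u G"
  proof -
    have "sq_integrable (leb_on \<Omega>) (\<lambda>x. \<Sum>i\<in>Basis. frechet_derivative u (at x) i *\<^sub>R i)"
    proof (rule sq_integrable_bounded[OF finite_leb_on, of _ L])
      show "(\<lambda>x. \<Sum>i\<in>Basis. frechet_derivative u (at x) i *\<^sub>R i) \<in> borel_measurable (leb_on \<Omega>)"
        using smooth_fun_measurable(2)[OF u]
        by (intro measurable_restrict_space1 borel_measurable_sum borel_measurable_scaleR) auto
      show "norm (\<Sum>i\<in>Basis. frechet_derivative u (at x) i *\<^sub>R i) \<le> L" for x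
        unfolding L_def using B' by (intro sum_norm_le) simp
    qed
    then show ?thesis using weak_grad_smooth[OF u] by blast
  qed
  ultimately show ?thesis using um by (simp add: H_iff)
qed

lemma test_fun_in_H:
  assumes "test_fun \<Omega> \<phi>"
  shows "\<phi> \<in> H"
proof -
  obtain B where B: "\<And>x. \<bar>\<phi> x\<bar> \<le> B" using test_fun_bounded[OF assms] by metis
  have "\<exists>B. \<forall>x. \<bar>frechet_derivative \<phi> (at x) i\<bar> \<le> B" for i
    using test_fun_bounded[OF assms, of i] by metis
  then obtain B' where "\<And>i x. \<bar>frechet_derivative \<phi> (at x) i\<bar> \<le> B' i" by metis
  then show ?thesis using B test_fun_facts(1)[OF assms] by (intro smooth_in_H)
qed

lemma const_in_H: "(\<lambda>_. c) \<in> H"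
  by (rule smooth_in_H[of _ "\<bar>c\<bar>" "\<lambda>_. 0"])
     (auto intro: flat_algebra_smooth flat_algebra.const simp: frechet_derivative_const)

lemma bform_box_bump_pos:
  assumes "cbox a b \<subseteq> \<Omega>" "box a b \<noteq> {}"
  shows "bform (box_bump a b 1) (box_bump a b 1) > 0"
proof -
  let ?\<phi> = "box_bump a b 1"
  have \<phi>: "test_fun \<Omega> ?\<phi>" by (rule box_bump_test_fun[OF assms(1)]) simp
  have "bform ?\<phi> ?\<phi> \<noteq> 0"
  proof
    assume "bform ?\<phi> ?\<phi> = 0"
    then have "AE x in leb_on \<Omega>. ?\<phi> x * ?\<phi> x = 0"
      using sq_integrable_mult[OF test_fun_sq_integrable(1)[OF \<phi>] test_fun_sq_integrable(1)[OF \<phi>]]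
      unfolding bform_def by (subst (asm) integral_nonneg_eq_0_iff_AE) auto
    then have "AE x in lborel. x \<in> \<Omega> \<longrightarrow> ?\<phi> x * ?\<phi> x = 0" by (simp add: AE_restrict_space_iff)
    then have "AE x in lborel. x \<notin> box a b"
      by eventually_elim (use box_bump_eq_0_iff[of 1 a b] assms(1) box_subset_cbox[of a b] in auto)
    then have "emeasure lborel (box a b) = 0" by (subst (asm) AE_iff_measurable[OF _ refl]) auto
    moreover have "emeasure lborel (box a b) > 0"
      using assms(2) by (auto simp: emeasure_lborel_box_eq box_ne_empty less_imp_le inner_diff_left intro!: prod_pos)
    ultimately show False by simp
  qed
  then show ?thesis by (simp add: bform_def less_le)
qed

text \<open>Bumps on disjoint boxes are orthogonal. The boxes are disjoint slices, in the coordinate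
  \<open>i0\<close>, of one cube around \<open>p\<close>: the \<open>k\<close>-th lies between the
  offsets \<open>\<rho> / (k + 2)\<close> and \<open>\<rho> / (k + 1)\<close>.\<close>

lemma orthonormal_family:
  "\<exists>w::nat \<Rightarrow> 'a \<Rightarrow> real. (\<forall>k. w k \<in> H) \<and> (\<forall>j k. bform (w j) (w k) = (if j = k then 1 else 0))"
proof -
  obtain p where "p \<in> \<Omega>" using nonempty_\<Omega> by blast
  then obtain e where e: "e > 0" "\<And>x. dist x p < e \<Longrightarrow> x \<in> \<Omega>"
    using open_\<Omega> unfolding open_dist by blast
  obtain i0 :: 'a where i0: "i0 \<in> Basis" using nonempty_Basis by blast
  \<comment> \<open>All coordinates of a point of the cube differ from those of \<open>p\<close> by
    at most \<rho>, so its distance from \<open>p\<close> is at most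
    \<open>DIM('a) * \<rho> = e / 2\<close>.\<close>
  define \<rho> where "\<rho> = e / (2 * real DIM('a))"
  have \<rho>: "\<rho> > 0" using e by (simp add: \<rho>_def)
  define a where "a k = (\<Sum>i\<in>Basis. (if i = i0 then p \<bullet> i + \<rho> / (real k + 2) else p \<bullet> i - \<rho>) *\<^sub>R i)" for k :: nat
  define b where "b k = (\<Sum>i\<in>Basis. (if i = i0 then p \<bullet> i + \<rho> / (real k + 1) else p \<bullet> i + \<rho>) *\<^sub>R i)" for k :: nat
  have ai: "a k \<bullet> i = (if i = i0 then p \<bullet> i + \<rho> / (real k + 2) else p \<bullet> i - \<rho>)" if "i \<in> Basis" for k i
    using that by (simp add: a_def)
  have bi: "b k \<bullet> i = (if i = i0 then p \<bullet> i + \<rho> / (real k + 1) else p \<bullet> i + \<rho>)" if "i \<in> Basis" for k i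
    using that by (simp add: b_def)
  have frac: "0 < \<rho> / (real k + 2)" "\<rho> / (real k + 2) < \<rho> / (real k + 1)" "\<rho> / (real k + 1) \<le> \<rho>" for k :: nat
    using \<rho> by (auto simp: field_simps)
  have sub: "cbox (a k) (b k) \<subseteq> \<Omega>" for k
  proof
    fix x assume x: "x \<in> cbox (a k) (b k)"
    have "\<bar>(x - p) \<bullet> i\<bar> \<le> \<rho>" if i: "i \<in> Basis" for i
    proof -
      have "a k \<bullet> i \<le> x \<bullet> i" "x \<bullet> i \<le> b k \<bullet> i" using x i by (auto simp: mem_box)
      then have "p \<bullet> i - \<rho> \<le> x \<bullet> i" "x \<bullet> i \<le> p \<bullet> i + \<rho>"
        unfolding ai[OF i] bi[OF i] using frac[of k] \<rho> by (simp_all only: split: if_splits)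
      then show ?thesis by (simp add: inner_diff_left abs_le_iff)
    qed
    then have "norm (x - p) \<le> real DIM('a) * \<rho>"
      using norm_le_l1[of "x - p"] sum_bounded_above[of Basis "\<lambda>i. \<bar>(x - p) \<bullet> i\<bar>" \<rho>] by simp
    also have "\<dots> < e" using e by (simp add: \<rho>_def)
    finally show "x \<in> \<Omega>" using e(2) by (simp add: dist_norm)
  qed
  have ne: "box (a k) (b k) \<noteq> {}" for k
    unfolding box_ne_empty using ai bi frac[of k] \<rho> by auto
  have disj: "box (a j) (b j) \<inter> box (a k) (b k) = {}" if "j < k" for j k
  proof -
    have "\<rho> / (real k + 1) \<le> \<rho> / (real j + 2)" using that \<rho> by (intro divide_left_mono) auto
    then have "b k \<bullet> i0 \<le> a j \<bullet> i0" using ai[OF i0] bi[OF i0] by simp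
    then show ?thesis using i0 by (fastforce simp: mem_box)
  qed
  define \<phi> where "\<phi> k = box_bump (a k) (b k) 1" for k
  have \<phi>H: "\<phi> k \<in> H" for k unfolding \<phi>_def by (intro test_fun_in_H box_bump_test_fun sub) simp
  have pos: "bform (\<phi> k) (\<phi> k) > 0" for k unfolding \<phi>_def by (rule bform_box_bump_pos[OF sub ne])
  have zero: "bform (\<phi> j) (\<phi> k) = 0" if "j \<noteq> k" for j k
  proof -
    have "box (a j) (b j) \<inter> box (a k) (b k) = {}" using disj[of j k] disj[of k j] that by (cases "j < k") auto
    then have eq: "(\<lambda>x. \<phi> j x * \<phi> k x) = (\<lambda>_. 0)"
      using box_bump_eq_0_iff[of 1 "a j" "b j"] box_bump_eq_0_iff[of 1 "a k" "b k"]
      by (auto simp: \<phi>_def fun_eq_iff)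
    show ?thesis unfolding bform_def eq by simp
  qed
  interpret B: psd_form H bform by (rule bform_psd)
  define w where "w k = (\<lambda>x. (1 / sqrt (bform (\<phi> k) (\<phi> k))) * \<phi> k x)" for k
  have "w k \<in> H" for k unfolding w_def by (rule B.scale_closed[OF \<phi>H])
  moreover have "bform (w j) (w k) = (if j = k then 1 else 0)" for j k
  proof -
    have "bform (w j) (w k) = (1 / sqrt (bform (\<phi> j) (\<phi> j))) * ((1 / sqrt (bform (\<phi> k) (\<phi> k))) * bform (\<phi> j) (\<phi> k))"
      unfolding w_def by (subst B.scale[OF \<phi>H B.scale_closed[OF \<phi>H]], subst B.scale_right[OF \<phi>H \<phi>H]) simp
    then show ?thesis using zero[of j k] pos[of j] by auto
  qed
  ultimately show ?thesis by blast
qed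

end

section \<open>Completeness of the energy space\<close>

lemma sq_integrable_psd: "psd_form {f::'m \<Rightarrow> real. sq_integrable M f} (\<lambda>f g. \<integral>x. f x * g x \<partial>M)"
proof
  show "(\<lambda>x. u x + c * v x) \<in> {f. sq_integrable M f}" if "u \<in> {f. sq_integrable M f}" "v \<in> {f. sq_integrable M f}"
    for u v :: "'m \<Rightarrow> real" and c
    using that sq_integrable_lin[of M u v c] by simp
  show "(\<integral>x. (u x + c * v x) * w x \<partial>M) = (\<integral>x. u x * w x \<partial>M) + c * (\<integral>x. v x * w x \<partial>M)"
    if "u \<in> {f. sq_integrable M f}" "v \<in> {f. sq_integrable M f}" "w \<in> {f. sq_integrable M f}" for u v w :: "'m \<Rightarrow> real" and c
    using that sq_integrable_inner_lin[of M u v w c] by simp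
qed (auto simp: mult.commute)

lemma L2_norm_le_iff:
  assumes "sq_integrable M f" "e \<ge> 0"
  shows "L2sq M f \<le> ennreal e \<longleftrightarrow> (\<integral>x. f x \<bullet> f x \<partial>M) \<le> e"
  using assms by (simp add: sq_integrable_nn_integral)

lemma tendsto_zero_eps:
  fixes x :: "nat \<Rightarrow> real"
  assumes "\<And>n. 0 \<le> x n" "\<And>e. e > 0 \<Longrightarrow> \<exists>K. \<forall>n\<ge>K. x n \<le> e"
  shows "x \<longlonglongrightarrow> 0"
proof (rule LIMSEQ_I)
  fix r :: real assume "r > 0"
  then obtain K where "\<forall>n\<ge>K. x n \<le> r / 2" using assms(2)[of "r/2"] by auto
  then show "\<exists>K. \<forall>n\<ge>K. norm (x n - 0) < r"
    using \<open>r > 0\<close> assms(1) by (intro exI[of _ K]) (auto intro: le_less_trans)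
qed

lemma L2_tendsto_inner:
  fixes f :: "nat \<Rightarrow> 'm \<Rightarrow> real"
  assumes f: "\<And>n. sq_integrable M (f n)" and l: "sq_integrable M l" and g: "sq_integrable M g"
    and lim: "\<And>e. e > 0 \<Longrightarrow> \<exists>K. \<forall>n\<ge>K. L2sq M (\<lambda>x. f n x - l x) \<le> ennreal e"
  shows "(\<lambda>n. \<integral>x. f n x * g x \<partial>M) \<longlonglongrightarrow> (\<integral>x. l x * g x \<partial>M)"
proof -
  interpret P: psd_form "{f. sq_integrable M f}" "\<lambda>f g. \<integral>x. f x * g x \<partial>M" by (rule sq_integrable_psd)
  have "(\<lambda>n. \<integral>x. (f n x - l x) * (f n x - l x) \<partial>M) \<longlonglongrightarrow> 0"
  proof (rule tendsto_zero_eps)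
    fix e :: real assume e: "e > 0"
    then show "\<exists>K. \<forall>n\<ge>K. (\<integral>x. (f n x - l x) * (f n x - l x) \<partial>M) \<le> e"
      using lim[OF e] L2_norm_le_iff[OF sq_integrable_diff[OF f l], of e] by simp
  qed simp
  then show ?thesis using f l g by (intro P.tendsto_form) auto
qed

context neumann_problem
begin

lemma emeasure_\<Omega>_pos: "emeasure lborel \<Omega> > 0"
proof -
  have "emeasure lborel \<Omega> \<noteq> 0"
  proof
    assume "emeasure lborel \<Omega> = 0"
    then have "negligible \<Omega>" by (subst negligible_iff_emeasure0) auto
    then show False using open_not_negligible[OF open_\<Omega> nonempty_\<Omega>] by simp
  qed
  then show ?thesis by (simp add: zero_less_iff_neq_zero)
qed

lemma AE_leb_onI: "AE x in lborel. P x \<Longrightarrow> AE x in leb_on \<Omega>. P x"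
  by (auto simp: AE_restrict_space_iff elim: eventually_mono)

lemma AE_leb_on_ex:
  assumes "AE x in leb_on \<Omega>. P x"
  shows "\<exists>x\<in>\<Omega>. P x"
proof -
  have "emeasure (leb_on \<Omega>) (space (leb_on \<Omega>)) \<noteq> 0"
    using emeasure_\<Omega>_pos by (simp add: emeasure_restrict_space space_restrict_space)
  then have nb: "ae_filter (leb_on \<Omega>) \<noteq> bot" by (simp add: ae_filter_eq_bot_iff)
  have "AE x in leb_on \<Omega>. x \<in> \<Omega> \<and> P x" using assms AE_space[of "leb_on \<Omega>"]
    by eventually_elim (auto simp: space_restrict_space)
  from eventually_happens[OF this] nb show ?thesis by blast
qed

text \<open>Nontriviality of \<mu> realises an almost everywhere statement at a single exponent. One
  is enough where it is applied, as each \<open>kern s\<close> vanishes only on the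
  diagonal.\<close>

lemma AE_\<mu>_ex:
  assumes "AE s in \<mu>. P s"
  shows "\<exists>s\<in>{0<..<1}. P s"
proof -
  have nb: "ae_filter \<mu> \<noteq> bot" using nontrivial_\<mu> by (simp add: ae_filter_eq_bot_iff)
  have "AE s in \<mu>. s \<in> {0<..<1} \<and> P s" using assms AE_space[of \<mu>] by eventually_elim (auto simp: space_\<mu>)
  from eventually_happens[OF this] nb show ?thesis by blast
qed

lemma kern_nonzero: "s \<in> {0<..<1} \<Longrightarrow> x \<noteq> y \<Longrightarrow> kern s (x, y) \<noteq> 0"
  using cNs_pos[of s "DIM('a)"] by (auto simp: kern_def)

text \<open>Convergence of the weighted differences determines the behaviour of a sequence outside of
  \<open>\<Omega>\<close>, where the norm of \<open>H\<close> contains no \<open>L\<^sup>2\<close> term.\<close>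

lemma AE_convergent_from_differences:
  assumes D: "AE p in nonlocal_measure. convergent (\<lambda>k. D (w k) p)"
    and w: "AE x in leb_on \<Omega>. convergent (\<lambda>k. w k x)"
  shows "AE y in lborel. convergent (\<lambda>k. w k y)"
proof -
  obtain s where s: "s \<in> {0<..<1}" and "AE z in lborel2. convergent (\<lambda>k. D (w k) (s, z))"
    using AE_\<mu>_ex[OF MP.AE_pair[OF D]] by blast
  from lborel_pair.AE_pair[OF this(2)]
  have "AE x in lborel. AE y in lborel. convergent (\<lambda>k. D (w k) (s, (x, y)))" .
  then have "AE x in leb_on \<Omega>. AE y in lborel. convergent (\<lambda>k. D (w k) (s, (x, y)))"
    by (rule AE_leb_onI)
  with w have "AE x in leb_on \<Omega>. convergent (\<lambda>k. w k x) \<and> (AE y in lborel. convergent (\<lambda>k. D (w k) (s, (x, y))))"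
    by eventually_elim simp
  \<comment> \<open>One base point \<open>x\<close> in \<Omega> serves for almost all
    \<open>y\<close>, because \<open>(x, y)\<close> lies in \<open>Qset \<Omega>\<close> for every
    \<open>y\<close>.\<close>
  from AE_leb_on_ex[OF this] obtain x where x: "x \<in> \<Omega>" "convergent (\<lambda>k. w k x)"
    "AE y in lborel. convergent (\<lambda>k. D (w k) (s, (x, y)))" by blast
  from x(3) AE_lborel_singleton[of x] show ?thesis
  proof eventually_elim
    fix y assume c: "convergent (\<lambda>k. D (w k) (s, (x, y)))" and "y \<noteq> x"
    then have k: "kern s (x, y) \<noteq> 0" using kern_nonzero[OF s, of x y] by simp
    have "D (w j) (s, (x, y)) = kern s (x, y) * (w j x - w j y)" for j
      using x(1) by (simp add: D_def Qset_def)
    then have "w j y = w j x + (- inverse (kern s (x, y))) * D (w j) (s, (x, y))" for j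
      using k by (simp add: mult.assoc[symmetric])
    moreover have "convergent (\<lambda>j. w j x + (- inverse (kern s (x, y))) * D (w j) (s, (x, y)))"
      by (intro convergent_add x(2) convergent_mult convergent_const c)
    ultimately show "convergent (\<lambda>k. w k y)" by simp
  qed
qed

text \<open>\<open>P\<close> may fail to be measurable, so its exceptional set is first enlarged to
  a Borel null set \<open>N\<close>; the pairs meeting \<open>N\<close> are null by Fubini.\<close>

lemma AE_nonlocal_from_AE_lborel:
  assumes "AE x in lborel. P x"
  shows "AE p in nonlocal_measure. P (fst (snd p)) \<and> P (snd (snd p))"
proof -
  obtain N where N: "N \<in> sets lborel" "emeasure lborel N = 0" "{x. \<not> P x} \<subseteq> N"
    using assms unfolding eventually_ae_filter by (auto simp: null_sets_def)
  have [measurable]: "N \<in> sets borel" using N(1) by simp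
  have notin: "AE x in lborel. x \<notin> N" using N by (intro AE_not_in) (auto simp: null_sets_def)
  have "AE z in lborel2. fst z \<notin> N \<and> snd z \<notin> N"
  proof (rule lborel_pair.AE_pair_measure)
    have "{z \<in> space lborel2. fst z \<notin> N \<and> snd z \<notin> N} = (UNIV - N) \<times> (UNIV - N)" by (auto simp: space_pair_measure)
    then show "{z \<in> space lborel2. fst z \<notin> N \<and> snd z \<notin> N} \<in> sets lborel2" by simp
    show "AE x in lborel. AE y in lborel. fst (x, y) \<notin> N \<and> snd (x, y) \<notin> N"
      using notin by eventually_elim (use notin in auto)
  qed
  then have "AE p in nonlocal_measure. fst (snd p) \<notin> N \<and> snd (snd p) \<notin> N"
  proof (intro MP.AE_pair_measure)
    have "{p \<in> space nonlocal_measure. fst (snd p) \<notin> N \<and> snd (snd p) \<notin> N} = space \<mu> \<times> ((UNIV - N) \<times> (UNIV - N))"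
      by (auto simp: space_pair_measure)
    then show "{p \<in> space nonlocal_measure. fst (snd p) \<notin> N \<and> snd (snd p) \<notin> N} \<in> sets nonlocal_measure" by simp
  qed auto
  then show ?thesis by eventually_elim (use N(3) in blast)
qed

lemma H_L2_norms:
  assumes u: "u \<in> H"
  shows "L2sq (leb_on \<Omega>) u = ennreal (bform u u)"
    and "L2sq nonlocal_measure (D u) \<le> ennreal (aform u u)"
    and "\<alpha> > 0 \<Longrightarrow> L2sq (leb_on \<Omega>) (wgrad \<Omega> u) \<le> ennreal (aform u u / \<alpha>)"
proof -
  show "L2sq (leb_on \<Omega>) u = ennreal (bform u u)"
    using sq_integrable_nn_integral[OF HD(2)[OF u]] by (simp add: bform_def)
  have g0: "0 \<le> \<alpha> * (\<integral>x. wgrad \<Omega> u x \<bullet> wgrad \<Omega> u x \<partial>leb_on \<Omega>)" using \<alpha>_nonneg by simp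
  have d0: "0 \<le> (\<integral>p. D u p * D u p \<partial>nonlocal_measure)" by simp
  show "L2sq nonlocal_measure (D u) \<le> ennreal (aform u u)"
    using sq_integrable_nn_integral[OF HD(3)[OF u]] g0 by (simp add: aform_def ennreal_leI)
  show "L2sq (leb_on \<Omega>) (wgrad \<Omega> u) \<le> ennreal (aform u u / \<alpha>)" if "\<alpha> > 0"
    using sq_integrable_nn_integral[OF HD(5)[OF u that]] d0 that
    by (simp add: aform_def ennreal_leI field_simps)
qed

lemma H_diff: "u \<in> H \<Longrightarrow> v \<in> H \<Longrightarrow> (\<lambda>x. u x - v x) \<in> H"
  using H_lin[of u v "-1"] by simp

lemma wgrad_diff:
  assumes "u \<in> H" "v \<in> H" "\<alpha> > 0"
  shows "AE x in leb_on \<Omega>. wgrad \<Omega> (\<lambda>x. u x - v x) x = wgrad \<Omega> u x - wgrad \<Omega> v x"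
  using wgrad_lin[OF assms, of "-1"] by simp

lemma energy_complete:
  assumes w: "\<And>k. w k \<in> H"
    and cauchy: "\<And>e. e > 0 \<Longrightarrow> \<exists>K. \<forall>m\<ge>K. \<forall>n\<ge>K. quad aform (\<lambda>x. w m x - w n x)
          + quad bform (\<lambda>x. w m x - w n x) < e"
  shows "\<exists>v\<in>H. (\<lambda>k. quad aform (\<lambda>x. w k x - v x)) \<longlonglongrightarrow> 0 \<and>
            (\<lambda>k. quad bform (\<lambda>x. w k x - v x)) \<longlonglongrightarrow> 0"
proof -
  interpret A: psd_form H aform by (rule aform_psd)
  interpret B: psd_form H bform by (rule bform_psd)
  have [measurable]: "w k \<in> borel_measurable borel" "w k \<in> borel_measurable (leb_on \<Omega>)" "D (w k) \<in> borel_measurable nonlocal_measure" for k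
    using HD(1,2,3)[OF w] by (auto intro: sq_integrable_measurable)
  have ab: "\<exists>K. \<forall>m\<ge>K. \<forall>n\<ge>K. quad aform (\<lambda>x. w m x - w n x) \<le> e \<and>
      quad bform (\<lambda>x. w m x - w n x) \<le> e" if "e > 0" for e
  proof -
    obtain K where K: "\<And>m n. m \<ge> K \<Longrightarrow> n \<ge> K \<Longrightarrow> quad aform (\<lambda>x. w m x - w n x)
          + quad bform (\<lambda>x. w m x - w n x) < e" using cauchy[OF \<open>e > 0\<close>] by blast
    show ?thesis
    proof (intro exI[of _ K] allI impI)
      fix m n assume "m \<ge> K" "n \<ge> K"
      then show "quad aform (\<lambda>x. w m x - w n x) \<le> e \<and> quad bform (\<lambda>x. w m x - w n x) \<le> e"
        using K[of m n] A.nonneg[OF H_diff[OF w w], of m n] B.nonneg[OF H_diff[OF w w], of m n] by linarith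
    qed
  qed
  have c1: "\<exists>K. \<forall>m\<ge>K. \<forall>n\<ge>K. L2sq (leb_on \<Omega>) (\<lambda>x. w m x - w n x) \<le> ennreal e" if "e > 0" for e
  proof -
    obtain K where K: "\<And>m n. m \<ge> K \<Longrightarrow> n \<ge> K \<Longrightarrow> quad aform (\<lambda>x. w m x - w n x) \<le> e \<and>
      quad bform (\<lambda>x. w m x - w n x) \<le> e" using ab[OF \<open>e > 0\<close>] by blast
    show ?thesis
      by (intro exI[of _ K] allI impI) (use K H_L2_norms(1)[OF H_diff[OF w w]] in \<open>simp add: ennreal_leI\<close>)
  qed
  have c2: "\<exists>K. \<forall>m\<ge>K. \<forall>n\<ge>K. L2sq nonlocal_measure (\<lambda>p. D (w m) p - D (w n) p) \<le> ennreal e" if "e > 0" for e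
  proof -
    obtain K where K: "\<And>m n. m \<ge> K \<Longrightarrow> n \<ge> K \<Longrightarrow> quad aform (\<lambda>x. w m x - w n x) \<le> e \<and>
      quad bform (\<lambda>x. w m x - w n x) \<le> e" using ab[OF \<open>e > 0\<close>] by blast
    show ?thesis
      by (intro exI[of _ K] allI impI order_trans[OF H_L2_norms(2)[OF H_diff[OF w w], unfolded D_diff]])
         (use K in \<open>simp add: ennreal_leI\<close>)
  qed
  obtain r1 :: "nat \<Rightarrow> nat" where r1: "strict_mono r1" "AE x in leb_on \<Omega>. convergent (\<lambda>k. w (r1 k) x)"
    by (rule L2_Cauchy_AE_convergent_subseq[OF _ c1]) auto
  \<comment> \<open>Refining the first subsequence lets the values on \<Omega> and the weighted
    differences converge along the same indices.\<close>
  have c2': "\<exists>K. \<forall>m\<ge>K. \<forall>n\<ge>K. L2sq nonlocal_measure (\<lambda>p. D (w (r1 m)) p - D (w (r1 n)) p) \<le> ennreal e" if "e > 0" for e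
  proof -
    obtain K where K: "\<And>m n. m \<ge> K \<Longrightarrow> n \<ge> K \<Longrightarrow>
        L2sq nonlocal_measure (\<lambda>p. D (w m) p - D (w n) p) \<le> ennreal e"
      using c2[OF \<open>e > 0\<close>] by blast
    show ?thesis by (intro exI[of _ K] allI impI K) (use seq_suble[OF r1(1)] order_trans in blast)+
  qed
  obtain r2 :: "nat \<Rightarrow> nat" where r2: "strict_mono r2" "AE p in nonlocal_measure. convergent (\<lambda>k. D (w (r1 (r2 k))) p)"
    by (rule L2_Cauchy_AE_convergent_subseq[of "\<lambda>k. D (w (r1 k))", OF _ c2']) auto
  define r where "r = r1 \<circ> r2"
  have r: "strict_mono r" unfolding r_def by (rule strict_mono_o[OF r1(1) r2(1)])
  have convO: "AE x in leb_on \<Omega>. convergent (\<lambda>k. w (r k) x)"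
    using r1(2) by eventually_elim (use convergent_subseq_convergent[OF _ r2(1)] in \<open>simp add: r_def o_def\<close>)
  have conv: "AE y in lborel. convergent (\<lambda>k. w (r k) y)"
    using r2(2) convO by (intro AE_convergent_from_differences) (simp_all add: r_def)
  \<comment> \<open>Defined at every point, with the default of \<open>lim\<close> where there is no
    convergence, so that \<open>v\<close> is Borel on the whole space.\<close>
  define v where "v y = lim (\<lambda>k. w (r k) y)" for y
  have vm[measurable]: "v \<in> borel_measurable borel" unfolding v_def by (rule borel_measurable_lim_metric) measurable
  have vlim: "AE y in lborel. (\<lambda>k. w (r k) y) \<longlonglongrightarrow> v y"
    using conv by eventually_elim (simp add: v_def convergent_LIMSEQ_iff)
  have vlimO: "AE y in leb_on \<Omega>. (\<lambda>k. w (r k) y) \<longlonglongrightarrow> v y"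
    using vlim by (rule AE_leb_onI)
  \<comment> \<open>This identifies the limit of the weighted differences as the weighted difference
    of \<open>v\<close>.\<close>
  have vlimD: "AE p in nonlocal_measure. (\<lambda>k. D (w (r k)) p) \<longlonglongrightarrow> D v p"
    using AE_nonlocal_from_AE_lborel[OF vlim] by eventually_elim (auto simp: D_def intro!: tendsto_intros)
  have vmO: "v \<in> borel_measurable (leb_on \<Omega>)" and vmD: "D v \<in> borel_measurable nonlocal_measure"
    using D_measurable[OF vm] by (auto intro: measurable_restrict_space1)
  have v1: "sq_integrable (leb_on \<Omega>) v"
    by (rule L2_Cauchy_limit(1)[OF HD(2)[OF w] vmO r vlimO c1])
  have l1: "\<exists>K. \<forall>n\<ge>K. L2sq (leb_on \<Omega>) (\<lambda>x. w n x - v x) \<le> ennreal e" if "e > 0" for e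
    using that by (rule L2_Cauchy_limit(2)[OF HD(2)[OF w] vmO r vlimO c1, rotated])
  have v2: "sq_integrable nonlocal_measure (D v)"
    by (rule L2_Cauchy_limit(1)[OF HD(3)[OF w] vmD r vlimD c2])
  have l2: "\<exists>K. \<forall>n\<ge>K. L2sq nonlocal_measure (\<lambda>p. D (w n) p - D v p) \<le> ennreal e" if "e > 0" for e
    using that by (rule L2_Cauchy_limit(2)[OF HD(3)[OF w] vmD r vlimD c2, rotated])
  \<comment> \<open>The gradients have an \<open>L\<^sup>2\<close> limit \<open>G\<close>; it is a
    weak gradient of \<open>v\<close> because, for a fixed test function, both sides of the defining
    identity are continuous in \<open>L\<^sup>2\<close>.\<close>
  have grad: "\<exists>G. weak_grad \<Omega> v G \<and> (\<forall>e>0. \<exists>K. \<forall>n\<ge>K.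
      L2sq (leb_on \<Omega>) (\<lambda>x. wgrad \<Omega> (w n) x - G x) \<le> ennreal e)" if \<alpha>: "\<alpha> > 0"
  proof -
    have wg: "sq_integrable (leb_on \<Omega>) (wgrad \<Omega> (w n))" for n by (rule HD(5)[OF w \<alpha>])
    have c3: "\<exists>K. \<forall>m\<ge>K. \<forall>n\<ge>K. L2sq (leb_on \<Omega>) (\<lambda>x. wgrad \<Omega> (w m) x - wgrad \<Omega> (w n) x) \<le> ennreal e" if "e > 0" for e
    proof -
      obtain K where K: "\<And>m n. m \<ge> K \<Longrightarrow> n \<ge> K \<Longrightarrow> quad aform (\<lambda>x. w m x - w n x) \<le> \<alpha> * e"
        using ab[of "\<alpha> * e"] \<alpha> \<open>e > 0\<close> by auto
      show ?thesis
      proof (intro exI[of _ K] allI impI)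
        fix m n assume mn: "m \<ge> K" "n \<ge> K"
        have "L2sq (leb_on \<Omega>) (\<lambda>x. wgrad \<Omega> (w m) x - wgrad \<Omega> (w n) x) =
          L2sq (leb_on \<Omega>) (\<lambda>x. wgrad \<Omega> (\<lambda>x. w m x - w n x) x)"
          using wgrad_diff[OF w w \<alpha>, of m n] by (intro nn_integral_cong_AE) auto
        also have "\<dots> \<le> ennreal (quad aform (\<lambda>x. w m x - w n x) / \<alpha>)"
          by (rule H_L2_norms(3)[OF H_diff[OF w w] \<alpha>])
        also have "\<dots> \<le> ennreal e" using K[OF mn] \<alpha> by (intro ennreal_leI) (simp add: field_simps)
        finally show "L2sq (leb_on \<Omega>) (\<lambda>x. wgrad \<Omega> (w m) x - wgrad \<Omega> (w n) x) \<le> ennreal e" .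
      qed
    qed
    obtain G where G: "sq_integrable (leb_on \<Omega>) G" and Glim: "\<And>e. e > 0 \<Longrightarrow> \<exists>K. \<forall>n\<ge>K.
      L2sq (leb_on \<Omega>) (\<lambda>x. wgrad \<Omega> (w n) x - G x) \<le> ennreal e"
      using L2_complete[OF wg c3] by blast
    have "weak_grad \<Omega> v G"
      unfolding weak_grad_iff[OF borel_\<Omega>]
    proof (intro conjI allI impI ballI G)
      fix \<phi> and i :: 'a assume \<phi>: "test_fun \<Omega> \<phi>" and i: "i \<in> Basis"
      have lim1: "(\<lambda>n. \<integral>x. w n x * frechet_derivative \<phi> (at x) i \<partial>leb_on \<Omega>) \<longlonglongrightarrow> (\<integral>x. v x * frechet_derivative \<phi> (at x) i \<partial>leb_on \<Omega>)"
        by (rule L2_tendsto_inner[OF HD(2)[OF w] v1 test_fun_sq_integrable(2)[OF \<phi>] l1])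
      have lim2: "(\<lambda>n. \<integral>x. (wgrad \<Omega> (w n) x \<bullet> i) * \<phi> x \<partial>leb_on \<Omega>) \<longlonglongrightarrow> (\<integral>x. (G x \<bullet> i) * \<phi> x \<partial>leb_on \<Omega>)"
      proof (rule L2_tendsto_inner[OF sq_integrable_component[OF wg i] sq_integrable_component[OF G i] test_fun_sq_integrable(1)[OF \<phi>]])
        fix e :: real assume e: "e > 0"
        have le: "L2sq (leb_on \<Omega>) (\<lambda>x. wgrad \<Omega> (w n) x \<bullet> i - G x \<bullet> i) \<le> L2sq (leb_on \<Omega>) (\<lambda>x. wgrad \<Omega> (w n) x - G x)" for n
          unfolding inner_diff_left[symmetric] using Basis_le_norm[OF i]
          by (intro nn_integral_mono ennreal_leI power_mono) auto
        obtain K where "\<forall>n\<ge>K. L2sq (leb_on \<Omega>) (\<lambda>x. wgrad \<Omega> (w n) x - G x) \<le> ennreal e"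
          using Glim[OF e] by blast
        then show "\<exists>K. \<forall>n\<ge>K. L2sq (leb_on \<Omega>) (\<lambda>x. wgrad \<Omega> (w n) x \<bullet> i - G x \<bullet> i) \<le> ennreal e"
          by (intro exI[of _ K] allI impI order_trans[OF le]) blast
      qed
      have "(\<integral>x. w n x * frechet_derivative \<phi> (at x) i \<partial>leb_on \<Omega>) = - (\<integral>x. (wgrad \<Omega> (w n) x \<bullet> i) * \<phi> x \<partial>leb_on \<Omega>)" for n
        using HD(4)[OF w[of n] \<alpha>] \<phi> i unfolding weak_grad_iff[OF borel_\<Omega>] by blast
      with tendsto_minus[OF lim2] lim1
      show "(\<integral>x. v x * frechet_derivative \<phi> (at x) i \<partial>leb_on \<Omega>) = - (\<integral>x. (G x \<bullet> i) * \<phi> x \<partial>leb_on \<Omega>)"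
        by (simp add: LIMSEQ_unique)
    qed
    then show ?thesis using Glim by blast
  qed
  have vH: "v \<in> H" using vm v1 v2 grad by (auto simp: H_iff)
  have "(\<lambda>k. quad bform (\<lambda>x. w k x - v x)) \<longlonglongrightarrow> 0"
  proof (rule tendsto_zero_eps)
    show "0 \<le> quad bform (\<lambda>x. w n x - v x)" for n by (rule B.nonneg[OF H_diff[OF w vH]])
    fix e :: real assume e: "e > 0"
    then show "\<exists>K. \<forall>n\<ge>K. quad bform (\<lambda>x. w n x - v x) \<le> e"
      using l1[OF e] H_L2_norms(1)[OF H_diff[OF w vH]] by simp
  qed
  moreover have "(\<lambda>k. quad aform (\<lambda>x. w k x - v x)) \<longlonglongrightarrow> \<alpha> * 0 + 0"
    unfolding aform_def
  proof (intro tendsto_add tendsto_zero_eps)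
    fix e :: real assume e: "e > 0"
    show "\<exists>K. \<forall>n\<ge>K. (\<integral>p. D (\<lambda>x. w n x - v x) p * D (\<lambda>x. w n x - v x) p \<partial>nonlocal_measure) \<le> e"
      using l2[OF e] L2_norm_le_iff[OF HD(3)[OF H_diff[OF w vH]], of e] e by (simp add: D_diff)
  next
    show "(\<lambda>k. \<alpha> * (\<integral>x. wgrad \<Omega> (\<lambda>x. w k x - v x) x \<bullet> wgrad \<Omega> (\<lambda>x. w k x - v x) x \<partial>leb_on \<Omega>)) \<longlonglongrightarrow> \<alpha> * 0"
    proof (cases "\<alpha> > 0")
      case True
      obtain G where G: "weak_grad \<Omega> v G" and Glim: "\<And>e. e > 0 \<Longrightarrow> \<exists>K. \<forall>n\<ge>K.
        L2sq (leb_on \<Omega>) (\<lambda>x. wgrad \<Omega> (w n) x - G x) \<le> ennreal e"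
        using grad[OF True] by blast
      have eq: "L2sq (leb_on \<Omega>) (\<lambda>x. wgrad \<Omega> (\<lambda>x. w n x - v x) x) =
          L2sq (leb_on \<Omega>) (\<lambda>x. wgrad \<Omega> (w n) x - G x)" for n
      proof (rule nn_integral_cong_AE)
        show "AE x in leb_on \<Omega>. ennreal ((norm (wgrad \<Omega> (\<lambda>x. w n x - v x) x))\<^sup>2) = ennreal ((norm (wgrad \<Omega> (w n) x - G x))\<^sup>2)"
          using wgrad_diff[OF w vH True, of n] wgrad_AE_eq[OF G] by eventually_elim simp
      qed
      have "(\<lambda>k. (\<integral>x. wgrad \<Omega> (\<lambda>x. w k x - v x) x \<bullet> wgrad \<Omega> (\<lambda>x. w k x - v x) x \<partial>leb_on \<Omega>)) \<longlonglongrightarrow> 0"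
      proof (rule tendsto_zero_eps)
        fix e :: real assume e: "e > 0"
        show "\<exists>K. \<forall>n\<ge>K. (\<integral>x. wgrad \<Omega> (\<lambda>x. w n x - v x) x \<bullet> wgrad \<Omega> (\<lambda>x. w n x - v x) x \<partial>leb_on \<Omega>) \<le> e"
          using Glim[OF e] L2_norm_le_iff[OF HD(5)[OF H_diff[OF w vH] True], of e] e by (simp add: eq)
      qed simp
      then show ?thesis by (rule tendsto_mult_left)
    next
      case False
      then have "\<alpha> = 0" using \<alpha>_nonneg by simp
      then show ?thesis by simp
    qed
  qed simp
  ultimately show ?thesis using vH by (intro bexI[of _ v]) auto
qed

end

section \<open>Compactness\<close>

lemma ennreal_cancel_left:
  assumes "0 < c" "ennreal c * X \<le> Y"
  shows "X \<le> ennreal (1 / c) * Y"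
proof -
  have "X = ennreal (1 / c) * (ennreal c * X)"
    using assms(1) by (simp add: mult.assoc[symmetric] ennreal_mult[symmetric])
  also have "\<dots> \<le> ennreal (1 / c) * Y" using assms(2) by (rule mult_left_mono) simp
  finally show ?thesis .
qed

text \<open>The product of the intervals is compact by Tychonoff and, the index set being countable,
  metrisable; this replaces a diagonal extraction.\<close>

lemma bounded_sequences_compact:
  fixes X :: "nat \<Rightarrow> nat \<Rightarrow> real"
  assumes "\<And>n k. \<bar>X n k\<bar> \<le> s k"
  obtains r :: "nat \<Rightarrow> nat" where "strict_mono r" "\<And>k. convergent (\<lambda>n. X (r n) k)"
proof -
  define K where "K = PiE UNIV (\<lambda>k. {- s k..s k})"
  have "compactin (product_topology (\<lambda>_. euclidean) UNIV) K"
    unfolding K_def by (subst compactin_PiE) auto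
  then have "compact K" by (simp add: euclidean_product_topology)
  moreover have "X n \<in> K" for n
  proof -
    have "- s k \<le> X n k \<and> X n k \<le> s k" for k using assms[of n k] by linarith
    then show ?thesis by (auto simp: K_def PiE_iff)
  qed
  ultimately obtain l r where r: "strict_mono r" "(X \<circ> r) \<longlonglongrightarrow> l"
    unfolding compact_eq_seq_compact_metric seq_compact_def by metis
  have "(\<lambda>n. X (r n) k) \<longlonglongrightarrow> l k" for k
  proof -
    have "isCont (\<lambda>f::nat \<Rightarrow> real. f k) l"
      by (rule continuous_on_eq_continuous_at[OF open_UNIV, THEN iffD1,
            OF continuous_on_product_coordinates, rule_format, OF UNIV_I])
    from isCont_tendsto_compose[OF this r(2)] show ?thesis by (simp add: o_def)
  qed
  then have "convergent (\<lambda>n. X (r n) k)" for k by (rule convergentI)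
  with r(1) show thesis by (rule that)
qed

context neumann_problem
begin

text \<open>The intervals from \<open>1 / (n + 2)\<close> to 1 exhaust the open unit interval, so
  they cannot all be null.\<close>

lemma exists_exponent: "\<exists>a. 0 < a \<and> a < 1 \<and> emeasure \<mu> {s \<in> space \<mu>. a \<le> s} \<noteq> 0"
proof (rule ccontr)
  assume "\<not> ?thesis"
  then have z: "emeasure \<mu> {s \<in> space \<mu>. a \<le> s} = 0" if "0 < a" "a < 1" for a using that by blast
  have "{s \<in> space \<mu>. 1 / (real n + 2) \<le> s} \<in> null_sets \<mu>" for n :: nat
    unfolding null_sets_def using z[of "1 / (real n + 2)"] by (auto simp: field_simps)
  then have "(\<Union>n::nat. {s \<in> space \<mu>. 1 / (real n + 2) \<le> s}) \<in> null_sets \<mu>" by (rule null_sets_UN)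
  moreover have "(\<Union>n::nat. {s \<in> space \<mu>. 1 / (real n + 2) \<le> s}) = space \<mu>"
  proof -
    have "\<exists>n::nat. 1 / (real n + 2) \<le> s" if "s \<in> space \<mu>" for s
    proof -
      have "s > 0" using that by (simp add: space_\<mu>)
      then obtain n where n: "inverse (real (Suc n)) < s" using reals_Archimedean by blast
      have "1 / (real n + 2) \<le> inverse (real (Suc n))" by (simp add: field_simps)
      then show ?thesis using n by (intro exI[of _ n]) simp
    qed
    then show ?thesis by auto
  qed
  ultimately show False using nontrivial_\<mu> by (simp add: null_sets_def)
qed

definition near_energy :: "real \<Rightarrow> real \<Rightarrow> ('a \<Rightarrow> real) \<Rightarrow> ennreal" where
  "near_energy a R u = (\<integral>\<^sup>+ z. indicator (Qset \<Omega>) z * (indicator {z. norm (fst z - snd z) \<le> R} z *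
     ennreal ((u (fst z) - u (snd z))\<^sup>2 / norm (fst z - snd z) powr (real DIM('a) + 2 * a))) \<partial>lborel2)"

lemma near_measurable[measurable]: "{z::'a \<times> 'a. norm (fst z - snd z) \<le> R} \<in> sets lborel2"
proof -
  have "{z \<in> space lborel2. norm (fst z - snd z) \<le> R} \<in> sets lborel2" by measurable
  then show ?thesis by (simp add: space_pair_measure)
qed

text \<open>For \<open>r \<le> R\<close> and \<open>s \<ge> a\<close> one has
  \<open>r powr (2 * (s - a)) \<le> R\<^sup>2\<close>, so the kernel of exponent \<open>s\<close>
  dominates that of exponent \<open>a\<close> up to \<open>R\<^sup>2\<close>. Integrating over the
  exponents \<open>s \<ge> a\<close> leaves a positive constant.\<close>

lemma near_energy_bound:
  obtains a \<kappa> where "0 < a" "a < 1" "0 < \<kappa>"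
    "\<And>u R. u \<in> H \<Longrightarrow> 1 \<le> R \<Longrightarrow> near_energy a R u \<le> ennreal (R\<^sup>2 / \<kappa> * aform u u)"
proof -
  obtain a where a: "0 < a" "a < 1" "emeasure \<mu> {s \<in> space \<mu>. a \<le> s} \<noteq> 0" using exists_exponent by blast
  define E where "E = {s \<in> space \<mu>. a \<le> s}"
  have [measurable]: "E \<in> sets \<mu>" unfolding E_def by measurable
  have E01: "E \<subseteq> {0<..<1}" by (auto simp: E_def space_\<mu>)
  define KE where "KE = (\<integral>\<^sup>+ s. indicator E s * ennreal (cNs DIM('a) s / 2) \<partial>\<mu>)"
  have "KE \<noteq> 0"
  proof
    assume "KE = 0"
    then have "AE s in \<mu>. indicator E s * ennreal (cNs DIM('a) s / 2) = 0"
      unfolding KE_def by (subst (asm) nn_integral_0_iff_AE) auto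
    then have "AE s in \<mu>. s \<notin> E"
    proof eventually_elim
      fix s assume *: "indicator E s * ennreal (cNs DIM('a) s / 2) = 0"
      show "s \<notin> E"
      proof
        assume s: "s \<in> E"
        then have "cNs DIM('a) s > 0" using E01 cNs_pos[of s] by auto
        then show False using * s by simp
      qed
    qed
    then have "emeasure \<mu> E = 0" by (subst (asm) AE_iff_measurable[OF _ refl]) (auto simp: E_def)
    then show False using a(3) by (simp add: E_def)
  qed
  \<comment> \<open>No finiteness of \<open>KE\<close> is established; any positive real below it
    will do.\<close>
  then obtain \<kappa> where \<kappa>: "0 < \<kappa>" "ennreal \<kappa> \<le> KE"
  proof (cases KE)
    case (real r)
    then show thesis using \<open>KE \<noteq> 0\<close> that[of r] by (cases "r = 0") auto
  next
    case top then show thesis using that[of 1] by simp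
  qed
  have "near_energy a R u \<le> ennreal (R\<^sup>2 / \<kappa> * aform u u)" if u: "u \<in> H" and R: "1 \<le> R" for u R
  proof -
    have [measurable]: "u \<in> borel_measurable borel" by (rule HD(1)[OF u])
    have [measurable]: "D u \<in> borel_measurable nonlocal_measure" by (rule D_measurable) simp
    let ?p = "real DIM('a) + 2 * a"
    let ?g = "\<lambda>z. indicator (Qset \<Omega>) z * (indicator {z. norm (fst z - snd z) \<le> R} z *
        ennreal ((u (fst z) - u (snd z))\<^sup>2 / norm (fst z - snd z) powr ?p))"
    have inner: "indicator E s * ennreal (cNs DIM('a) s / 2) * (ennreal (1 / R\<^sup>2) * near_energy a R u)
        \<le> L2sq lborel2 (\<lambda>z. D u (s, z))" for s
    proof (cases "s \<in> E")
      case True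
      then have s: "s \<in> {0<..<1}" "a \<le> s" using E01 by (auto simp: E_def)
      then have c: "cNs DIM('a) s > 0" using cNs_pos by auto
      have "ennreal (cNs DIM('a) s / 2) * (ennreal (1 / R\<^sup>2) * near_energy a R u) =
          (\<integral>\<^sup>+ z. ennreal (cNs DIM('a) s / 2) * (ennreal (1 / R\<^sup>2) * ?g z) \<partial>lborel2)"
        unfolding near_energy_def by (simp add: nn_integral_cmult)
      also have "\<dots> \<le> L2sq lborel2 (\<lambda>z. D u (s, z))"
      proof (rule nn_integral_mono)
        fix z :: "'a \<times> 'a"
        define r where "r = norm (fst z - snd z)"
        define X where "X = (u (fst z) - u (snd z))\<^sup>2"
        show "ennreal (cNs DIM('a) s / 2) * (ennreal (1 / R\<^sup>2) * ?g z) \<le> ennreal ((norm (D u (s, z)))\<^sup>2)"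
        proof (cases "z \<in> Qset \<Omega> \<and> r \<le> R")
          case T: True
          have "X / r powr ?p / R\<^sup>2 \<le> X / r powr (real DIM('a) + 2 * s)"
          proof (cases "r = 0")
            case True then show ?thesis by simp
          next
            case False
            then have r0: "r > 0" by (simp add: r_def)
            have "r powr (2 * (s - a)) \<le> R powr (2 * (s - a))"
              using T s r0 by (intro powr_mono2) auto
            also have "\<dots> \<le> R powr 2" using s R a by (intro powr_mono) auto
            also have "\<dots> = R\<^sup>2" using R by simp
            finally have "r powr ?p * r powr (2 * (s - a)) \<le> r powr ?p * R\<^sup>2" by (rule mult_left_mono) simp
            also have "r powr ?p * r powr (2 * (s - a)) = r powr (real DIM('a) + 2 * s)"
              unfolding powr_add[symmetric] by (rule arg_cong[of _ _ "(powr) r"]) simp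
            finally have "r powr (real DIM('a) + 2 * s) \<le> r powr ?p * R\<^sup>2" .
            then have "X / (r powr ?p * R\<^sup>2) \<le> X / r powr (real DIM('a) + 2 * s)"
              using r0 R by (intro divide_left_mono) (auto simp: X_def)
            then show ?thesis by simp
          qed
          then have le: "cNs DIM('a) s / 2 * (X / r powr ?p / R\<^sup>2) \<le> cNs DIM('a) s / 2 * (X / r powr (real DIM('a) + 2 * s))"
            using c by (intro mult_left_mono) auto
          have "ennreal (cNs DIM('a) s / 2) * (ennreal (1 / R\<^sup>2) * ?g z) = ennreal (cNs DIM('a) s / 2 * (X / r powr ?p / R\<^sup>2))"
            using T c by (simp add: r_def X_def ennreal_mult[symmetric])
          also have "\<dots> \<le> ennreal (cNs DIM('a) s / 2 * (X / r powr (real DIM('a) + 2 * s)))" by (rule ennreal_leI[OF le])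
          also have "cNs DIM('a) s / 2 * (X / r powr (real DIM('a) + 2 * s)) = (norm (D u (s, z)))\<^sup>2"
            using D_mult[OF s(1), of u z u] T by (simp add: power2_eq_square X_def r_def)
          finally show ?thesis .
        next
          case False then show ?thesis by (auto simp: r_def)
        qed
      qed
      finally show ?thesis using True by simp
    qed simp
    have "ennreal \<kappa> * (ennreal (1 / R\<^sup>2) * near_energy a R u) \<le> KE * (ennreal (1 / R\<^sup>2) * near_energy a R u)"
      using \<kappa>(2) by (rule mult_right_mono) simp
    also have "\<dots> = (\<integral>\<^sup>+ s. indicator E s * ennreal (cNs DIM('a) s / 2) * (ennreal (1 / R\<^sup>2) * near_energy a R u) \<partial>\<mu>)"
      unfolding KE_def by (rule nn_integral_multc[symmetric]) measurable
    also have "\<dots> \<le> (\<integral>\<^sup>+ s. L2sq lborel2 (\<lambda>z. D u (s, z)) \<partial>\<mu>)"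
      by (rule nn_integral_mono) (rule inner)
    also have "\<dots> = L2sq nonlocal_measure (D u)"
      by (rule sigma_finite_measure.nn_integral_fst[OF sigma_finite_lborel2]) measurable
    also have "\<dots> \<le> ennreal (aform u u)" by (rule H_L2_norms(2)[OF u])
    finally have "ennreal (\<kappa> / R\<^sup>2) * near_energy a R u \<le> ennreal (aform u u)"
      using \<kappa> R by (simp add: mult.assoc[symmetric] ennreal_mult[symmetric])
    then have "near_energy a R u \<le> ennreal (1 / (\<kappa> / R\<^sup>2)) * ennreal (aform u u)"
      using \<kappa> R by (intro ennreal_cancel_left) auto
    also have "\<dots> = ennreal (R\<^sup>2 / \<kappa> * aform u u)"
      using \<kappa> R psd_form.nonneg[OF aform_psd u] by (simp add: ennreal_mult[symmetric])
    finally show ?thesis .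
  qed
  then show thesis using a \<kappa> that by blast
qed

text \<open>Although the norm of \<open>H\<close> only controls the \<open>L\<^sup>2\<close> norm on \<open>\<Omega>\<close>, the interaction of \<open>\<Omega>\<close> with its
  complement makes \<open>H\<close> embed into \<open>L\<^sup>2\<close> of every bounded set.\<close>

lemma H_L2_local:
  assumes B[measurable]: "B \<in> sets borel" and bB: "bounded B"
  obtains C where "C \<ge> 0"
    "\<And>u. u \<in> H \<Longrightarrow> L2sq (leb_on B) u \<le> ennreal (C * (aform u u + bform u u))"
proof -
  obtain a \<kappa> where a: "0 < a" "a < 1" "0 < \<kappa>"
    and near: "\<And>u R. u \<in> H \<Longrightarrow> 1 \<le> R \<Longrightarrow> near_energy a R u \<le> ennreal (R\<^sup>2 / \<kappa> * aform u u)"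
    using near_energy_bound by blast
  let ?p = "real DIM('a) + 2 * a"
  obtain R1 R2 where R1: "\<And>x. x \<in> \<Omega> \<Longrightarrow> norm x \<le> R1" and R2: "\<And>x. x \<in> B \<Longrightarrow> norm x \<le> R2"
    using bounded_\<Omega> bB unfolding bounded_iff by blast
  \<comment> \<open>Bounds every distance between \<Omega> and \<open>B\<close>, so that the cut-off
    in \<open>near_energy\<close> loses none of these pairs.\<close>
  define R where "R = max 1 (R1 + R2)"
  have R: "1 \<le> R" by (simp add: R_def)
  have dist: "norm (x - y) \<le> R" if "x \<in> \<Omega>" "y \<in> B" for x y
    using norm_triangle_ineq4[of x y] R1[OF that(1)] R2[OF that(2)] by (simp add: R_def)
  define V where "V = measure lborel \<Omega>"
  have eV: "emeasure lborel \<Omega> = ennreal V"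
    using emeasure_bounded_finite[OF bounded_\<Omega>] by (auto simp: V_def emeasure_eq_ennreal_measure)
  have V: "V > 0" using emeasure_\<Omega>_pos eV by (simp add: ennreal_less_zero_iff)
  define W where "W = measure lborel B"
  have eW: "emeasure lborel B = ennreal W" "0 \<le> W"
    using emeasure_bounded_finite[OF bB] by (auto simp: W_def emeasure_eq_ennreal_measure)
  define C where "C = 1 / V * (2 * R powr ?p * (R\<^sup>2 / \<kappa>) + 2 * W)"
  have C0: "C \<ge> 0" using V eW a by (simp add: C_def)
  have "L2sq (leb_on B) u \<le> ennreal (C * (aform u u + bform u u))" if u: "u \<in> H" for u
  proof -
    have [measurable]: "u \<in> borel_measurable borel" by (rule HD(1)[OF u])
    have a0: "0 \<le> aform u u" and b0: "0 \<le> bform u u"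
      using psd_form.nonneg[OF aform_psd u] psd_form.nonneg[OF bform_psd u] by auto
    \<comment> \<open>The inequality \<open>(u y)\<^sup>2 \<le> 2 * (u x - u y)\<^sup>2 + 2 * (u
      x)\<^sup>2\<close> is integrated over \<open>x\<close> in \<Omega> and \<open>y\<close> in
      \<open>B\<close>; the left side produces the factor \<open>V\<close>.\<close>
    have "ennreal V * L2sq (leb_on B) u =
        (\<integral>\<^sup>+ x. indicator \<Omega> x * (\<integral>\<^sup>+ y. indicator B y * ennreal ((u y)\<^sup>2) \<partial>lborel) \<partial>lborel)"
      by (simp add: nn_integral_restrict_space nn_integral_multc eV mult.commute)
    also have "\<dots> = (\<integral>\<^sup>+ x. (\<integral>\<^sup>+ y. indicator \<Omega> x * (indicator B y * ennreal ((u y)\<^sup>2)) \<partial>lborel) \<partial>lborel)"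
      by (simp add: nn_integral_cmult)
    also have "\<dots> = (\<integral>\<^sup>+ z. indicator \<Omega> (fst z) * (indicator B (snd z) * ennreal ((u (snd z))\<^sup>2)) \<partial>lborel2)"
      by (subst lborel.nn_integral_fst[symmetric]) simp_all
    also have "\<dots> \<le> (\<integral>\<^sup>+ z. ennreal (2 * R powr ?p) * (indicator (Qset \<Omega>) z * (indicator {z. norm (fst z - snd z) \<le> R} z *
        ennreal ((u (fst z) - u (snd z))\<^sup>2 / norm (fst z - snd z) powr ?p)))
        + 2 * (indicator \<Omega> (fst z) * ennreal ((u (fst z))\<^sup>2) * indicator B (snd z)) \<partial>lborel2)"
    proof (rule nn_integral_mono)
      fix z :: "'a \<times> 'a"
      obtain x y where z: "z = (x, y)" by (cases z)
      show "indicator \<Omega> (fst z) * (indicator B (snd z) * ennreal ((u (snd z))\<^sup>2)) \<le>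
        ennreal (2 * R powr ?p) * (indicator (Qset \<Omega>) z * (indicator {z. norm (fst z - snd z) \<le> R} z *
        ennreal ((u (fst z) - u (snd z))\<^sup>2 / norm (fst z - snd z) powr ?p)))
        + 2 * (indicator \<Omega> (fst z) * ennreal ((u (fst z))\<^sup>2) * indicator B (snd z))"
      proof (cases "x \<in> \<Omega> \<and> y \<in> B")
        case True
        have "(u x - u y)\<^sup>2 \<le> R powr ?p * ((u x - u y)\<^sup>2 / norm (x - y) powr ?p)"
        proof (cases "x = y")
          case False
          have "norm (x - y) powr ?p \<le> R powr ?p" using dist[of x y] True a by (intro powr_mono2) auto
          then have "(u x - u y)\<^sup>2 * norm (x - y) powr ?p \<le> (u x - u y)\<^sup>2 * R powr ?p" by (intro mult_left_mono) auto
          then show ?thesis using False by (simp add: field_simps)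
        qed simp
        moreover have "(u y)\<^sup>2 \<le> 2 * (u x - u y)\<^sup>2 + 2 * (u x)\<^sup>2"
          using norm_add_square_le[of "u y - u x" "u x"] by (simp add: power2_commute)
        ultimately have "(u y)\<^sup>2 \<le> 2 * R powr ?p * ((u x - u y)\<^sup>2 / norm (x - y) powr ?p) + 2 * (u x)\<^sup>2" by linarith
        then have "ennreal ((u y)\<^sup>2) \<le> ennreal (2 * R powr ?p * ((u x - u y)\<^sup>2 / norm (x - y) powr ?p) + 2 * (u x)\<^sup>2)"
          by (rule ennreal_leI)
        also have "\<dots> = ennreal (2 * R powr ?p) * ennreal ((u x - u y)\<^sup>2 / norm (x - y) powr ?p) + 2 * ennreal ((u x)\<^sup>2)"
          by (simp only: ennreal_plus ennreal_mult zero_le_power2 zero_le_divide_iff powr_ge_zero mult_nonneg_nonneg zero_le_numeral ennreal_numeral simp_thms)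
        finally show ?thesis using True dist[of x y] by (simp add: z Qset_def)
      next
        case False then show ?thesis by (auto simp: z)
      qed
    qed
    also have "\<dots> = ennreal (2 * R powr ?p) * near_energy a R u + 2 * (\<integral>\<^sup>+ z. indicator \<Omega> (fst z) * ennreal ((u (fst z))\<^sup>2) * indicator B (snd z) \<partial>lborel2)"
      unfolding near_energy_def by (simp add: nn_integral_add nn_integral_cmult)
    also have "(\<integral>\<^sup>+ z. indicator \<Omega> (fst z) * ennreal ((u (fst z))\<^sup>2) * indicator B (snd z) \<partial>lborel2) = ennreal (bform u u) * ennreal W"
      unfolding H_L2_norms(1)[OF u, symmetric]
      by (subst lborel.nn_integral_fst[symmetric])
         (simp_all add: nn_integral_cmult nn_integral_multc nn_integral_restrict_space eW mult.commute)
    also have "ennreal (2 * R powr ?p) * near_energy a R u + 2 * (ennreal (bform u u) * ennreal W) \<le>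
        ennreal (2 * R powr ?p) * ennreal (R\<^sup>2 / \<kappa> * aform u u) + 2 * (ennreal (bform u u) * ennreal W)"
      using near[OF u R] by (intro add_right_mono mult_left_mono) auto
    also have "\<dots> = ennreal (2 * R powr ?p * (R\<^sup>2 / \<kappa> * aform u u) + 2 * (bform u u * W))"
      using a0 b0 eW(2) a by (simp add: ennreal_mult[symmetric] ennreal_plus[symmetric] ennreal_numeral[symmetric] del: ennreal_plus ennreal_numeral)
    finally have "L2sq (leb_on B) u \<le> ennreal (1 / V) * ennreal (2 * R powr ?p * (R\<^sup>2 / \<kappa> * aform u u) + 2 * (bform u u * W))"
      by (rule ennreal_cancel_left[OF V])
    also have "\<dots> = ennreal (1 / V * (2 * R powr ?p * (R\<^sup>2 / \<kappa> * aform u u) + 2 * (bform u u * W)))"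
      using V a0 b0 eW(2) a by (intro ennreal_mult[symmetric]) auto
    also have "\<dots> \<le> ennreal (C * (aform u u + bform u u))"
    proof (rule ennreal_leI)
      have "2 * R powr ?p * (R\<^sup>2 / \<kappa> * aform u u) + 2 * (bform u u * W) \<le> (2 * R powr ?p * (R\<^sup>2 / \<kappa>) + 2 * W) * (aform u u + bform u u)"
      proof -
        define k where "k = 2 * R powr ?p * (R\<^sup>2 / \<kappa>)"
        have k: "0 \<le> k" using a by (simp add: k_def)
        have "k * aform u u + 2 * (bform u u * W) \<le> (k + 2 * W) * (aform u u + bform u u)"
          using mult_nonneg_nonneg[OF k b0] mult_nonneg_nonneg[OF eW(2) a0] by (simp add: algebra_simps)
        then show ?thesis by (simp add: k_def mult.assoc)
      qed
      then show "1 / V * (2 * R powr ?p * (R\<^sup>2 / \<kappa> * aform u u) + 2 * (bform u u * W)) \<le> C * (aform u u + bform u u)"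
        unfolding C_def mult.assoc[of "1 / V"] using V by (intro mult_left_mono) auto
    qed
    finally show ?thesis .
  qed
  then show thesis using C0 that by blast
qed

section \<open>Averages over balls and the compactness estimate\<close>

definition avg :: "'a \<Rightarrow> real \<Rightarrow> ('a \<Rightarrow> real) \<Rightarrow> real" where
  "avg p \<delta> u = (\<integral>x. u x \<partial>leb_on (ball p \<delta>)) / measure lborel (ball p \<delta>)"

lemma finite_leb_on_ball: "finite_measure (leb_on (ball (p::'a) \<delta>))"
  by (rule finite_measure_leb_on) auto

lemma sq_integrable_ball_integrable:
  assumes "sq_integrable (leb_on (ball p \<delta>)) u"
  shows "integrable (leb_on (ball p \<delta>)) (u :: 'a \<Rightarrow> real)"
  using sq_integrable_mult[OF assms sq_integrable_bounded[OF finite_leb_on_ball, where f="\<lambda>_. 1" and B=1]] by simp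

lemma measure_leb_on_ball: "measure (leb_on (ball (p::'a) \<delta>)) (ball p \<delta>) = measure lborel (ball p \<delta>)"
  by (simp add: measure_restrict_space)

text \<open>Cauchy-Schwarz against the constant 1.\<close>

lemma ball_jensen:
  assumes u: "sq_integrable (leb_on (ball p \<delta>)) (u :: 'a \<Rightarrow> real)"
  shows "(\<integral>x. u x \<partial>leb_on (ball p \<delta>))\<^sup>2 \<le> measure lborel (ball p \<delta>) * (\<integral>x. u x * u x \<partial>leb_on (ball p \<delta>))"
proof -
  let ?M = "leb_on (ball p \<delta>)"
  interpret P: psd_form "{f. sq_integrable ?M f}" "\<lambda>f g. \<integral>x. f x * g x \<partial>?M" by (rule sq_integrable_psd)
  have one: "sq_integrable ?M (\<lambda>_. 1::real)" by (rule sq_integrable_bounded[OF finite_leb_on_ball, where B=1]) auto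
  have "\<bar>\<integral>x. u x * 1 \<partial>?M\<bar> \<le> sqrt (\<integral>x. u x * u x \<partial>?M) * sqrt (\<integral>x. 1 * 1 \<partial>?M)"
    using P.cauchy_schwarz[of u "\<lambda>_. 1"] u one by simp
  then have "(\<integral>x. u x \<partial>?M)\<^sup>2 \<le> (sqrt (\<integral>x. u x * u x \<partial>?M) * sqrt (measure lborel (ball p \<delta>)))\<^sup>2"
    by (intro abs_le_square_iff[THEN iffD1]) (simp add: measure_leb_on_ball)
  then show ?thesis by (simp add: power_mult_distrib mult.commute)
qed

text \<open>The ball may leave \<Omega>, so this rests on the local embedding and not on the
  definition of \<open>H\<close>.\<close>

lemma H_sq_integrable_ball:
  assumes "u \<in> H"
  shows "sq_integrable (leb_on (ball p \<delta>)) u"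
proof -
  obtain C where "L2sq (leb_on (ball p \<delta>)) u \<le> ennreal (C * (aform u u + bform u u))"
    using H_L2_local[of "ball p \<delta>"] assms by auto
  then have "L2sq (leb_on (ball p \<delta>)) u < \<infinity>"
    by (auto intro: le_less_trans)
  then show ?thesis using HD(1)[OF assms] by (simp add: sq_integrable_def measurable_restrict_space1)
qed

lemma avg_diff:
  assumes "u \<in> H" "v \<in> H"
  shows "avg p \<delta> (\<lambda>x. u x - v x) = avg p \<delta> u - avg p \<delta> v"
  using sq_integrable_ball_integrable[OF H_sq_integrable_ball[OF assms(1)]]
    sq_integrable_ball_integrable[OF H_sq_integrable_ball[OF assms(2)]]
  by (simp add: avg_def diff_divide_distrib)

lemma avg_bounded: "\<exists>C\<ge>0. \<forall>u\<in>H. (avg p \<delta> u)\<^sup>2 \<le> C * (aform u u + bform u u)"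
proof (cases "measure lborel (ball p \<delta>) = 0")
  case True then show ?thesis by (intro exI[of _ 0]) (simp add: avg_def)
next
  case False
  define m where "m = measure lborel (ball p \<delta>)"
  have m: "m > 0" using False by (simp add: m_def less_le)
  obtain C where C: "C \<ge> 0" "\<And>u. u \<in> H \<Longrightarrow> L2sq (leb_on (ball p \<delta>)) u \<le> ennreal (C * (aform u u + bform u u))"
    using H_L2_local[of "ball p \<delta>"] by auto
  have "(avg p \<delta> u)\<^sup>2 \<le> C / m * (aform u u + bform u u)" if u: "u \<in> H" for u
  proof -
    have ab: "0 \<le> aform u u + bform u u"
      using psd_form.nonneg[OF aform_psd u] psd_form.nonneg[OF bform_psd u] by simp
    have "(avg p \<delta> u)\<^sup>2 = (\<integral>x. u x \<partial>leb_on (ball p \<delta>))\<^sup>2 / m\<^sup>2" by (simp add: avg_def m_def power_divide)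
    also have "\<dots> \<le> m * (\<integral>x. u x * u x \<partial>leb_on (ball p \<delta>)) / m\<^sup>2"
      using ball_jensen[OF H_sq_integrable_ball[OF u], of p \<delta>] by (intro divide_right_mono) (auto simp: m_def)
    also have "\<dots> = (\<integral>x. u x * u x \<partial>leb_on (ball p \<delta>)) / m" using m by (simp add: power2_eq_square)
    also have "\<dots> \<le> C * (aform u u + bform u u) / m"
      using C(2)[OF u] L2_norm_le_iff[OF H_sq_integrable_ball[OF u, of p \<delta>], of "C * (aform u u + bform u u)"] C(1) ab m
      by (intro divide_right_mono) auto
    finally show ?thesis by simp
  qed
  then show ?thesis using C m by (intro exI[of _ "C / m"]) auto
qed

text \<open>The left side squares the average of \<open>u x - u y\<close> over the ball; Jensen
  moves the square inside.\<close>

lemma deviation_from_avg: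
  assumes u: "u \<in> H" and \<delta>: "\<delta> > 0"
  shows "ennreal ((u x - avg p \<delta> u)\<^sup>2) \<le> ennreal (1 / measure lborel (ball p \<delta>)) *
    (\<integral>\<^sup>+ y. indicator (ball p \<delta>) y * ennreal ((u x - u y)\<^sup>2) \<partial>lborel)"
proof -
  let ?M = "leb_on (ball p \<delta>)"
  define m where "m = measure lborel (ball p \<delta>)"
  have m: "m > 0" using \<delta> by (simp add: m_def content_ball_pos)
  note ub = H_sq_integrable_ball[OF u, of p \<delta>]
  have c: "sq_integrable ?M (\<lambda>_. u x)" by (rule sq_integrable_bounded[OF finite_leb_on_ball, where B="norm (u x)"]) auto
  have d: "sq_integrable ?M (\<lambda>y. u x - u y)" by (rule sq_integrable_diff[OF c ub])
  have "(\<integral>y. u x - u y \<partial>?M) = m * u x - (\<integral>y. u y \<partial>?M)"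
    using sq_integrable_ball_integrable[OF ub] sq_integrable_ball_integrable[OF c]
    by (simp add: measure_leb_on_ball m_def)
  then have "u x - avg p \<delta> u = (\<integral>y. u x - u y \<partial>?M) / m"
    using m by (simp add: avg_def m_def[symmetric] field_simps)
  then have "(u x - avg p \<delta> u)\<^sup>2 = (\<integral>y. u x - u y \<partial>?M)\<^sup>2 / m\<^sup>2" by (simp add: power_divide)
  also have "\<dots> \<le> m * (\<integral>y. (u x - u y) * (u x - u y) \<partial>?M) / m\<^sup>2"
    using ball_jensen[OF d] by (intro divide_right_mono) (auto simp: m_def)
  also have "\<dots> = 1 / m * (\<integral>y. (u x - u y) * (u x - u y) \<partial>?M)" using m by (simp add: power2_eq_square)
  finally have "ennreal ((u x - avg p \<delta> u)\<^sup>2) \<le> ennreal (1 / m * (\<integral>y. (u x - u y) * (u x - u y) \<partial>?M))" by (rule ennreal_leI)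
  also have "\<dots> = ennreal (1 / m) * ennreal (\<integral>y. (u x - u y) * (u x - u y) \<partial>?M)" using m by (intro ennreal_mult) auto
  also have "ennreal (\<integral>y. (u x - u y) * (u x - u y) \<partial>?M) = L2sq ?M (\<lambda>y. u x - u y)"
    using sq_integrable_nn_integral[OF d] by simp
  also have "\<dots> = (\<integral>\<^sup>+ y. indicator (ball p \<delta>) y * ennreal ((u x - u y)\<^sup>2) \<partial>lborel)"
    by (simp add: nn_integral_restrict_space mult.commute)
  finally show ?thesis by (simp add: m_def)
qed

text \<open>An inequality of Ehrling type: up to finitely many linear functionals the
  \<open>L\<^sup>2\<close> norm is small against the energy. Removing the kernel costs
  \<open>(2 * \<delta>) powr (N + 2 * a)\<close> with \<open>N\<close> the dimension, averaging over
  a ball divides by order \<open>\<delta> ^ N\<close>, and \<open>\<delta> powr (2 * a)\<close>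
  remains.\<close>

lemma compactness_estimate:
  assumes e: "e > 0"
  shows "\<exists>P \<delta> C. finite P \<and> C \<ge> 0 \<and> (\<forall>u\<in>H. bform u u \<le> e * aform u u + C * (\<Sum>p\<in>P. (avg p \<delta> u)\<^sup>2))"
proof -
  obtain a \<kappa> where a: "0 < a" "a < 1" "0 < \<kappa>"
    and near: "\<And>u R. u \<in> H \<Longrightarrow> 1 \<le> R \<Longrightarrow> near_energy a R u \<le> ennreal (R\<^sup>2 / \<kappa> * aform u u)"
    using near_energy_bound by blast
  let ?p = "real DIM('a) + 2 * a" and ?U = "unit_ball_vol (real DIM('a))"
  have U: "?U > 0" by simp
  \<comment> \<open>Collects the factors in front of the energy other than
    \<open>\<delta> powr (2 * a)\<close>: from \<open>2 / m\<close>, from the power of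
    \<open>2 * \<delta>\<close>, and \<open>1 / \<kappa>\<close>.\<close>
  define K where "K = 2 * 2 powr ?p / ?U / \<kappa>"
  have K: "K > 0" using U a by (simp add: K_def)
  \<comment> \<open>Small enough for \<open>K * \<delta> powr (2 * a) \<le> e\<close>; the cap 1/2
    keeps pairs at distance \<open>2 * \<delta>\<close> within range 1 of
    \<open>near_energy\<close>.\<close>
  define \<delta> where "\<delta> = min (1/2) ((e / K) powr (1 / (2 * a)))"
  have \<delta>: "0 < \<delta>" "2 * \<delta> \<le> 1" using e K by (auto simp: \<delta>_def)
  have "\<delta> powr (2 * a) \<le> ((e / K) powr (1 / (2 * a))) powr (2 * a)"
    using a \<delta> by (intro powr_mono2) (auto simp: \<delta>_def)
  also have "\<dots> = e / K" using a e K by (simp add: powr_powr)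
  finally have \<delta>a: "K * \<delta> powr (2 * a) \<le> e" using K by (simp add: field_simps)
  have "compact (closure \<Omega>)" using bounded_\<Omega> by simp
  then obtain P where P: "finite P" "closure \<Omega> \<subseteq> (\<Union>x\<in>P. ball x \<delta>)"
    using \<delta>(1) unfolding compact_eq_totally_bounded by blast
  define V where "V = measure lborel \<Omega>"
  have eV: "emeasure lborel \<Omega> = ennreal V" "0 \<le> V"
    using emeasure_bounded_finite[OF bounded_\<Omega>] by (auto simp: V_def emeasure_eq_ennreal_measure)
  define m where "m = ?U * \<delta> ^ DIM('a)"
  have m: "m > 0" using U \<delta> by (simp add: m_def)
  have mb: "measure lborel (ball p \<delta>) = m" for p :: 'a using \<delta> by (simp add: content_ball m_def)
  have "bform u u \<le> e * aform u u + 2 * V * (\<Sum>p\<in>P. (avg p \<delta> u)\<^sup>2)" if u: "u \<in> H" for u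
  proof -
    have [measurable]: "u \<in> borel_measurable borel" by (rule HD(1)[OF u])
    have a0: "0 \<le> aform u u" using psd_form.nonneg[OF aform_psd u] .
    define S where "S = (\<Sum>p\<in>P. (avg p \<delta> u)\<^sup>2)"
    have S0: "0 \<le> S" by (simp add: S_def sum_nonneg)
    let ?N = "\<lambda>x y. indicator {z. norm (fst z - snd z) \<le> 2 * \<delta>} (x, y) * ennreal ((u x - u y)\<^sup>2)"
    \<comment> \<open>The centre \<open>p\<close> varies with \<open>x\<close>. Replacing its
      average by the sum \<open>S\<close> and its ball by the points within
      \<open>2 * \<delta>\<close> of \<open>x\<close> removes this dependence, so that the bound can
      be integrated in \<open>x\<close>.\<close>
    have pt: "ennreal ((u x)\<^sup>2) \<le> ennreal (2 / m) * (\<integral>\<^sup>+ y. ?N x y \<partial>lborel) + ennreal (2 * S)" if x: "x \<in> \<Omega>" for x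
    proof -
      obtain p where p: "p \<in> P" "x \<in> ball p \<delta>" using P(2) x closure_subset[of \<Omega>] by blast
      have "(u x)\<^sup>2 \<le> 2 * (u x - avg p \<delta> u)\<^sup>2 + 2 * (avg p \<delta> u)\<^sup>2"
        using norm_add_square_le[of "u x - avg p \<delta> u" "avg p \<delta> u"] by simp
      moreover have "(avg p \<delta> u)\<^sup>2 \<le> S" unfolding S_def using P(1) p(1) by (intro member_le_sum) auto
      ultimately have "(u x)\<^sup>2 \<le> 2 * (u x - avg p \<delta> u)\<^sup>2 + 2 * S" by linarith
      then have "ennreal ((u x)\<^sup>2) \<le> ennreal (2 * (u x - avg p \<delta> u)\<^sup>2 + 2 * S)" by (rule ennreal_leI)
      also have "\<dots> = 2 * ennreal ((u x - avg p \<delta> u)\<^sup>2) + ennreal (2 * S)"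
        using S0 by (subst ennreal_plus) (auto simp: ennreal_mult)
      also have "\<dots> \<le> 2 * (ennreal (1 / m) * (\<integral>\<^sup>+ y. indicator (ball p \<delta>) y * ennreal ((u x - u y)\<^sup>2) \<partial>lborel)) + ennreal (2 * S)"
        using deviation_from_avg[OF u \<delta>(1), of x p] unfolding mb by (intro add_right_mono mult_left_mono) auto
      also have "\<dots> \<le> 2 * (ennreal (1 / m) * (\<integral>\<^sup>+ y. ?N x y \<partial>lborel)) + ennreal (2 * S)"
      proof (intro add_right_mono mult_left_mono nn_integral_mono)
        fix y
        have "norm (x - y) \<le> 2 * \<delta>" if "y \<in> ball p \<delta>"
          using p(2) that norm_triangle_ineq4[of "p - y" "p - x"] by (simp add: dist_norm)
        then show "indicator (ball p \<delta>) y * ennreal ((u x - u y)\<^sup>2) \<le> ?N x y"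
          by (auto simp: indicator_def)
      qed auto
      also have "2 * (ennreal (1 / m) * (\<integral>\<^sup>+ y. ?N x y \<partial>lborel)) = ennreal (2 / m) * (\<integral>\<^sup>+ y. ?N x y \<partial>lborel)"
      proof -
        have "2 * ennreal (1 / m) = ennreal (2 / m)"
          using m by (simp add: ennreal_numeral[symmetric] ennreal_mult[symmetric] del: ennreal_numeral)
        then show ?thesis by (simp add: mult.assoc[symmetric])
      qed
      finally show ?thesis .
    qed
    have near_part: "(\<integral>\<^sup>+ x. indicator \<Omega> x * (\<integral>\<^sup>+ y. ?N x y \<partial>lborel) \<partial>lborel) \<le> ennreal ((2 * \<delta>) powr ?p) * near_energy a 1 u"
    proof -
      have "(\<integral>\<^sup>+ x. indicator \<Omega> x * (\<integral>\<^sup>+ y. ?N x y \<partial>lborel) \<partial>lborel) = (\<integral>\<^sup>+ x. (\<integral>\<^sup>+ y. indicator \<Omega> x * ?N x y \<partial>lborel) \<partial>lborel)"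
        by (simp add: nn_integral_cmult)
      also have "\<dots> = (\<integral>\<^sup>+ z. indicator \<Omega> (fst z) * ?N (fst z) (snd z) \<partial>lborel2)"
        by (subst lborel.nn_integral_fst[symmetric]) simp_all
      also have "\<dots> \<le> (\<integral>\<^sup>+ z. ennreal ((2 * \<delta>) powr ?p) * (indicator (Qset \<Omega>) z * (indicator {z. norm (fst z - snd z) \<le> 1} z *
          ennreal ((u (fst z) - u (snd z))\<^sup>2 / norm (fst z - snd z) powr ?p))) \<partial>lborel2)"
      proof (rule nn_integral_mono)
        fix z :: "'a \<times> 'a"
        obtain x y where z: "z = (x, y)" by (cases z)
        show "indicator \<Omega> (fst z) * ?N (fst z) (snd z) \<le> ennreal ((2 * \<delta>) powr ?p) * (indicator (Qset \<Omega>) z * (indicator {z. norm (fst z - snd z) \<le> 1} z *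
          ennreal ((u (fst z) - u (snd z))\<^sup>2 / norm (fst z - snd z) powr ?p)))"
        proof (cases "x \<in> \<Omega> \<and> norm (x - y) \<le> 2 * \<delta>")
          case True
          have "(u x - u y)\<^sup>2 \<le> (2 * \<delta>) powr ?p * ((u x - u y)\<^sup>2 / norm (x - y) powr ?p)"
          proof (cases "x = y")
            case False
            have "norm (x - y) powr ?p \<le> (2 * \<delta>) powr ?p" using True a by (intro powr_mono2) auto
            then have "(u x - u y)\<^sup>2 * norm (x - y) powr ?p \<le> (u x - u y)\<^sup>2 * (2 * \<delta>) powr ?p" by (intro mult_left_mono) auto
            then show ?thesis using False by (simp add: field_simps)
          qed simp
          then have "ennreal ((u x - u y)\<^sup>2) \<le> ennreal ((2 * \<delta>) powr ?p * ((u x - u y)\<^sup>2 / norm (x - y) powr ?p))" by (rule ennreal_leI)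
          also have "\<dots> = ennreal ((2 * \<delta>) powr ?p) * ennreal ((u x - u y)\<^sup>2 / norm (x - y) powr ?p)"
            by (rule ennreal_mult) auto
          finally show ?thesis using True \<delta> by (simp add: z Qset_def)
        next
          case False then show ?thesis by (auto simp: z)
        qed
      qed
      also have "\<dots> = ennreal ((2 * \<delta>) powr ?p) * near_energy a 1 u"
        unfolding near_energy_def by (simp add: nn_integral_cmult)
      finally show ?thesis .
    qed
    have "ennreal (bform u u) = (\<integral>\<^sup>+ x. indicator \<Omega> x * ennreal ((u x)\<^sup>2) \<partial>lborel)"
      unfolding H_L2_norms(1)[OF u, symmetric] by (simp add: nn_integral_restrict_space mult.commute)
    also have "\<dots> \<le> (\<integral>\<^sup>+ x. ennreal (2 / m) * (indicator \<Omega> x * (\<integral>\<^sup>+ y. ?N x y \<partial>lborel)) + ennreal (2 * S) * indicator \<Omega> x \<partial>lborel)"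
    proof (rule nn_integral_mono)
      fix x show "indicator \<Omega> x * ennreal ((u x)\<^sup>2) \<le> ennreal (2 / m) * (indicator \<Omega> x * (\<integral>\<^sup>+ y. ?N x y \<partial>lborel)) + ennreal (2 * S) * indicator \<Omega> x"
        using pt[of x] by (cases "x \<in> \<Omega>") auto
    qed
    also have "\<dots> = ennreal (2 / m) * (\<integral>\<^sup>+ x. indicator \<Omega> x * (\<integral>\<^sup>+ y. ?N x y \<partial>lborel) \<partial>lborel) + ennreal (2 * S) * ennreal V"
      by (simp add: nn_integral_add nn_integral_cmult nn_integral_cmult_indicator eV)
    also have "\<dots> \<le> ennreal (2 / m) * (ennreal ((2 * \<delta>) powr ?p) * near_energy a 1 u) + ennreal (2 * S) * ennreal V"
      using near_part by (intro add_right_mono mult_left_mono) auto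
    also have "\<dots> \<le>
      ennreal (2 / m) * (ennreal ((2 * \<delta>) powr ?p) * ennreal (1 / \<kappa> * aform u u)) + ennreal (2 * S) * ennreal V"
      using near[OF u, of 1] by (intro add_right_mono mult_left_mono) auto
    also have "\<dots> = ennreal (2 / m * ((2 * \<delta>) powr ?p * (1 / \<kappa> * aform u u)) + 2 * S * V)"
      using m a a0 S0 eV(2) by (simp add: ennreal_mult[symmetric] ennreal_plus[symmetric] del: ennreal_plus)
    also have "2 / m * ((2 * \<delta>) powr ?p * (1 / \<kappa> * aform u u)) = K * \<delta> powr (2 * a) * aform u u"
    proof -
      have "(2 * \<delta>) powr ?p = 2 powr ?p * (\<delta> ^ DIM('a) * \<delta> powr (2 * a))"
        using \<delta> by (simp add: powr_mult powr_add powr_realpow)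
      then show ?thesis using \<delta> U by (simp add: K_def m_def field_simps)
    qed
    finally have "ennreal (bform u u) \<le> ennreal (K * \<delta> powr (2 * a) * aform u u + 2 * S * V)" by simp
    then have "bform u u \<le> K * \<delta> powr (2 * a) * aform u u + 2 * S * V"
      using K a0 S0 eV(2) by (subst (asm) ennreal_le_iff) auto
    also have "\<dots> \<le> e * aform u u + 2 * V * S" using \<delta>a a0 mult_right_mono[OF \<delta>a a0] by (simp add: mult_ac)
    finally show ?thesis by (simp add: S_def)
  qed
  then show ?thesis using P(1) eV(2) by (intro exI[of _ P] exI[of _ \<delta>] exI[of _ "2 * V"]) auto
qed

text \<open>The estimates for \<open>e = 1 / (n + 1)\<close>, over all \<open>n\<close>, involve
  only countably many averages. Along one subsequence all of these converge, and the estimates then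
  make the differences small.\<close>

lemma energy_compact:
  assumes w: "\<And>k. w k \<in> H" and bound: "\<And>k. aform (w k) (w k) + bform (w k) (w k) \<le> C"
  shows "\<exists>r::nat \<Rightarrow> nat. strict_mono r \<and> (\<forall>e>0. \<exists>K. \<forall>m\<ge>K. \<forall>n\<ge>K.
          quad bform (\<lambda>x. w (r m) x - w (r n) x) < e)"
proof -
  interpret A: psd_form H aform by (rule aform_psd)
  interpret B: psd_form H bform by (rule bform_psd)
  have C0: "C \<ge> 0" using bound[of 0] A.nonneg[OF w[of 0]] B.nonneg[OF w[of 0]] by linarith
  have "\<forall>n::nat. \<exists>P \<delta> c. finite P \<and> c \<ge> 0 \<and> (\<forall>u\<in>H. bform u u \<le> 1 / (real n + 1) * aform u u + c * (\<Sum>p\<in>P. (avg p \<delta> u)\<^sup>2))"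
    by (intro allI compactness_estimate) simp
  then obtain P \<delta> c where P: "\<And>n::nat. finite (P n)" "\<And>n. c n \<ge> 0"
    "\<And>n u. u \<in> H \<Longrightarrow> bform u u \<le> 1 / (real n + 1) * aform u u + c n * (\<Sum>p\<in>P n. (avg p (\<delta> n) u)\<^sup>2)"
    by metis
  define F where "F = (\<Union>n. (\<lambda>p. (p, \<delta> n)) ` P n)"
  have cF: "countable F" unfolding F_def by (rule countable_UN) (auto intro: countable_finite P(1))
  define l where "l k u = avg (fst (from_nat_into F k)) (snd (from_nat_into F k)) u" for k u
  have "\<forall>k. \<exists>M\<ge>0. \<forall>u\<in>H. (l k u)\<^sup>2 \<le> M * (aform u u + bform u u)"
    unfolding l_def using avg_bounded by blast
  then obtain M where M: "\<And>k. M k \<ge> 0" "\<And>k u. u \<in> H \<Longrightarrow> (l k u)\<^sup>2 \<le> M k * (aform u u + bform u u)" by metis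
  have "\<bar>l k (w n)\<bar> \<le> sqrt (M k * C)" for n k
  proof -
    have "(l k (w n))\<^sup>2 \<le> M k * C"
      using M(2)[OF w, of k n] mult_left_mono[OF bound[of n] M(1)[of k]] by linarith
    then show ?thesis using real_sqrt_le_mono by fastforce
  qed
  then obtain r :: "nat \<Rightarrow> nat" where r: "strict_mono r" "\<And>k. convergent (\<lambda>n. l k (w (r n)))"
    using bounded_sequences_compact[of "\<lambda>n k. l k (w n)" "\<lambda>k. sqrt (M k * C)"] by blast
  have avgc: "Cauchy (\<lambda>j. avg p (\<delta> n) (w (r j)))" if "p \<in> P n" for p n
  proof -
    have "(p, \<delta> n) \<in> F" using that by (auto simp: F_def)
    then obtain k where "from_nat_into F k = (p, \<delta> n)" using from_nat_into_surj[OF cF] by blast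
    then show ?thesis using r(2)[of k] by (simp add: l_def convergent_Cauchy)
  qed
  have "\<exists>K. \<forall>m\<ge>K. \<forall>n\<ge>K. quad bform (\<lambda>x. w (r m) x - w (r n) x) < e" if e: "e > 0" for e
  proof -
    \<comment> \<open>Differences of the sequence have energy at most \<open>4 * C\<close>, and
      \<open>N\<close> reduces its contribution below \<open>e / 2\<close>.\<close>
    obtain N :: nat where N: "8 * C / e < real N" using reals_Archimedean2 by blast
    have small: "1 / (real N + 1) * (4 * C) < e / 2"
      using N e C0 by (simp add: field_simps)
    \<comment> \<open>With this bound the averages together contribute at most \<open>e / 2\<close>;
      the 1 guards against a zero denominator.\<close>
    define h where "h = sqrt (e / (2 * (c N * real (card (P N)) + 1)))"
    have den: "c N * real (card (P N)) + 1 > 0" using P(2)[of N] by (simp add: add_nonneg_pos)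
    have h: "h > 0" using e den by (simp add: h_def)
    have "\<forall>p\<in>P N. \<exists>K. \<forall>m\<ge>K. \<forall>n\<ge>K. \<bar>avg p (\<delta> N) (w (r m)) - avg p (\<delta> N) (w (r n))\<bar> < h"
      using avgc h unfolding Cauchy_def dist_real_def by blast
    then obtain Kp where Kp: "\<And>p m n. p \<in> P N \<Longrightarrow> m \<ge> Kp p \<Longrightarrow> n \<ge> Kp p \<Longrightarrow> \<bar>avg p (\<delta> N) (w (r m)) - avg p (\<delta> N) (w (r n))\<bar> < h"
      by metis
    define K where "K = (\<Sum>p\<in>P N. Kp p)"
    have KpK: "Kp p \<le> K" if "p \<in> P N" for p
      unfolding K_def using that P(1) by (intro member_le_sum) auto
    show ?thesis
    proof (intro exI[of _ K] allI impI)
      fix m n assume mn: "m \<ge> K" "n \<ge> K"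
      let ?v = "\<lambda>x. w (r m) x - w (r n) x"
      have vH: "?v \<in> H" by (rule H_diff[OF w w])
      have "aform (w k) (w k) \<le> C" for k using bound[of k] B.nonneg[OF w[of k]] by linarith
      then have av: "aform ?v ?v \<le> 4 * C" using A.diff_diff_le[OF w w, of "r m" "r n"]
        by (smt (verit, ccfv_SIG))
      have "(\<Sum>p\<in>P N. (avg p (\<delta> N) ?v)\<^sup>2) \<le> (\<Sum>p\<in>P N. h\<^sup>2)"
      proof (rule sum_mono)
        fix p assume p: "p \<in> P N"
        have "\<bar>avg p (\<delta> N) ?v\<bar> \<le> \<bar>h\<bar>"
          using Kp[OF p, of m n] KpK[OF p] mn h by (simp add: avg_diff[OF w w])
        then show "(avg p (\<delta> N) ?v)\<^sup>2 \<le> h\<^sup>2" by (simp add: abs_le_square_iff)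
      qed
      then have "c N * (\<Sum>p\<in>P N. (avg p (\<delta> N) ?v)\<^sup>2) \<le> c N * (real (card (P N)) * h\<^sup>2)"
        using P(2)[of N] by (intro mult_left_mono) auto
      also have "\<dots> = c N * real (card (P N)) * (e / (2 * (c N * real (card (P N)) + 1)))"
        using e den by (simp add: h_def)
      also have "\<dots> \<le> e / 2" using e den by (simp add: field_simps)
      finally have 1: "c N * (\<Sum>p\<in>P N. (avg p (\<delta> N) ?v)\<^sup>2) \<le> e / 2" .
      have "1 / (real N + 1) * aform ?v ?v \<le> 1 / (real N + 1) * (4 * C)" by (rule mult_left_mono[OF av]) simp
      with small have 2: "1 / (real N + 1) * aform ?v ?v < e / 2" by (rule le_less_trans[rotated])
      show "bform ?v ?v < e" using P(3)[OF vH, of N] 1 2 by linarith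
    qed
  qed
  then show ?thesis using r(1) by blast
qed

end

section \<open>The Neumann spectrum\<close>

context neumann_problem
begin

lemma compact_form_pair: "compact_form_pair H aform bform"
  by (intro compact_form_pair.intro compact_form_pair_axioms.intro aform_psd bform_psd orthonormal_family
      energy_complete energy_compact) auto

text \<open>A point \<open>x\<close> of \<Omega> is paired with every point of the space, so
  vanishing weighted differences at one exponent force \<open>u y = u x\<close> for almost all
  \<open>y\<close>.\<close>

lemma zero_energy_AE_const:
  assumes u: "u \<in> H" and zero: "aform u u = 0"
  shows "\<exists>c. AE x in leb_on \<Omega>. u x = c"
proof -
  have [measurable]: "D u \<in> borel_measurable nonlocal_measure" by (rule D_measurable[OF HD(1)[OF u]])
  have "L2sq nonlocal_measure (D u) = 0"
    using H_L2_norms(2)[OF u] zero by simp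
  then have "AE p in nonlocal_measure. ennreal ((norm (D u p))\<^sup>2) = 0"
    by (subst (asm) nn_integral_0_iff_AE) auto
  then have "AE p in nonlocal_measure. D u p = 0" by eventually_elim simp
  from AE_\<mu>_ex[OF MP.AE_pair[OF this]] obtain s where s: "s \<in> {0<..<1}" "AE z in lborel2. D u (s, z) = 0" by blast
  from lborel_pair.AE_pair[OF s(2)] have "AE x in leb_on \<Omega>. AE y in lborel. D u (s, (x, y)) = 0"
    by (rule AE_leb_onI)
  from AE_leb_on_ex[OF this] obtain x where x: "x \<in> \<Omega>" "AE y in lborel. D u (s, (x, y)) = 0" by blast
  from x(2) AE_lborel_singleton[of x] have "AE y in lborel. u y = u x"
  proof eventually_elim
    fix y assume "D u (s, (x, y)) = 0" "y \<noteq> x"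
    then show "u y = u x" using kern_nonzero[OF s(1), of x y] x(1) by (auto simp: D_def Qset_def)
  qed
  then show ?thesis by (intro exI[of _ "u x"] AE_leb_onI)
qed

lemma aform_const: "quad aform (\<lambda>_. c) = 0"
proof -
  have "\<alpha> * (\<integral>x. wgrad \<Omega> (\<lambda>_. c) x \<bullet> wgrad \<Omega> (\<lambda>_. c) x \<partial>leb_on \<Omega>) = 0"
  proof -
    have sm: "smooth_fun (\<lambda>_::'a. c)" by (rule flat_algebra_smooth[OF flat_algebra.const])
    have "weak_grad \<Omega> (\<lambda>_. c) (\<lambda>_. 0)"
      using weak_grad_smooth[OF sm] by (simp add: frechet_derivative_const sq_integrable_def)
    from wgrad_AE_eq[OF this]
    have "AE x in leb_on \<Omega>. wgrad \<Omega> (\<lambda>_. c) x \<bullet> wgrad \<Omega> (\<lambda>_. c) x = 0" by eventually_elim simp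
    then show ?thesis by (simp add: integral_eq_zero_AE)
  qed
  moreover have "D (\<lambda>_. c) = (\<lambda>_. 0)" by (simp add: D_def fun_eq_iff)
  ultimately show ?thesis by (simp add: aform_def)
qed

lemma bform_const_pos: "quad bform (\<lambda>_. 1) > 0"
  using emeasure_\<Omega>_pos emeasure_bounded_finite[OF bounded_\<Omega>]
  by (simp add: bform_def measure_def emeasure_restrict_space space_restrict_space enn2real_positive_iff)

text \<open>Numbering starts at 0, so \<open>lam 0\<close> is the first eigenvalue. Beyond the
  abstract sequence it remains to show \<open>lam 0 = 0\<close>, the strict gap above it, and
  completeness for functions that lie only in \<open>L\<^sup>2\<close>.\<close>

theorem neumann_spectrum:
  "\<exists>(lam::nat \<Rightarrow> real) (u::nat \<Rightarrow> 'a \<Rightarrow> real).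
     (\<forall>i. neumann_eigenpair \<alpha> \<mu> \<Omega> (lam i) (u i)) \<and>
     lam 0 = 0 \<and> lam 0 < lam 1 \<and> (\<forall>i\<ge>1. lam i \<le> lam (Suc i)) \<and>
     (\<forall>i. L2_on \<Omega> (u i) \<and> (\<integral>x\<in>\<Omega>. (u i x)\<^sup>2 \<partial>lborel) > 0) \<and>
     (\<forall>i j. i \<noteq> j \<longrightarrow> (\<integral>x\<in>\<Omega>. u i x * u j x \<partial>lborel) = 0) \<and>
     (\<forall>f. L2_on \<Omega> f \<and> (\<forall>i. (\<integral>x\<in>\<Omega>. f x * u i x \<partial>lborel) = 0) \<longrightarrow>
        (AE x in lborel. x \<in> \<Omega> \<longrightarrow> f x = 0))"
proof -
  interpret compact_form_pair H aform bform by (rule compact_form_pair)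
  obtain u :: "nat \<Rightarrow> 'a \<Rightarrow> real" where uH: "\<And>n. u n \<in> H"
    and on: "\<And>i j. bform (u i) (u j) = (if i = j then 1 else 0)"
    and eig: "\<And>n w. w \<in> H \<Longrightarrow> aform (u n) w = aform (u n) (u n) * bform (u n) w"
    and ray: "\<And>n w. w \<in> H \<Longrightarrow> \<forall>i<n. bform w (u i) = 0 \<Longrightarrow> aform (u n) (u n) * bform w w \<le> aform w w"
    and mono: "\<And>n. aform (u n) (u n) \<le> aform (u (Suc n)) (u (Suc n))"
    and lim: "\<And>v. v \<in> H \<Longrightarrow> (\<lambda>n. quad bform (\<lambda>x. v x - (\<Sum>i<n. bform v (u i) * u i x))) \<longlonglongrightarrow> 0"
    by (rule eigenfunction_sequence) blast
  define lam where "lam n = aform (u n) (u n)" for n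
  \<comment> \<open>For \<open>n = 0\<close> the Rayleigh bound carries no orthogonality condition
    and may be tested with the constant 1.\<close>
  have lam0: "lam 0 = 0"
  proof -
    have "lam 0 * quad bform (\<lambda>_. 1) \<le> 0"
      using ray[of "\<lambda>_. 1" 0] const_in_H[of 1] aform_const[of 1] by (simp add: lam_def)
    then have "lam 0 \<le> 0" using bform_const_pos by (simp add: mult_le_0_iff)
    then show ?thesis using A.nonneg[OF uH, of 0] by (simp add: lam_def)
  qed
  \<comment> \<open>Otherwise two orthonormal functions would both be constant almost everywhere on
    \<Omega>, although constants span only one dimension.\<close>
  have lam1: "lam 1 \<noteq> 0"
  proof
    assume "lam 1 = 0"
    then obtain c0 c1 where c: "AE x in leb_on \<Omega>. u 0 x = c0" "AE x in leb_on \<Omega>. u 1 x = c1"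
      using zero_energy_AE_const[OF uH, of 0] zero_energy_AE_const[OF uH, of 1] lam0 by (auto simp: lam_def)
    have [measurable]: "u n \<in> borel_measurable (leb_on \<Omega>)" for n
      using HD(2)[OF uH] by (rule sq_integrable_measurable)
    define V :: real where "V = (\<integral>x. 1 \<partial>leb_on \<Omega>)"
    have "bform (u 0) (u 1) = (\<integral>x. c0 * c1 \<partial>leb_on \<Omega>)"
      unfolding bform_def using c by (intro integral_cong_AE) auto
    then have 01: "c0 * c1 * V = 0" using on[of 0 1] by (auto simp: V_def)
    have "bform (u 0) (u 0) = (\<integral>x. c0 * c0 \<partial>leb_on \<Omega>)"
      unfolding bform_def using c by (intro integral_cong_AE) auto
    then have 00: "c0 * c0 * V = 1" using on[of 0 0] by (simp add: V_def mult.commute)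
    have "bform (u 1) (u 1) = (\<integral>x. c1 * c1 \<partial>leb_on \<Omega>)"
      unfolding bform_def using c by (intro integral_cong_AE) auto
    then have 11: "c1 * c1 * V = 1" using on[of 1 1] by (simp add: V_def mult.commute)
    show False using 01 00 11 by auto
  qed
  have b_set: "(\<integral>x\<in>\<Omega>. v x * w x \<partial>lborel) = bform v w" for v w
    by (simp add: set_integral_leb_on bform_def)
  \<comment> \<open>\<open>f\<close> need not belong to \<open>H\<close>, so the argument uses the
    \<open>L\<^sup>2\<close> product: \<open>f\<close> has the same product with a test function as
    with its residual \<open>p n\<close>, whose norm tends to 0.\<close>
  have complete: "AE x in lborel. x \<in> \<Omega> \<longrightarrow> f x = 0"
    if f: "L2_on \<Omega> f" and orth: "\<And>i. (\<integral>x\<in>\<Omega>. f x * u i x \<partial>lborel) = 0" for f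
  proof (rule sq_integrable_orthogonal_test_fun_AE_zero)
    show fs: "sq_integrable (leb_on \<Omega>) f" using f by (simp add: L2_on_iff)
    interpret P: psd_form "{f. sq_integrable (leb_on \<Omega>) f}" "\<lambda>f g. \<integral>x. f x * g x \<partial>leb_on \<Omega>"
      by (rule sq_integrable_psd)
    fix \<phi> assume "test_fun \<Omega> \<phi>"
    then have \<phi>: "\<phi> \<in> H" by (rule test_fun_in_H)
    define p where "p n = (\<lambda>x. \<phi> x - (\<Sum>i<n. bform \<phi> (u i) * u i x))" for n
    have ps: "sq_integrable (leb_on \<Omega>) (p n)" for n
      using P.sub_sum_closed[of \<phi> n u "\<lambda>i. bform \<phi> (u i)"] HD(2)[OF \<phi>] HD(2)[OF uH] by (simp add: p_def)
    have pf: "(\<integral>x. p n x * f x \<partial>leb_on \<Omega>) = (\<integral>x. \<phi> x * f x \<partial>leb_on \<Omega>)" for n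
    proof -
      have "(\<integral>x. u i x * f x \<partial>leb_on \<Omega>) = 0" for i
        using orth[of i] by (simp add: set_integral_leb_on mult.commute)
      then show ?thesis
        using P.sub_sum[of \<phi> n u f "\<lambda>i. bform \<phi> (u i)"] HD(2)[OF \<phi>] HD(2)[OF uH] fs by (simp add: p_def)
    qed
    have bound: "\<bar>\<integral>x. \<phi> x * f x \<partial>leb_on \<Omega>\<bar> \<le> sqrt (bform (p n) (p n)) * sqrt (\<integral>x. f x * f x \<partial>leb_on \<Omega>)" for n
      using P.cauchy_schwarz[of "p n" f] ps[of n] fs by (simp add: pf bform_def)
    have "(\<lambda>n. sqrt (bform (p n) (p n)) * sqrt (\<integral>x. f x * f x \<partial>leb_on \<Omega>)) \<longlonglongrightarrow> sqrt 0 * sqrt (\<integral>x. f x * f x \<partial>leb_on \<Omega>)"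
      using lim[OF \<phi>] unfolding p_def by (intro tendsto_intros)
    then have "\<bar>\<integral>x. \<phi> x * f x \<partial>leb_on \<Omega>\<bar> \<le> sqrt 0 * sqrt (\<integral>x. f x * f x \<partial>leb_on \<Omega>)"
      using bound by (intro LIMSEQ_le_const) auto
    then show "(\<integral>x. f x * \<phi> x \<partial>leb_on \<Omega>) = 0" by (simp add: mult.commute)
  qed
  show ?thesis
  proof (intro exI[of _ lam] exI[of _ u] conjI allI impI)
    show "neumann_eigenpair \<alpha> \<mu> \<Omega> (lam i) (u i)" for i
      unfolding neumann_eigenpair_iff
    proof (intro conjI ballI)
      show "u i \<in> H" by (rule uH)
      show "\<exists>x. u i x \<noteq> 0"
      proof (rule ccontr)
        assume "\<not> (\<exists>x. u i x \<noteq> 0)"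
        then have "bform (u i) (u i) = 0" by (simp add: bform_def)
        then show False using on[of i i] by simp
      qed
      show "aform (u i) v = lam i * bform (u i) v" if "v \<in> H" for v using eig[OF that] by (simp add: lam_def)
    qed
    show "lam 0 = 0" by (rule lam0)
    show "lam 0 < lam 1" using lam0 lam1 A.nonneg[OF uH, of 1] by (simp add: lam_def less_le)
    show "lam i \<le> lam (Suc i)" for i using mono by (simp add: lam_def)
    show "L2_on \<Omega> (u i)" for i using HD(2)[OF uH] by (simp add: L2_on_iff)
    show "(\<integral>x\<in>\<Omega>. (u i x)\<^sup>2 \<partial>lborel) > 0" for i
      using b_set[of "u i" "u i"] on[of i i] by (simp add: power2_eq_square)
    show "(\<integral>x\<in>\<Omega>. u i x * u j x \<partial>lborel) = 0" if "i \<noteq> j" for i j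
      using b_set[of "u i" "u j"] on[of i j] that by simp
    show "AE x in lborel. x \<in> \<Omega> \<longrightarrow> f x = 0"
      if "L2_on \<Omega> f \<and> (\<forall>i. (\<integral>x\<in>\<Omega>. f x * u i x \<partial>lborel) = 0)" for f
      using that by (intro complete) auto
  qed
qed

end

theorem theorem1p4:
  fixes \<Omega> :: "'a::euclidean_space set" and \<alpha> :: real and \<mu> :: "real measure"
  assumes "lipschitz_domain \<Omega>" and "bounded \<Omega>" and "\<alpha> \<ge> 0" and "admissible_mu \<mu>"
  shows "\<exists>(lam::nat \<Rightarrow> real) (u::nat \<Rightarrow> 'a \<Rightarrow> real).
     (\<forall>i. neumann_eigenpair \<alpha> \<mu> \<Omega> (lam i) (u i)) \<and>
     lam 0 = 0 \<and> lam 0 < lam 1 \<and> (\<forall>i\<ge>1. lam i \<le> lam (Suc i)) \<and>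
     (\<forall>i. L2_on \<Omega> (u i) \<and> (\<integral>x\<in>\<Omega>. (u i x)\<^sup>2 \<partial>lborel) > 0) \<and>
     (\<forall>i j. i \<noteq> j \<longrightarrow> (\<integral>x\<in>\<Omega>. u i x * u j x \<partial>lborel) = 0) \<and>
     (\<forall>f. L2_on \<Omega> f \<and> (\<forall>i. (\<integral>x\<in>\<Omega>. f x * u i x \<partial>lborel) = 0) \<longrightarrow>
        (AE x in lborel. x \<in> \<Omega> \<longrightarrow> f x = 0))"
proof -
  interpret neumann_problem \<Omega> \<alpha> \<mu>
    using assms by unfold_locales (auto simp: lipschitz_domain_def)
  show ?thesis by (rule neumann_spectrum)
qed

end
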